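(* Let $\pi$ be a set of primes. If $\mathcal F$ is an $\mathfrak N^\pi$-Fitting set of a finite $\pi'$-soluble group $G$, then $G$ possesses exactly one conjugacy class of $\mathcal F$-injectors (that is, $\mathcal F$-injectors of $G$ exist, and they form a single conjugacy class of subgroups of $G$). Moreover, if $V$ and $V^*$ are $\mathcal F$-injectors of $G$, there exists $g\in G^{\mathfrak N^\pi}$ such that $(V^* )^g=V$. Also, if $I$ is an $\mathcal F$-injector of $G$ and $N$ is an $\mathfrak N^\pi$-Dnormal subgroup of $G$, then $I\cap N$ is an $\mathcal F$-injector of $N$.
   Context: All groups are finite. $\pi'$ is the complement of $\pi$ in the set of all primes. For a set of primes $\rho$, a group is $\rho$-separable if each of its composition factors is either a $\rho$-group or a $\rho'$-group; it is $\rho$-soluble if it is $\rho$-separable and each composition factor that is a $\rho$-group is a $p$-group for some prime $p\in\rho$. $\mathfrak N^\pi$ is the class of all groups $H\times K$ with $H$ a $\pi$-group and $K$ a nilpotent $\pi'$-group. For a group $X$, the $\mathfrak N^\pi$-residual $X^{\mathfrak N^\pi}$ is the smallest normal subgroup of $X$ whose quotient belongs to $\mathfrak N^\pi$. $O^\pi(X)$ is the smallest normal subgroup of $X$ whose quotient is a $\pi$-group. $\mathfrak N^\pi$-Dnormal subgroups: For a Sylow $p$-subgroup $G_p$ of a group $G$ and $H\le G$, write $G_p\searrow H$ if $G_p\cap H$ is a Sylow $p$-subgroup of $H$. A subgroup $H$ of $G$ is $\mathfrak N^\pi$-Dnormal in $G$ if (1) whenever $p\in\pi'$, $G_p\in\mathrm{Syl}_p(G)$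 and $G_p\searrow H$, then $G_p\le N_G(H)$; and (2) whenever $p\in\pi$, $G_p\in\mathrm{Syl}_p(G)$ and $G_p\searrow H$, then $G_p\le N_G(H)$ if $\pi=\{p\}$, and $G_p\le N_G(O^\pi(H))$ if $|\pi|\ge 2$. A subgroup $S$ of $G$ is $\mathfrak N^\pi$-Dsubnormal in $G$ if there is a chain $S=S_0\le S_1\le\cdots\le S_k=G$ with $S_i$ $\mathfrak N^\pi$-Dnormal in $S_{i+1}$ for $0\le i\le k-1$. A non-empty set $\mathcal F$ of subgroups of a group $G$ is an $\mathfrak N^\pi$-Fitting set of $G$ if: (FS1) if $T$ is an $\mathfrak N^\pi$-Dsubnormal subgroup of $S\in\mathcal F$, then $T\in\mathcal F$; (FS2) if $S,T\in\mathcal F$ and $S,T$ are $\mathfrak N^\pi$-Dnormal in $\langle S,T\rangle$, then $\langle S,T\rangle\in\mathcal F$; (FS3) if $S\in\mathcal F$ and $x\in G$, then $S^x\in\mathcal F$. For $H\le G$, an $\mathcal F$-injector of $H$ is a subgroup $V$ of $H$ such that, for every subnormal subgroup $K$ of $H$, $V\cap K$ is an $\mathcal F$-maximal subgroup of $K$, i.e. $V\cap K$ is maximal, with respect to inclusion, among the subgroups of $K$ belonging to $\mathcal F$. $A^x=x^{-1}Ax$. *)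

theory Defs
  imports
    "HOL-Algebra.Group_Action"
    "HOL-Algebra.Generated_Groups"
    "HOL-Algebra.SimpleGroups"
begin

text \<open>
  Subgroups of \<open>G\<close> are subsets of its carrier; a subgroup \<open>H\<close> regarded as a group in its own right
  is \<open>G\<lparr>carrier := H\<rparr>\<close>.  Predicates such as ``Dnormal in \<open>G\<close>'' or ``Sylow subgroup of \<open>G\<close>'' take the
  ambient group as an argument, so that they can be applied to \<open>G\<lparr>carrier := H\<rparr>\<close> as well.
\<close>

definition compl_primes :: "nat set \<Rightarrow> nat set"
  where "compl_primes \<pi> = {p. prime p \<and> p \<notin> \<pi>}"

definition conj_set :: "('a, 'b) monoid_scheme \<Rightarrow> 'a set \<Rightarrow> 'a \<Rightarrow> 'a set"
  where "conj_set G A x = inv\<^bsub>G\<^esub> x <#\<^bsub>G\<^esub> A #>\<^bsub>G\<^esub> x"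

definition pi_group :: "nat set \<Rightarrow> ('a, 'b) monoid_scheme \<Rightarrow> bool"
  where "pi_group \<rho> G \<longleftrightarrow>
    group G \<and> finite (carrier G) \<and> (\<forall>p. prime p \<longrightarrow> p dvd order G \<longrightarrow> p \<in> \<rho>)"

definition sylow_subgroup :: "nat \<Rightarrow> 'a set \<Rightarrow> ('a, 'b) monoid_scheme \<Rightarrow> bool"
  where "sylow_subgroup p P G \<longleftrightarrow> subgroup P G \<and> card P = p ^ multiplicity p (order G)"


subsection \<open>Composition factors, separable and soluble groups\<close>

definition composition_series :: "('a, 'b) monoid_scheme \<Rightarrow> 'a set list \<Rightarrow> bool"
  where "composition_series G Hs \<longleftrightarrow>
    Hs \<noteq> [] \<and> hd Hs = {\<one>\<^bsub>G\<^esub>} \<and> last Hs = carrier G \<and>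
    (\<forall>i. Suc i < length Hs \<longrightarrow>
      subgroup (Hs ! i) G \<and>
      Hs ! i \<lhd> G\<lparr>carrier := Hs ! Suc i\<rparr> \<and>
      simple_group (G\<lparr>carrier := Hs ! Suc i\<rparr> Mod Hs ! i))"

definition composition_factor :: "('a, 'b) monoid_scheme \<Rightarrow> 'a set monoid \<Rightarrow> bool"
  where "composition_factor G F \<longleftrightarrow>
    (\<exists>Hs i. composition_series G Hs \<and> Suc i < length Hs \<and>
      F = G\<lparr>carrier := Hs ! Suc i\<rparr> Mod Hs ! i)"

definition pi_separable :: "nat set \<Rightarrow> ('a, 'b) monoid_scheme \<Rightarrow> bool"
  where "pi_separable \<rho> G \<longleftrightarrow>
    (\<forall>F. composition_factor G F \<longrightarrow> pi_group \<rho> F \<or> pi_group (compl_primes \<rho>) F)"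

definition pi_soluble :: "nat set \<Rightarrow> ('a, 'b) monoid_scheme \<Rightarrow> bool"
  where "pi_soluble \<rho> G \<longleftrightarrow> pi_separable \<rho> G \<and>
    (\<forall>F. composition_factor G F \<longrightarrow> pi_group \<rho> F \<longrightarrow> (\<exists>p\<in>\<rho>. pi_group {p} F))"


subsection \<open>The class of products of a pi-group and a nilpotent pi'-group\<close>

fun lower_central :: "('a, 'b) monoid_scheme \<Rightarrow> nat \<Rightarrow> 'a set"
  where
    "lower_central G 0 = carrier G"
  | "lower_central G (Suc n) = generate G
       {inv\<^bsub>G\<^esub> x \<otimes>\<^bsub>G\<^esub> inv\<^bsub>G\<^esub> y \<otimes>\<^bsub>G\<^esub> x \<otimes>\<^bsub>G\<^esub> y | x y. x \<in> lower_central G n \<and> y \<in> carrier G}"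

definition nilpotent_group :: "('a, 'b) monoid_scheme \<Rightarrow> bool"
  where "nilpotent_group G \<longleftrightarrow> group G \<and> (\<exists>n. lower_central G n = {\<one>\<^bsub>G\<^esub>})"

text \<open>
  The factors may be taken over the element type of \<open>X\<close>, since both factors of a direct product
  embed into it.
\<close>

definition Npi_group :: "nat set \<Rightarrow> ('a, 'b) monoid_scheme \<Rightarrow> bool"
  where "Npi_group \<pi> X \<longleftrightarrow> group X \<and>
    (\<exists>(H :: 'a monoid) (K :: 'a monoid).
      pi_group \<pi> H \<and> nilpotent_group K \<and> pi_group (compl_primes \<pi>) K \<and> X \<cong> H \<times>\<times> K)"

text \<open>
  \<open>LEAST\<close> is with respect to inclusion.  The least elements exist when \<open>X\<close> is finite: both classes
  are closed under subgroups and under direct products of two members, so the normal subgroups in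
  question are closed under intersection, and \<open>carrier X\<close> is one of them.
\<close>

definition Npi_residual :: "nat set \<Rightarrow> ('a, 'b) monoid_scheme \<Rightarrow> 'a set"
  where "Npi_residual \<pi> X = (LEAST N. N \<lhd> X \<and> Npi_group \<pi> (X Mod N))"

definition pi_residual :: "nat set \<Rightarrow> ('a, 'b) monoid_scheme \<Rightarrow> 'a set"
  where "pi_residual \<pi> X = (LEAST N. N \<lhd> X \<and> pi_group \<pi> (X Mod N))"


subsection \<open>Dnormal and Dsubnormal subgroups\<close>

definition sylow_reduces :: "nat \<Rightarrow> 'a set \<Rightarrow> 'a set \<Rightarrow> ('a, 'b) monoid_scheme \<Rightarrow> bool"
  where "sylow_reduces p P H G \<longleftrightarrow> sylow_subgroup p (P \<inter> H) (G\<lparr>carrier := H\<rparr>)"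

text \<open>In the last clause \<open>p \<in> \<pi>\<close>, so \<open>\<pi> \<noteq> {p}\<close> says that \<open>\<pi>\<close> has at least two elements.\<close>

definition Npi_Dnormal :: "nat set \<Rightarrow> 'a set \<Rightarrow> ('a, 'b) monoid_scheme \<Rightarrow> bool"
  where "Npi_Dnormal \<pi> H G \<longleftrightarrow> subgroup H G \<and>
    (\<forall>p P. p \<in> compl_primes \<pi> \<longrightarrow> sylow_subgroup p P G \<longrightarrow> sylow_reduces p P H G \<longrightarrow>
      P \<subseteq> normalizer G H) \<and>
    (\<forall>p P. p \<in> \<pi> \<longrightarrow> sylow_subgroup p P G \<longrightarrow> sylow_reduces p P H G \<longrightarrow>
      (if \<pi> = {p} then P \<subseteq> normalizer G H
       else P \<subseteq> normalizer G (pi_residual \<pi> (G\<lparr>carrier := H\<rparr>))))"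

definition Npi_Dsubnormal :: "nat set \<Rightarrow> 'a set \<Rightarrow> ('a, 'b) monoid_scheme \<Rightarrow> bool"
  where "Npi_Dsubnormal \<pi> S G \<longleftrightarrow>
    (\<exists>(k :: nat) C. C 0 = S \<and> C k = carrier G \<and>
      (\<forall>i<k. subgroup (C i) G \<and> Npi_Dnormal \<pi> (C i) (G\<lparr>carrier := C (Suc i)\<rparr>)))"

definition subnormal :: "'a set \<Rightarrow> ('a, 'b) monoid_scheme \<Rightarrow> bool"
  where "subnormal S G \<longleftrightarrow>
    (\<exists>(k :: nat) C. C 0 = S \<and> C k = carrier G \<and>
      (\<forall>i<k. subgroup (C i) G \<and> C i \<lhd> G\<lparr>carrier := C (Suc i)\<rparr>))"


subsection \<open>Fitting sets and injectors\<close>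

definition Npi_Fitting_set :: "nat set \<Rightarrow> ('a, 'b) monoid_scheme \<Rightarrow> 'a set set \<Rightarrow> bool"
  where "Npi_Fitting_set \<pi> G \<F> \<longleftrightarrow>
    \<F> \<noteq> {} \<and> (\<forall>S\<in>\<F>. subgroup S G) \<and>
    (\<forall>S\<in>\<F>. \<forall>T. Npi_Dsubnormal \<pi> T (G\<lparr>carrier := S\<rparr>) \<longrightarrow> T \<in> \<F>) \<and>
    (\<forall>S\<in>\<F>. \<forall>T\<in>\<F>.
      Npi_Dnormal \<pi> S (G\<lparr>carrier := generate G (S \<union> T)\<rparr>) \<longrightarrow>
      Npi_Dnormal \<pi> T (G\<lparr>carrier := generate G (S \<union> T)\<rparr>) \<longrightarrow>
      generate G (S \<union> T) \<in> \<F>) \<and>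
    (\<forall>S\<in>\<F>. \<forall>x\<in>carrier G. conj_set G S x \<in> \<F>)"

definition maximal_in :: "('a, 'b) monoid_scheme \<Rightarrow> 'a set set \<Rightarrow> 'a set \<Rightarrow> 'a set \<Rightarrow> bool"
  where "maximal_in G \<F> K V \<longleftrightarrow>
    subgroup V (G\<lparr>carrier := K\<rparr>) \<and> V \<in> \<F> \<and>
    (\<forall>W\<in>\<F>. subgroup W (G\<lparr>carrier := K\<rparr>) \<longrightarrow> V \<subseteq> W \<longrightarrow> W = V)"

definition injector :: "('a, 'b) monoid_scheme \<Rightarrow> 'a set set \<Rightarrow> 'a set \<Rightarrow> 'a set \<Rightarrow> bool"
  where "injector G \<F> H V \<longleftrightarrow>
    subgroup V (G\<lparr>carrier := H\<rparr>) \<and>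
    (\<forall>K. subnormal K (G\<lparr>carrier := H\<rparr>) \<longrightarrow> maximal_in G \<F> K (V \<inter> K))"

end

theory Submission
  imports Defs "HOL-Algebra.Sylow" "HOL-Algebra.Multiplicative_Group"
begin

text \<open>
  Call \<open>\<pi>\<close> and the singletons \<open>{p}\<close> with \<open>p \<notin> \<pi>\<close> atoms.  A \<open>\<pi>'\<close>-soluble group has a normal series whose
  factors are \<open>\<rho>\<close>-groups for atoms \<open>\<rho>\<close>, and for every atom all \<open>\<rho>\<close>-subgroups lie in conjugates of one
  Hall \<open>\<rho>\<close>-subgroup.  Beyond the properties of an ordinary Fitting set, existence and uniqueness only
  need one consequence of the Dnormal axioms: if \<open>J/W\<close> is a \<open>\<rho>\<close>-group for an atom \<open>\<rho>\<close>, then two members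
  of \<open>\<F>\<close> between \<open>W\<close> and \<open>J\<close> lie in a third one.

  Hence, if \<open>H/K\<close> is a \<open>\<rho>\<close>-group, the \<open>\<F>\<close>-maximal subgroups of \<open>H\<close> above a given \<open>\<F>\<close>-maximal subgroup
  of \<open>K\<close> are conjugate under \<open>K\<close>, which gives uniqueness of injectors by induction.  For existence, let
  \<open>V\<close> be \<open>\<F>\<close>-maximal in \<open>H\<close> above an injector of \<open>K\<close>; one has to show that \<open>V \<inter> M\<close> is an injector of \<open>M\<close>
  for every other normal \<open>M\<close> with atomic quotient.  If the atoms of \<open>H/K\<close> and \<open>H/M\<close> differ, this asks for
  injectors of \<open>K\<close> and \<open>M\<close> that agree on \<open>M \<inter> K\<close> and normalize each other.  Both are unique in
  the Hall subgroups containing them, and this weak closure lets one push the relation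
  \<open>[P, Q\<^sup>d] \<le> N\<close> down a normal series from \<open>N = M \<inter> K\<close> to \<open>N = M \<inter> K \<inter> V\<close>.

  The normalizer of an injector supplements every normal subgroup with atomic quotient, hence also the
  residual; and a Dnormal subgroup \<open>N\<close> is normalized by \<open>O\<^sup>\<pi>(G)\<close> if \<open>|\<pi>| \<noteq> 1\<close>, and normal otherwise.
\<close>


section \<open>Subgroups, indices and conjugation in a finite group\<close>

text \<open>A \<pi>-factor may be insoluble, so nothing is known inside it. Hall subgroups exist
  because the coprime factors met on the way are p-groups with p outside \<pi>; these are cut into
  abelian layers, where complements and their conjugacy come from averaging a crossed homomorphism.
  Everything is phrased for subgroups of the one group G lying between W and H, not for H/W, since
  \<F> has no image in a quotient.

  The obstacle to existence is that H/(M \<inter> K) may involve two atoms. There two members of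
  \<F> need not lie in a third, and only mutually normalizing members can be multiplied; a priori
  injectors of K and M commute only modulo M \<inter> K.

  Conjugating elements are always found in the smaller normal subgroup. This keeps intersections
  with it under control in the induction, and it is also what makes the Frattini argument for
  normalizers of injectors work.

  If |\<pi>| is not 1, every subgroup between W and J is Dnormal in J when J/W is a \<pi>-group;
  this gives both joins in \<F> and inheritance by intermediate subgroups. If |\<pi>| = 1,
  subnormality of subgroups of p-groups replaces it for the joins.\<close>

definition pi_number :: "nat set \<Rightarrow> nat \<Rightarrow> bool"
  where "pi_number \<rho> n \<longleftrightarrow> n > 0 \<and> (\<forall>p. prime p \<longrightarrow> p dvd n \<longrightarrow> p \<in> \<rho>)"

lemma pi_number_pos: "pi_number \<rho> n \<Longrightarrow> n > 0"
  by (simp add: pi_number_def)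

lemma pi_number_1 [simp]: "pi_number \<rho> 1" "pi_number \<rho> (Suc 0)"
  by (auto simp: pi_number_def)

lemma pi_number_mult_iff: "pi_number \<rho> (a * b) \<longleftrightarrow> pi_number \<rho> a \<and> pi_number \<rho> b"
  by (auto simp: pi_number_def prime_dvd_mult_iff)

lemma pi_number_dvd: "pi_number \<rho> b \<Longrightarrow> a dvd b \<Longrightarrow> pi_number \<rho> a"
  by (auto simp: pi_number_mult_iff elim: dvdE)

lemma pi_number_mono: "pi_number \<rho> a \<Longrightarrow> \<rho> \<subseteq> \<sigma> \<Longrightarrow> pi_number \<sigma> a"
  by (auto simp: pi_number_def)

lemma pi_number_coprime:
  assumes "pi_number \<rho> a" "pi_number \<sigma> b" "\<rho> \<inter> \<sigma> = {}"
  shows "coprime a b"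
proof (rule ccontr)
  assume "\<not> coprime a b"
  then have "gcd a b \<noteq> 1" by (simp add: coprime_iff_gcd_eq_1)
  then obtain p where p: "prime p" "p dvd gcd a b"
    using prime_factor_nat by blast
  then have "p dvd a" "p dvd b" by auto
  with p assms show False
    unfolding pi_number_def by blast
qed

lemma pi_number_disjoint: "pi_number \<rho> a \<Longrightarrow> pi_number \<sigma> a \<Longrightarrow> \<rho> \<inter> \<sigma> = {} \<Longrightarrow> a = 1"
  using pi_number_coprime[of \<rho> a \<sigma> a] by simp

lemma pi_number_prime_power: "prime p \<Longrightarrow> pi_number {p} n \<Longrightarrow> \<exists>k. n = p ^ k"
proof -
  assume p: "prime p" "pi_number {p} n"
  then have "n \<noteq> 0" "\<not> is_unit p" using pi_number_pos by (auto simp: prime_nat_iff)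
  then obtain m where m: "n = p ^ multiplicity p n * m" "\<not> p dvd m"
    using multiplicity_decompose' by metis
  have "m = 1"
  proof (rule ccontr)
    assume "m \<noteq> 1"
    then obtain q where q: "prime q" "q dvd m" using prime_factor_nat by blast
    then have "q dvd n" using m(1) by (metis dvd_mult)
    then have "q = p" using q p by (auto simp: pi_number_def)
    then show False using q m by simp
  qed
  then show ?thesis using m(1) by (metis mult.right_neutral)
qed

text \<open>The division is exact once \<open>K\<close> is a subgroup inside the subgroup
  \<open>H\<close> (\<open>idx_card\<close>). Being a quotient of cardinalities, \<open>idx\<close>
  also applies to products \<open>A <#> B\<close> that are not known to be subgroups.\<close>

definition idx :: "'a set \<Rightarrow> 'a set \<Rightarrow> nat"
  where "idx H K = card H div card K"

locale finite_group = group G for G (structure) +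
  assumes fin: "finite (carrier G)"
begin

abbreviation sub :: "'a set \<Rightarrow> bool" where "sub H \<equiv> subgroup H G"

text \<open>Conjugation is a right action, which fixes the order of the factors in
  \<open>cj_mult\<close>. On subsets of the carrier it agrees with \<open>conj_set\<close>
  (\<open>conj_set_eq\<close>); the image form suits elementwise reasoning.\<close>

definition cj :: "'a \<Rightarrow> 'a set \<Rightarrow> 'a set"
  where "cj x A = (\<lambda>a. inv x \<otimes> a \<otimes> x) ` A"

definition normalizes :: "'a set \<Rightarrow> 'a set \<Rightarrow> bool"
  where "normalizes B A \<longleftrightarrow> (\<forall>b\<in>B. cj b A = A)"

text \<open>Normality as a relation between subsets of the one ambient group, which avoids nested
  restricted group structures. \<open>normal_iff_nml\<close> translates.\<close>

definition nml :: "'a set \<Rightarrow> 'a set \<Rightarrow> bool"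
  where "nml N H \<longleftrightarrow> sub N \<and> sub H \<and> N \<subseteq> H \<and> normalizes H N"

lemma sub_carrier: "sub H \<Longrightarrow> H \<subseteq> carrier G"
  by (rule subgroup.subset)

lemma sub_fin: "sub H \<Longrightarrow> finite H"
  using fin finite_subset sub_carrier by blast

lemma card_sub_pos: "sub H \<Longrightarrow> card H > 0"
  using subgroup.finite_imp_card_positive fin by blast

lemma inv_cancel_l [simp]:
  "x \<in> carrier G \<Longrightarrow> y \<in> carrier G \<Longrightarrow> inv x \<otimes> (x \<otimes> y) = y"
  "x \<in> carrier G \<Longrightarrow> y \<in> carrier G \<Longrightarrow> x \<otimes> (inv x \<otimes> y) = y"
  by (simp_all flip: m_assoc)

lemma sub_restrict: "sub H \<Longrightarrow> subgroup K (G\<lparr>carrier := H\<rparr>) \<longleftrightarrow> sub K \<and> K \<subseteq> H"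
proof -
  assume H: "sub H"
  have "K \<subseteq> H" if "subgroup K (G\<lparr>carrier := H\<rparr>)"
    using subgroup.subset[OF that] by simp
  then show ?thesis using H incl_subgroup subgroup_incl by blast
qed

lemma lagrange_dvd:
  assumes "sub H" "sub K" "K \<subseteq> H"
  shows "card K dvd card H"
proof -
  interpret H: group "G\<lparr>carrier := H\<rparr>" using assms subgroup_imp_group by blast
  have "card (rcosets\<^bsub>G\<lparr>carrier := H\<rparr>\<^esub> K) * card K = order (G\<lparr>carrier := H\<rparr>)"
    using H.lagrange assms sub_restrict by blast
  then have "card (rcosets\<^bsub>G\<lparr>carrier := H\<rparr>\<^esub> K) * card K = card H" by (simp add: order_def)
  then show ?thesis by (metis dvd_triv_right)
qed

lemma idx_card: "sub H \<Longrightarrow> sub K \<Longrightarrow> K \<subseteq> H \<Longrightarrow> card H = idx H K * card K"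
  by (simp add: idx_def lagrange_dvd)

lemma idx_pos: "sub H \<Longrightarrow> sub K \<Longrightarrow> K \<subseteq> H \<Longrightarrow> idx H K > 0"
  using idx_card[of H K] card_sub_pos[of H] by (cases "idx H K") auto

lemma idx_eqI: "sub K \<Longrightarrow> card H = n * card K \<Longrightarrow> idx H K = n"
  using card_sub_pos[of K] by (simp add: idx_def)

lemma idx_trans:
  assumes "sub H" "sub K" "sub L" "L \<subseteq> K" "K \<subseteq> H"
  shows "idx H L = idx H K * idx K L"
  using assms idx_card[of H K] idx_card[of K L] by (intro idx_eqI) auto

lemma idx_self [simp]: "sub H \<Longrightarrow> idx H H = 1"
  using card_sub_pos[of H] by (simp add: idx_def)

lemma idx_1D: "sub H \<Longrightarrow> sub K \<Longrightarrow> K \<subseteq> H \<Longrightarrow> idx H K = 1 \<Longrightarrow> K = H"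
  using idx_card[of H K] card_subset_eq[OF sub_fin] by simp

lemma idx_dvd_l: "\<lbrakk>sub H; sub K; sub L; L \<subseteq> K; K \<subseteq> H\<rbrakk> \<Longrightarrow> idx H K dvd idx H L"
  and idx_dvd_r: "\<lbrakk>sub H; sub K; sub L; L \<subseteq> K; K \<subseteq> H\<rbrakk> \<Longrightarrow> idx K L dvd idx H L"
  using idx_trans[of H K L] by auto

lemma one_in: "sub H \<Longrightarrow> \<one> \<in> H"
  by (rule subgroup.one_closed)

lemma sub_Int: "sub H \<Longrightarrow> sub K \<Longrightarrow> sub (H \<inter> K)"
  by (rule subgroups_Inter_pair)

lemma sub_carrier_self: "sub (carrier G)"
  by (rule subgroup_self)

lemma sub_memD:
  "sub H \<Longrightarrow> x \<in> H \<Longrightarrow> x \<in> carrier G"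
  "sub H \<Longrightarrow> x \<in> H \<Longrightarrow> inv x \<in> H"
  "sub H \<Longrightarrow> x \<in> H \<Longrightarrow> y \<in> H \<Longrightarrow> x \<otimes> y \<in> H"
  using subgroup.mem_carrier subgroup.m_inv_closed subgroup.m_closed by fast+

lemma cj_mem_iff:
  assumes "x \<in> carrier G" "A \<subseteq> carrier G"
  shows "y \<in> cj x A \<longleftrightarrow> y \<in> carrier G \<and> x \<otimes> y \<otimes> inv x \<in> A"
proof
  assume "y \<in> cj x A"
  then obtain a where a: "a \<in> A" "y = inv x \<otimes> a \<otimes> x" unfolding cj_def by blast
  then have c: "a \<in> carrier G" using assms(2) by blast
  then have "x \<otimes> y \<otimes> inv x = a" unfolding a(2) using assms(1) by (simp add: m_assoc)
  then show "y \<in> carrier G \<and> x \<otimes> y \<otimes> inv x \<in> A"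
    using a c assms(1) by simp
next
  assume y: "y \<in> carrier G \<and> x \<otimes> y \<otimes> inv x \<in> A"
  then have "y = inv x \<otimes> (x \<otimes> y \<otimes> inv x) \<otimes> x" using assms(1) by (simp add: m_assoc)
  then show "y \<in> cj x A"
    unfolding cj_def using y by blast
qed

lemma conj_set_eq: "x \<in> carrier G \<Longrightarrow> A \<subseteq> carrier G \<Longrightarrow> conj_set G A x = cj x A"
  unfolding conj_set_def cj_def l_coset_def r_coset_def by blast

lemma cj_carrier: "x \<in> carrier G \<Longrightarrow> A \<subseteq> carrier G \<Longrightarrow> cj x A \<subseteq> carrier G"
  using cj_mem_iff by blast

lemma cj_mult:
  assumes "x \<in> carrier G" "y \<in> carrier G" "A \<subseteq> carrier G"
  shows "cj y (cj x A) = cj (x \<otimes> y) A"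
  unfolding cj_def image_image
proof (rule image_cong[OF refl])
  fix a assume "a \<in> A"
  then have "a \<in> carrier G" using assms by blast
  then show "inv y \<otimes> (inv x \<otimes> a \<otimes> x) \<otimes> y = inv (x \<otimes> y) \<otimes> a \<otimes> (x \<otimes> y)"
    using assms(1,2) by (simp add: m_assoc inv_mult_group)
qed

lemma cj_one [simp]:
  assumes "A \<subseteq> carrier G"
  shows "cj \<one> A = A"
proof -
  have "inv \<one> \<otimes> a \<otimes> \<one> = a" if "a \<in> A" for a
    using that assms by (simp add: subset_iff)
  then show ?thesis unfolding cj_def by simp
qed

lemma cj_inv_cancel [simp]:
  assumes "x \<in> carrier G" "A \<subseteq> carrier G"
  shows "cj (inv x) (cj x A) = A" "cj x (cj (inv x) A) = A"
  using assms by (simp_all add: cj_mult)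

lemma cj_mono: "A \<subseteq> B \<Longrightarrow> cj x A \<subseteq> cj x B"
  unfolding cj_def by blast

lemma cj_eq_swap:
  assumes "x \<in> carrier G" "A \<subseteq> carrier G" "B \<subseteq> carrier G"
  shows "cj x A = B \<longleftrightarrow> A = cj (inv x) B"
proof
  show "A = cj (inv x) B" if "cj x A = B" using that cj_inv_cancel(1)[OF assms(1,2)] by simp
  show "cj x A = B" if "A = cj (inv x) B" using that cj_inv_cancel(2)[OF assms(1,3)] by simp
qed

lemma cj_inj:
  assumes "x \<in> carrier G" "A \<subseteq> carrier G"
  shows "inj_on (\<lambda>a. inv x \<otimes> a \<otimes> x) A"
proof (rule inj_onI)
  fix a b assume "a \<in> A" "b \<in> A" and e: "inv x \<otimes> a \<otimes> x = inv x \<otimes> b \<otimes> x"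
  then have "a \<in> carrier G" "b \<in> carrier G" using assms by auto
  then show "a = b" using e assms(1) by simp
qed

lemma cj_Int:
  assumes "x \<in> carrier G" "A \<subseteq> carrier G" "B \<subseteq> carrier G"
  shows "cj x (A \<inter> B) = cj x A \<inter> cj x B"
  unfolding cj_def by (rule inj_on_image_Int[OF cj_inj[OF assms(1) subset_refl[of "carrier G"]] assms(2,3)])

lemma card_cj [simp]: "x \<in> carrier G \<Longrightarrow> A \<subseteq> carrier G \<Longrightarrow> card (cj x A) = card A"
  unfolding cj_def by (simp add: card_image cj_inj)

lemma idx_cj [simp]: "x \<in> carrier G \<Longrightarrow> A \<subseteq> carrier G \<Longrightarrow> B \<subseteq> carrier G \<Longrightarrow> idx (cj x A) (cj x B) = idx A B"
  by (simp add: idx_def)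

lemma sub_cj:
  assumes "x \<in> carrier G" "sub H"
  shows "sub (cj x H)"
proof (rule subgroupI)
  show "cj x H \<subseteq> carrier G" using assms cj_carrier sub_carrier by blast
  show "cj x H \<noteq> {}" using one_in[OF assms(2)] unfolding cj_def by blast
next
  note H = sub_memD[OF assms(2)]
  { fix a assume "a \<in> cj x H"
    then obtain h where h: "h \<in> H" "a = inv x \<otimes> h \<otimes> x" unfolding cj_def by blast
    then have "inv a = inv x \<otimes> inv h \<otimes> x" using H(1) assms(1) by (simp add: inv_mult_group m_assoc)
    then show "inv a \<in> cj x H" unfolding cj_def using h H by blast }
  fix a b assume "a \<in> cj x H" "b \<in> cj x H"
  then obtain h k where h: "h \<in> H" "a = inv x \<otimes> h \<otimes> x" "k \<in> H" "b = inv x \<otimes> k \<otimes> x"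
    unfolding cj_def by blast
  then have "a \<otimes> b = inv x \<otimes> (h \<otimes> k) \<otimes> x" using H(1) assms(1) by (simp add: m_assoc)
  then show "a \<otimes> b \<in> cj x H" unfolding cj_def using h H by blast
qed

lemma cj_self: "sub H \<Longrightarrow> h \<in> H \<Longrightarrow> cj h H = H"
proof -
  assume H: "sub H" "h \<in> H"
  then have "cj h H \<subseteq> H" unfolding cj_def using sub_memD by auto
  then show ?thesis
    using H card_subset_eq[OF sub_fin] card_cj sub_carrier by (meson subgroup.mem_carrier)
qed

lemma cj_subset_sub: "sub H \<Longrightarrow> h \<in> H \<Longrightarrow> A \<subseteq> H \<Longrightarrow> cj h A \<subseteq> H"
  using cj_self cj_mono by metis

lemma cj_eqI: "sub A \<Longrightarrow> x \<in> carrier G \<Longrightarrow> cj x A \<subseteq> A \<Longrightarrow> cj x A = A"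
  using card_subset_eq[OF sub_fin] card_cj sub_carrier by meson

lemma normalizesD: "normalizes B A \<Longrightarrow> b \<in> B \<Longrightarrow> cj b A = A"
  by (simp add: normalizes_def)

lemma normalizes_elem: "normalizes B A \<Longrightarrow> b \<in> B \<Longrightarrow> a \<in> A \<Longrightarrow> inv b \<otimes> a \<otimes> b \<in> A"
  unfolding normalizes_def cj_def by blast

lemma normalizesI: 
  "sub A \<Longrightarrow> B \<subseteq> carrier G \<Longrightarrow> (\<And>a b. a \<in> A \<Longrightarrow> b \<in> B \<Longrightarrow> inv b \<otimes> a \<otimes> b \<in> A) \<Longrightarrow> normalizes B A"
  unfolding normalizes_def
proof
  fix b assume a: "sub A" "B \<subseteq> carrier G" "\<And>a b. a \<in> A \<Longrightarrow> b \<in> B \<Longrightarrow> inv b \<otimes> a \<otimes> b \<in> A" "b \<in> B"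
  then have "cj b A \<subseteq> A" unfolding cj_def by blast
  then show "cj b A = A" using a cj_eqI by blast
qed

lemma normalizes_mono: "normalizes B A \<Longrightarrow> C \<subseteq> B \<Longrightarrow> normalizes C A"
  by (auto simp: normalizes_def)

lemma normalizes_Int: 
  "normalizes B A \<Longrightarrow> normalizes B C \<Longrightarrow> A \<subseteq> carrier G \<Longrightarrow> C \<subseteq> carrier G \<Longrightarrow> B \<subseteq> carrier G \<Longrightarrow> normalizes B (A \<inter> C)"
  unfolding normalizes_def
proof
  fix b assume a: "\<forall>b\<in>B. cj b A = A" "\<forall>b\<in>B. cj b C = C" "A \<subseteq> carrier G" "C \<subseteq> carrier G"
    "B \<subseteq> carrier G" "b \<in> B"
  then have "b \<in> carrier G" by blast
  then show "cj b (A \<inter> C) = A \<inter> C" using a by (simp add: cj_Int)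
qed

lemma normalizes_self: "sub A \<Longrightarrow> B \<subseteq> A \<Longrightarrow> normalizes B A"
  by (auto simp: normalizes_def cj_self)

lemma normalizes_cj:
  assumes "normalizes B A" "x \<in> carrier G" "A \<subseteq> carrier G" "B \<subseteq> carrier G"
  shows "normalizes (cj x B) (cj x A)"
proof -
  have "cj (inv x \<otimes> b \<otimes> x) (cj x A) = cj x A" if "b \<in> B" for b
  proof -
    have b: "b \<in> carrier G" using that assms by auto
    have "cj (inv x \<otimes> b \<otimes> x) (cj x A) = cj x (cj b A)"
      using assms b by (simp add: cj_mult m_assoc)
    then show ?thesis using that assms by (simp add: normalizesD)
  qed
  then show ?thesis by (auto simp: normalizes_def cj_def[of x B])
qed

lemma nmlD:
  assumes "nml N H"
  shows "sub N" "sub H" "N \<subseteq> H" "normalizes H N" "\<And>h. h \<in> H \<Longrightarrow> cj h N = N"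
  using assms by (auto simp: nml_def normalizes_def)

lemma nmlI: "sub N \<Longrightarrow> sub H \<Longrightarrow> N \<subseteq> H \<Longrightarrow> normalizes H N \<Longrightarrow> nml N H"
  by (simp add: nml_def)

lemma nml_self: "sub H \<Longrightarrow> nml H H"
  by (simp add: nml_def normalizes_self)

lemma nml_one: "sub H \<Longrightarrow> nml {\<one>} H"
  by (rule nmlI[OF triv_subgroup]) (auto simp: normalizes_def cj_def sub_memD intro: one_in)

lemma nml_restrict: "nml N H \<Longrightarrow> sub K \<Longrightarrow> N \<subseteq> K \<Longrightarrow> K \<subseteq> H \<Longrightarrow> nml N K"
  by (meson nmlI nmlD normalizes_mono)

lemma nml_Int_sub:
  assumes "nml N H" "sub L" "L \<subseteq> H"
  shows "nml (N \<inter> L) L"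
proof (rule nmlI)
  note N = nmlD(1-4)[OF assms(1)]
  show "sub (N \<inter> L)" using N assms sub_Int by blast
  show "normalizes L (N \<inter> L)"
    by (rule normalizes_Int[OF normalizes_mono[OF N(4) assms(3)] normalizes_self[OF assms(2) subset_refl]])
      (use N assms sub_carrier in simp_all)
qed (use assms in auto)

lemma nml_Int:
  assumes "nml N H" "nml M H"
  shows "nml (N \<inter> M) H"
proof (rule nmlI)
  note N = nmlD(1-4)[OF assms(1)] nmlD(1-4)[OF assms(2)]
  show "sub (N \<inter> M)" using N sub_Int by blast
  show "normalizes H (N \<inter> M)"
    by (rule normalizes_Int) (use N assms sub_carrier in simp_all)
  show "N \<inter> M \<subseteq> H" using N by blast
qed (use assms nmlD in auto)

lemma nml_cj:
  assumes "nml N H" "x \<in> carrier G"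
  shows "nml (cj x N) (cj x H)"
  using nmlD(1-4)[OF assms(1)] assms(2) by (intro nmlI sub_cj normalizes_cj cj_mono sub_carrier)

lemma normal_iff_nml: "sub H \<Longrightarrow> N \<lhd> G\<lparr>carrier := H\<rparr> \<longleftrightarrow> nml N H"
proof -
  assume H: "sub H"
  interpret H: group "G\<lparr>carrier := H\<rparr>" using H subgroup_imp_group by blast
  show ?thesis
  proof
    assume N: "N \<lhd> G\<lparr>carrier := H\<rparr>"
    then have s: "sub N" "N \<subseteq> H" using H normal_imp_subgroup sub_restrict by blast+
    have "inv b \<otimes> a \<otimes> b \<in> N" if "a \<in> N" "b \<in> H" for a b
      using normal.inv_op_closed1[OF N, of b a] that H by simp
    then show "nml N H" using s H by (intro nmlI normalizesI) (auto simp: sub_carrier)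
  next
    assume N: "nml N H"
    have "b \<otimes> a \<otimes> inv b \<in> N" if "a \<in> N" "b \<in> H" for a b
      using normalizes_elem[OF nmlD(4)[OF N], of "inv b" a] that H sub_memD by simp
    then show "N \<lhd> G\<lparr>carrier := H\<rparr>" using nmlD[OF N] H
      by (auto simp: H.normal_inv_iff sub_restrict)
  qed
qed

section \<open>Products of subgroups and their indices\<close>

lemma set_mult_mem: "x \<in> A <#> B \<longleftrightarrow> (\<exists>a\<in>A. \<exists>b\<in>B. x = a \<otimes> b)"
  unfolding set_mult_def by auto

lemma set_mult_memI: "a \<in> A \<Longrightarrow> b \<in> B \<Longrightarrow> a \<otimes> b \<in> A <#> B"
  using set_mult_mem by blast

lemma sub_set_mult:
  assumes "sub A" "sub B" "normalizes B A"
  shows "sub (A <#> B)"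
proof (rule subgroupI)
  show "A <#> B \<subseteq> carrier G" using assms sub_carrier by (simp add: setmult_subset_G)
  show "A <#> B \<noteq> {}" using one_in[OF assms(1)] one_in[OF assms(2)] set_mult_memI by blast
next
  have conj: "b \<otimes> a \<otimes> inv b \<in> A" if "a \<in> A" "b \<in> B" for a b
    using normalizes_elem[OF assms(3), of "inv b" a] that assms sub_memD by simp
  { fix x assume "x \<in> A <#> B"
    then obtain a b where ab: "a \<in> A" "b \<in> B" "x = a \<otimes> b" using set_mult_mem by blast
    then have "inv x = (inv b \<otimes> inv a \<otimes> b) \<otimes> inv b"
      using assms sub_memD(1) by (simp add: inv_mult_group m_assoc)
    moreover have "inv b \<otimes> inv a \<otimes> b \<in> A"
      using ab assms normalizes_elem sub_memD by blast
    ultimately show "inv x \<in> A <#> B" using ab assms set_mult_memI sub_memD by metis }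
  fix x y assume "x \<in> A <#> B" "y \<in> A <#> B"
  then obtain a b c d where ab: "a \<in> A" "b \<in> B" "x = a \<otimes> b" "c \<in> A" "d \<in> B" "y = c \<otimes> d"
    using set_mult_mem by metis
  then have "x \<otimes> y = (a \<otimes> (b \<otimes> c \<otimes> inv b)) \<otimes> (b \<otimes> d)"
    using assms sub_memD(1) by (simp add: m_assoc)
  then show "x \<otimes> y \<in> A <#> B" using ab conj assms set_mult_memI sub_memD(3) by metis
qed

lemma set_mult_upper: 
  "sub A \<Longrightarrow> sub B \<Longrightarrow> A \<subseteq> A <#> B" "sub A \<Longrightarrow> sub B \<Longrightarrow> B \<subseteq> A <#> B"
proof -
  assume s: "sub A" "sub B"
  have "a \<in> A <#> B" if "a \<in> A" for a
    using set_mult_memI[OF that one_in[OF s(2)]] s that sub_memD(1) by simp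
  then show "A \<subseteq> A <#> B" by blast
  have "a \<in> A <#> B" if "a \<in> B" for a
    using set_mult_memI[OF one_in[OF s(1)] that] s that sub_memD(1) by simp
  then show "B \<subseteq> A <#> B" by blast
qed

lemma set_mult_least: "sub H \<Longrightarrow> A \<subseteq> H \<Longrightarrow> B \<subseteq> H \<Longrightarrow> A <#> B \<subseteq> H"
  unfolding set_mult_def using sub_memD(3) by blast

lemma set_mult_absorb: "sub A \<Longrightarrow> sub B \<Longrightarrow> B \<subseteq> A \<Longrightarrow> A <#> B = A"
  using set_mult_upper(1) set_mult_least by (metis subset_antisym subset_refl)

lemma set_mult_absorb2: "sub A \<Longrightarrow> sub B \<Longrightarrow> A \<subseteq> B \<Longrightarrow> A <#> B = B"
  using set_mult_upper(2) set_mult_least by (metis subset_antisym subset_refl)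

text \<open>Each fibre of the multiplication map on \<open>A \<times> B\<close> is a translate of
  \<open>A \<inter> B\<close>, so counting pairs by their product gives the formula even when
  \<open>A <#> B\<close> is no subgroup.\<close>

lemma card_set_mult:
  assumes "sub A" "sub B"
  shows "card (A <#> B) * card (A \<inter> B) = card A * card B"
proof -
  let ?f = "\<lambda>(a, b). a \<otimes> b"
  have fib: "card {p \<in> A \<times> B. ?f p = y} = card (A \<inter> B)" if "y \<in> A <#> B" for y
  proof -
    obtain a b where ab: "a \<in> A" "b \<in> B" "y = a \<otimes> b" using \<open>y \<in> A <#> B\<close> set_mult_mem by blast
    note c = sub_memD(1)[OF assms(1)] sub_memD(1)[OF assms(2)]
    have "{p \<in> A \<times> B. ?f p = y} = (\<lambda>c. (a \<otimes> c, inv c \<otimes> b)) ` (A \<inter> B)"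
    proof (intro subset_antisym subsetI)
      fix p assume "p \<in> {p \<in> A \<times> B. ?f p = y}"
      then obtain u v where p: "p = (u, v)" "u \<in> A" "v \<in> B" "u \<otimes> v = a \<otimes> b" using ab by auto
      have e: "inv a \<otimes> u = b \<otimes> inv v"
      proof -
        have uv: "a \<in> carrier G" "b \<in> carrier G" "u \<in> carrier G" "v \<in> carrier G" using c p ab by auto
        then have "inv a \<otimes> u = inv a \<otimes> (u \<otimes> v) \<otimes> inv v" by (simp add: m_assoc)
        also have "\<dots> = b \<otimes> inv v" unfolding p(4) using uv by (simp add: m_assoc)
        finally show ?thesis .
      qed
      have "inv a \<otimes> u \<in> A \<inter> B"
        using e p ab assms sub_memD by (metis IntI)
      moreover have "v = inv (inv a \<otimes> u) \<otimes> b"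
        unfolding e using c p ab by (simp add: inv_mult_group m_assoc)
      moreover have "u = a \<otimes> (inv a \<otimes> u)" using c p ab by simp
      ultimately show "p \<in> (\<lambda>c. (a \<otimes> c, inv c \<otimes> b)) ` (A \<inter> B)" using p by blast
    next
      fix p assume "p \<in> (\<lambda>c. (a \<otimes> c, inv c \<otimes> b)) ` (A \<inter> B)"
      then show "p \<in> {p \<in> A \<times> B. ?f p = y}"
        using ab assms sub_memD by (auto simp: m_assoc)
    qed
    moreover have "inj_on (\<lambda>c. (a \<otimes> c, inv c \<otimes> b)) (A \<inter> B)"
      using ab c by (auto intro!: inj_onI)
    ultimately show ?thesis by (simp add: card_image)
  qed
  have f: "finite A" "finite B" using assms sub_fin by auto
  have img: "?f ` (A \<times> B) = A <#> B" unfolding set_mult_def by auto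
  have "card (A \<times> B) = (\<Sum>y\<in>?f ` (A \<times> B). card {p \<in> A \<times> B. ?f p = y})"
    using sum.image_gen[of "A \<times> B" "\<lambda>_. 1::nat" ?f] f by simp
  also have "\<dots> = (\<Sum>y\<in>A <#> B. card (A \<inter> B))" unfolding img using fib by (intro sum.cong) auto
  finally show ?thesis by (simp add: card_cartesian_product)
qed

text \<open>The second isomorphism theorem at the level of orders.\<close>

lemma idx_set_mult:
  assumes "sub A" "sub B"
  shows "idx (A <#> B) A = idx B (A \<inter> B)"
proof (rule idx_eqI[OF assms(1)])
  have "card (A <#> B) * card (A \<inter> B) = (idx B (A \<inter> B) * card A) * card (A \<inter> B)"
    using card_set_mult[OF assms] idx_card[OF assms(2) sub_Int[OF assms]] by (simp add: ac_simps)
  then show "card (A <#> B) = idx B (A \<inter> B) * card A"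
    using card_sub_pos[OF sub_Int[OF assms]] by simp
qed

lemma set_mult_commute_nml:
  assumes "sub A" "sub B" "normalizes B A"
  shows "A <#> B = B <#> A"
proof (rule subset_antisym)
  show "B <#> A \<subseteq> A <#> B"
    using sub_set_mult[OF assms] set_mult_upper[OF assms(1,2)] by (intro set_mult_least)
  show "A <#> B \<subseteq> B <#> A"
  proof
    fix x assume "x \<in> A <#> B"
    then obtain a b where ab: "a \<in> A" "b \<in> B" "x = a \<otimes> b" using set_mult_mem by blast
    then have "x = b \<otimes> (inv b \<otimes> a \<otimes> b)"
      using sub_memD(1)[OF assms(1)] sub_memD(1)[OF assms(2)] by (simp add: m_assoc)
    then show "x \<in> B <#> A" using ab normalizes_elem[OF assms(3)] set_mult_memI by simp
  qed
qed

lemma dedekind: 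
  assumes "sub A" "sub B" "sub C" "A \<subseteq> C"
  shows "(A <#> B) \<inter> C = A <#> (B \<inter> C)"
proof
  show "A <#> (B \<inter> C) \<subseteq> (A <#> B) \<inter> C"
    unfolding set_mult_def using assms(4) sub_memD(3)[OF assms(3)] by blast
  show "(A <#> B) \<inter> C \<subseteq> A <#> (B \<inter> C)"
  proof
    fix x assume x: "x \<in> (A <#> B) \<inter> C"
    then obtain a b where ab: "a \<in> A" "b \<in> B" "x = a \<otimes> b" using set_mult_mem by blast
    then have "b = inv a \<otimes> x" using assms sub_memD(1) by simp
    then have "b \<in> C" using x ab assms sub_memD by (metis IntD2 subsetD)
    then show "x \<in> A <#> (B \<inter> C)" using ab set_mult_memI by blast
  qed
qed

lemma cj_set_mult:
  assumes "x \<in> carrier G" "A \<subseteq> carrier G" "B \<subseteq> carrier G"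
  shows "cj x (A <#> B) = cj x A <#> cj x B"
proof (intro subset_antisym subsetI)
  fix y assume "y \<in> cj x (A <#> B)"
  then obtain a b where ab: "a \<in> A" "b \<in> B" "y = inv x \<otimes> (a \<otimes> b) \<otimes> x"
    by (auto simp: cj_def set_mult_mem)
  then have "y = (inv x \<otimes> a \<otimes> x) \<otimes> (inv x \<otimes> b \<otimes> x)"
    using assms(1) subsetD[OF assms(2) ab(1)] subsetD[OF assms(3) ab(2)] by (simp add: m_assoc)
  then show "y \<in> cj x A <#> cj x B" using ab by (auto simp: set_mult_mem cj_def)
next
  fix y assume "y \<in> cj x A <#> cj x B"
  then obtain a b where ab: "a \<in> A" "b \<in> B" "y = (inv x \<otimes> a \<otimes> x) \<otimes> (inv x \<otimes> b \<otimes> x)"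
    by (auto simp: cj_def set_mult_mem)
  then have "y = inv x \<otimes> (a \<otimes> b) \<otimes> x"
    using assms(1) subsetD[OF assms(2) ab(1)] subsetD[OF assms(3) ab(2)] by (simp add: m_assoc)
  then show "y \<in> cj x (A <#> B)" unfolding cj_def using set_mult_memI[OF ab(1,2)] by blast
qed

lemma normalizes_set_mult:
  assumes "normalizes C A" "normalizes C B" "A \<subseteq> carrier G" "B \<subseteq> carrier G" "C \<subseteq> carrier G"
  shows "normalizes C (A <#> B)"
  unfolding normalizes_def
proof
  fix c assume c: "c \<in> C"
  then have "c \<in> carrier G" using assms by blast
  then show "cj c (A <#> B) = A <#> B" using c assms normalizesD by (simp add: cj_set_mult)
qed

lemma normalizes_by_set_mult:
  assumes "normalizes B A" "normalizes C A" "A \<subseteq> carrier G" "B \<subseteq> carrier G" "C \<subseteq> carrier G"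
  shows "normalizes (B <#> C) A"
  unfolding normalizes_def
proof
  fix x assume "x \<in> B <#> C"
  then obtain b c where x: "b \<in> B" "c \<in> C" "x = b \<otimes> c" using set_mult_mem by blast
  then have "b \<in> carrier G" "c \<in> carrier G" using assms by auto
  then have "cj x A = cj c (cj b A)" using x assms(3) by (simp add: cj_mult)
  then show "cj x A = A" using x assms normalizesD by simp
qed

lemma nml_set_mult:
  assumes "nml A H" "nml B H"
  shows "nml (A <#> B) H"
proof -
  note N = nmlD(1-4)[OF assms(1)] nmlD(1-4)[OF assms(2)]
  show ?thesis
    using N normalizes_mono[OF N(4) N(7)]
    by (intro nmlI sub_set_mult normalizes_set_mult set_mult_least sub_carrier)
qed

lemma nml_in_set_mult: 
  assumes "sub A" "sub B" "normalizes B A"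
  shows "nml A (A <#> B)"
  using assms normalizes_self[OF assms(1) subset_refl]
  by (intro nmlI normalizes_by_set_mult sub_set_mult set_mult_upper(1) sub_carrier)

text \<open>L/(L \<inter> N) has the order of NL/N, which is a subgroup of H/N.\<close>

lemma idx_Int_dvd:
  assumes "nml N H" "sub L" "L \<subseteq> H"
  shows "idx L (L \<inter> N) dvd idx H N"
proof -
  have s: "sub (N <#> L)" using assms nmlD sub_set_mult normalizes_mono by metis
  have "idx (N <#> L) N dvd idx H N"
    using assms(2,3) s nmlD(1-3)[OF assms(1)] by (intro idx_dvd_r set_mult_least set_mult_upper)
  then show ?thesis using idx_set_mult[of N L] assms nmlD by (simp add: Int_commute)
qed

text \<open>NM/WM is a quotient of N/W: writing NM as (WM)N shows that its order is the index of WM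
  \<inter> N in N, and W lies in that intersection.\<close>

lemma idx_set_mult_dvd:
  assumes "nml W X" "nml N X" "nml M X" "W \<subseteq> N"
  shows "idx (N <#> M) (W <#> M) dvd idx N W"
proof -
  have s: "sub W" "sub N" "sub M" "sub (W <#> M)" "sub (N <#> M)"
    using nmlD(1)[OF assms(1)] nmlD(1)[OF assms(2)] nmlD(1)[OF assms(3)]
      nmlD(1)[OF nml_set_mult[OF assms(1,3)]] nmlD(1)[OF nml_set_mult[OF assms(2,3)]] by blast+
  have s': "sub ((W <#> M) <#> N)"
    by (rule nmlD(1)[OF nml_set_mult[OF nml_set_mult[OF assms(1,3)] assms(2)]])
  have e: "N <#> M = (W <#> M) <#> N"
  proof (rule subset_antisym)
    show "N <#> M \<subseteq> (W <#> M) <#> N"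
      using set_mult_upper[OF s(4,2)] set_mult_upper(2)[OF s(1,3)]
      by (intro set_mult_least[OF s']) simp_all
    have "W <#> M \<subseteq> N <#> M" using assms(4) by (simp add: mono_set_mult)
    then show "(W <#> M) <#> N \<subseteq> N <#> M"
      using set_mult_upper(1)[OF s(2,3)] by (rule set_mult_least[OF s(5)])
  qed
  have "idx (N <#> M) (W <#> M) = idx N ((W <#> M) \<inter> N)"
    unfolding e using s idx_set_mult by simp
  also have "\<dots> dvd idx N W"
    using s assms(4) set_mult_upper(1)[OF s(1,3)] by (intro idx_dvd_l sub_Int) auto
  finally show ?thesis .
qed

end

section \<open>Fixed points of p-groups and Sylow subgroups\<close>

context finite_group
begin

text \<open>The index of \<open>A <#> B\<close> in \<open>V\<close> divides two coprime
  numbers.\<close>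

lemma idx_coprime_set_mult:
  assumes "sub A" "sub B" "sub V" "sub (A <#> B)" "A \<subseteq> V" "B \<subseteq> V" "coprime (idx V A) (idx V B)"
  shows "A <#> B = V"
proof -
  have le: "A <#> B \<subseteq> V" using assms by (intro set_mult_least)
  have "idx V (A <#> B) dvd idx V A"
    using assms le set_mult_upper(1)[OF assms(1,2)] by (intro idx_dvd_l)
  moreover have "idx V (A <#> B) dvd idx V B"
    using assms le set_mult_upper(2)[OF assms(1,2)] by (intro idx_dvd_l)
  ultimately have "idx V (A <#> B) = 1"
    using assms(7) by (metis coprime_def nat_dvd_1_iff_1)
  then show ?thesis using idx_1D assms le by blast
qed

text \<open>Orbit and stabilizer for a bare function \<open>f\<close>; the action laws are required
  only at the point \<open>x\<close>, so conjugation and translation of sets qualify without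
  restricting their domain.\<close>

lemma card_orbit:
  assumes "sub P" and "\<And>g h. g \<in> P \<Longrightarrow> h \<in> P \<Longrightarrow> f (g \<otimes> h) x = f g (f h x)"
    and "f \<one> x = x"
  shows "sub {g \<in> P. f g x = x}"
    and "card ((\<lambda>g. f g x) ` P) * card {g \<in> P. f g x = x} = card P"
proof -
  note P = sub_memD[OF assms(1)]
  let ?S = "{g \<in> P. f g x = x}"
  show "sub ?S"
  proof (rule subgroupI)
    show "?S \<subseteq> carrier G" using P by blast
    show "?S \<noteq> {}" using assms one_in by blast
    fix g assume g: "g \<in> ?S"
    then have "f (inv g) (f g x) = f \<one> x" using assms(2)[of "inv g" g] P by simp
    then show "inv g \<in> ?S" using g assms(3) P by simp
  next
    fix g h assume "g \<in> ?S" "h \<in> ?S"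
    then show "g \<otimes> h \<in> ?S" using assms P by simp
  qed
  have fib: "card {g \<in> P. f g x = y} = card ?S" if y: "y \<in> (\<lambda>g. f g x) ` P" for y
  proof -
    obtain h where h: "h \<in> P" "y = f h x" using y by blast
    have "{g \<in> P. f g x = y} = (\<lambda>s. h \<otimes> s) ` ?S"
    proof (intro subset_antisym subsetI)
      fix g assume g: "g \<in> {g \<in> P. f g x = y}"
      have "f (inv h \<otimes> g) x = f (inv h) (f g x)" using assms(2) P(2) h g by simp
      also have "\<dots> = f (inv h) (f h x)" using h g by simp
      also have "\<dots> = f (inv h \<otimes> h) x" using assms(2)[of "inv h" h] P(2) h by simp
      also have "\<dots> = x" using h P assms(3) by simp
      finally have "inv h \<otimes> g \<in> ?S" using P h g by simp
      moreover have "g = h \<otimes> (inv h \<otimes> g)" using P h g by simp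
      ultimately show "g \<in> (\<lambda>s. h \<otimes> s) ` ?S" by blast
    next
      fix g assume "g \<in> (\<lambda>s. h \<otimes> s) ` ?S"
      then show "g \<in> {g \<in> P. f g x = y}" using h assms(2) P by auto
    qed
    moreover have "inj_on (\<lambda>s. h \<otimes> s) ?S" by (rule inj_onI) (use h P in simp)
    ultimately show ?thesis by (simp add: card_image)
  qed
  have "card P = (\<Sum>y\<in>(\<lambda>g. f g x) ` P. card {g \<in> P. f g x = y})"
    using sum.image_gen[of P "\<lambda>_. 1::nat" "\<lambda>g. f g x"] sub_fin[OF assms(1)] by simp
  also have "\<dots> = (\<Sum>y\<in>(\<lambda>g. f g x) ` P. card ?S)" using fib by (intro sum.cong refl)
  finally show "card ((\<lambda>g. f g x) ` P) * card ?S = card P" by simp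
qed

text \<open>Removing one non-trivial orbit changes the size of \<open>X\<close> by a multiple of p
  and loses no fixed point. The action laws hold on the fixed set \<open>X0\<close>, while
  \<open>X\<close> shrinks during the induction.\<close>

lemma p_group_fixed_points:
  assumes P: "sub P" "card P = p ^ k" "prime p"
    and f: "\<And>g h x. g \<in> P \<Longrightarrow> h \<in> P \<Longrightarrow> x \<in> X0 \<Longrightarrow> f (g \<otimes> h) x = f g (f h x)"
      "\<And>x. x \<in> X0 \<Longrightarrow> f \<one> x = x"
    and X: "finite X" "X \<subseteq> X0" "\<And>g x. g \<in> P \<Longrightarrow> x \<in> X \<Longrightarrow> f g x \<in> X"
  shows "p dvd card X \<longleftrightarrow> p dvd card {x \<in> X. \<forall>g\<in>P. f g x = x}"
  using X
proof (induction "card X" arbitrary: X rule: less_induct)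
  case less
  show ?case
  proof (cases "\<forall>x\<in>X. \<forall>g\<in>P. f g x = x")
    case True
    then have "{x \<in> X. \<forall>g\<in>P. f g x = x} = X" by blast
    then show ?thesis by simp
  next
    case False
    then obtain x h where x: "x \<in> X" "h \<in> P" "f h x \<noteq> x" by blast
    note PP = sub_memD[OF P(1)]
    define Orb where "Orb = (\<lambda>g. f g x) ` P"
    have xX0: "x \<in> X0" using x less by blast
    have OX: "Orb \<subseteq> X" unfolding Orb_def using less x by blast
    have xO: "x \<in> Orb" unfolding Orb_def using f(2)[OF xX0] one_in[OF P(1)] by force
    note orb = card_orbit[of P f x, OF P(1) f(1)[OF _ _ xX0] f(2)[OF xX0]]
    have "card {g \<in> P. f g x = x} \<noteq> card P"
      using x card_subset_eq[OF sub_fin[OF P(1)], of "{g \<in> P. f g x = x}"] by blast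
    then have "card Orb \<noteq> 1" using orb(2) unfolding Orb_def by auto
    moreover have "card Orb dvd p ^ k" using orb(2) P(2) unfolding Orb_def by (metis dvd_triv_left)
    ultimately have pO: "p dvd card Orb"
      using P(3) by (metis divides_primepow_nat dvd_power gr0I power_0)
    have inv: "f g y \<in> X - Orb" if "g \<in> P" "y \<in> X - Orb" for g y
    proof -
      have "y \<in> Orb" if "f g y \<in> Orb"
      proof -
        obtain u where u: "u \<in> P" "f g y = f u x" using \<open>f g y \<in> Orb\<close> unfolding Orb_def by blast
        have y: "y \<in> X0" using \<open>y \<in> X - Orb\<close> less by blast
        have "y = f (inv g \<otimes> g) y" using f(2) y \<open>g \<in> P\<close> PP by simp
        also have "\<dots> = f (inv g) (f u x)" using f(1)[of "inv g" g y] y \<open>g \<in> P\<close> PP u by simp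
        also have "\<dots> = f (inv g \<otimes> u) x" using f(1) xX0 \<open>g \<in> P\<close> PP u by simp
        finally show "y \<in> Orb" unfolding Orb_def using \<open>g \<in> P\<close> PP u by blast
      qed
      then show ?thesis using that less by blast
    qed
    have fO: "finite Orb" using OX less(2) finite_subset by blast
    have "card (X - Orb) < card X" using OX xO less(2) x by (intro psubset_card_mono) auto
    then have IH: "p dvd card (X - Orb) \<longleftrightarrow> p dvd card {x \<in> X - Orb. \<forall>g\<in>P. f g x = x}"
      using less inv by (intro less(1)) blast+
    \<comment> \<open>A fixed point inside an orbit would be the whole orbit, but \<open>x\<close>
      is moved.\<close>
    have "{x \<in> X - Orb. \<forall>g\<in>P. f g x = x} = {x \<in> X. \<forall>g\<in>P. f g x = x}"
    proof -
      have "y \<notin> Orb" if "\<forall>g\<in>P. f g y = y" for y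
      proof
        assume "y \<in> Orb"
        then obtain u where u: "u \<in> P" "y = f u x" unfolding Orb_def by blast
        have "x = f (inv u \<otimes> u) x" using f(2) xX0 u PP by simp
        also have "\<dots> = f (inv u) y" using f(1)[of "inv u" u x] xX0 u PP by simp
        also have "\<dots> = y" using that u PP by blast
        finally show False using x that by blast
      qed
      then show ?thesis by blast
    qed
    moreover have "card X = card (X - Orb) + card Orb"
      using OX fO less(2) by (simp add: card_Diff_subset card_mono)
    ultimately show ?thesis using IH pO by (simp add: dvd_add_left_iff)
  qed
qed

section \<open>Left cosets, Sylow subgroups and relative Hall subgroups\<close>

definition lcos :: "'a \<Rightarrow> 'a set \<Rightarrow> 'a set"
  where "lcos x A = (\<lambda>a. x \<otimes> a) ` A"

lemma lcos_mult: "x \<in> carrier G \<Longrightarrow> y \<in> carrier G \<Longrightarrow> A \<subseteq> carrier G \<Longrightarrow> lcos x (lcos y A) = lcos (x \<otimes> y) A"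
  unfolding lcos_def image_image by (rule image_cong) (auto simp: m_assoc dest!: subsetD)

lemma lcos_carrier: "x \<in> carrier G \<Longrightarrow> A \<subseteq> carrier G \<Longrightarrow> lcos x A \<subseteq> carrier G"
  unfolding lcos_def by blast

lemma lcos_one: 
  assumes "A \<subseteq> carrier G"
  shows "lcos \<one> A = A"
proof -
  have "\<one> \<otimes> a = a" if "a \<in> A" for a using that assms by (simp add: subset_iff)
  then show ?thesis unfolding lcos_def by simp
qed

lemma lcos_eq_iff:
  assumes "sub S" "x \<in> carrier G" "y \<in> carrier G"
  shows "lcos x S = lcos y S \<longleftrightarrow> inv x \<otimes> y \<in> S"
proof
  assume "lcos x S = lcos y S"
  moreover have "y \<in> lcos y S" unfolding lcos_def using one_in[OF assms(1)] assms by force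
  ultimately obtain s where "s \<in> S" "y = x \<otimes> s" unfolding lcos_def by blast
  then show "inv x \<otimes> y \<in> S" using assms sub_memD(1)[OF assms(1)] by simp
next
  note S = sub_memD[OF assms(1)]
  assume a: "inv x \<otimes> y \<in> S"
  show "lcos x S = lcos y S"
  proof (intro subset_antisym subsetI)
    fix z assume "z \<in> lcos x S"
    then obtain s where s: "s \<in> S" "z = x \<otimes> s" unfolding lcos_def by blast
    then have "z = y \<otimes> (inv (inv x \<otimes> y) \<otimes> s)" using assms S(1) by (simp add: inv_mult_group m_assoc)
    then show "z \<in> lcos y S" unfolding lcos_def using s a S by blast
  next
    fix z assume "z \<in> lcos y S"
    then obtain s where s: "s \<in> S" "z = y \<otimes> s" unfolding lcos_def by blast
    then have "z = x \<otimes> ((inv x \<otimes> y) \<otimes> s)" using assms S(1) by (simp add: m_assoc)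
    then show "z \<in> lcos x S" unfolding lcos_def using s a S by blast
  qed
qed

lemma card_lcosets:
  assumes "sub H" "sub S" "S \<subseteq> H"
  shows "card ((\<lambda>h. lcos h S) ` H) = idx H S"
proof -
  note H = sub_memD[OF assms(1)]
  have fib: "card {h \<in> H. lcos h S = C} = card S" if C: "C \<in> (\<lambda>h. lcos h S) ` H" for C
  proof -
    obtain h where h: "h \<in> H" "C = lcos h S" using C by blast
    have "{g \<in> H. lcos g S = C} = lcos h S"
    proof (intro subset_antisym subsetI)
      fix g assume g: "g \<in> {g \<in> H. lcos g S = C}"
      then have "inv h \<otimes> g \<in> S" using h H lcos_eq_iff[OF assms(2), of h g] by auto
      moreover have "g = h \<otimes> (inv h \<otimes> g)" using g h H by simp
      ultimately show "g \<in> lcos h S" unfolding lcos_def by blast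
    next
      fix g assume "g \<in> lcos h S"
      then obtain s where s: "s \<in> S" "g = h \<otimes> s" unfolding lcos_def by blast
      then have gH: "g \<in> H" using h H assms(3) by blast
      have "inv h \<otimes> g \<in> S" using s h H assms(3) by (simp add: subset_iff)
      then have "lcos h S = lcos g S" using lcos_eq_iff[OF assms(2), of h g] h gH H by blast
      then show "g \<in> {g \<in> H. lcos g S = C}" using h gH by simp
    qed
    moreover have "card (lcos h S) = card S"
      unfolding lcos_def by (rule card_image, rule inj_onI) (use h H assms(3) in \<open>simp add: subset_iff\<close>)
    ultimately show ?thesis by simp
  qed
  have "card H = (\<Sum>C\<in>(\<lambda>h. lcos h S) ` H. card {h \<in> H. lcos h S = C})"
    using sum.image_gen[of H "\<lambda>_. 1::nat" "\<lambda>h. lcos h S"] sub_fin[OF assms(1)] by simp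
  also have "\<dots> = (\<Sum>C\<in>(\<lambda>h. lcos h S) ` H. card S)" using fib by (intro sum.cong refl)
  finally have "card H = card ((\<lambda>h. lcos h S) ` H) * card S" by simp
  then show ?thesis using idx_eqI[OF assms(2)] by metis
qed

lemma fixed_lcos_iff:
  assumes "sub S" "g \<in> carrier G" "h \<in> carrier G"
  shows "lcos g (lcos h S) = lcos h S \<longleftrightarrow> inv h \<otimes> g \<otimes> h \<in> S"
proof -
  have "lcos g (lcos h S) = lcos h S \<longleftrightarrow> lcos h S = lcos (g \<otimes> h) S"
    using assms sub_carrier by (auto simp: lcos_mult)
  then show ?thesis using assms lcos_eq_iff[of S h "g \<otimes> h"] by (simp add: m_assoc)
qed

lemma p_group_fixed_lcosets:
  assumes "sub H" "sub S" "S \<subseteq> H" "sub P" "P \<subseteq> H" "card P = p ^ k" "prime p"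
  shows "p dvd idx H S \<longleftrightarrow> p dvd card {C \<in> (\<lambda>h. lcos h S) ` H. \<forall>g\<in>P. lcos g C = C}"
proof -
  note c = sub_memD(1)[OF assms(1)] sub_carrier[OF assms(2)]
  have P: "g \<in> carrier G" "g \<in> H" if "g \<in> P" for g using that assms c by blast+
  have "lcos g (lcos h S) = lcos (g \<otimes> h) S" if "g \<in> H" "h \<in> H" for g h
    using that c lcos_mult by simp
  then have "lcos g C \<in> (\<lambda>h. lcos h S) ` H" if "g \<in> P" "C \<in> (\<lambda>h. lcos h S) ` H" for g C
    using that P sub_memD(3)[OF assms(1)] by auto
  moreover have "(\<lambda>h. lcos h S) ` H \<subseteq> Pow (carrier G)" using c lcos_carrier by blast
  moreover have "lcos (g \<otimes> h) C = lcos g (lcos h C)" if "g \<in> P" "h \<in> P" "C \<in> Pow (carrier G)" for g h C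
    using that P lcos_mult by simp
  moreover have "lcos \<one> C = C" if "C \<in> Pow (carrier G)" for C
    using that lcos_one by simp
  moreover have "finite ((\<lambda>h. lcos h S) ` H)" using sub_fin[OF assms(1)] by simp
  ultimately show ?thesis
    using p_group_fixed_points[of P p k "Pow (carrier G)" lcos "(\<lambda>h. lcos h S) ` H", OF assms(4,6,7)]
      card_lcosets[OF assms(1-3)] by simp
qed

text \<open>\<open>P\<close> permutes the left cosets of \<open>S\<close>, whose number is prime to
  p, so it fixes some coset hS; this says that P conjugated by h lies in S.\<close>

lemma p_subgroup_conj_into:
  assumes "sub H" "sub S" "S \<subseteq> H" "sub P" "P \<subseteq> H" "card P = p ^ k" "prime p" "\<not> p dvd idx H S"
  shows "\<exists>h\<in>H. cj h P \<subseteq> S"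
proof -
  have "{C \<in> (\<lambda>h. lcos h S) ` H. \<forall>g\<in>P. lcos g C = C} \<noteq> {}"
    using p_group_fixed_lcosets[OF assms(1-7)] assms(8) by (metis card.empty dvd_0_right)
  then obtain h where h: "h \<in> H" "\<forall>g\<in>P. lcos g (lcos h S) = lcos h S" by blast
  have "inv h \<otimes> g \<otimes> h \<in> S" if "g \<in> P" for g
    using h that fixed_lcos_iff[OF assms(2), of g h] sub_memD(1)[OF assms(1)] assms(5) by blast
  then show ?thesis using h unfolding cj_def by blast
qed

lemma sylow_exists:
  assumes "sub H" "prime p"
  shows "\<exists>P. sub P \<and> P \<subseteq> H \<and> card P = p ^ multiplicity p (card H) \<and> \<not> p dvd idx H P"
proof -
  have p: "\<not> is_unit p" "card H \<noteq> 0" using assms card_sub_pos[OF assms(1)] by (auto simp: prime_nat_iff)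
  obtain m where m: "card H = p ^ multiplicity p (card H) * m" "\<not> p dvd m"
    using multiplicity_decompose'[OF p(2,1)] by metis
  interpret H: group "G\<lparr>carrier := H\<rparr>" using subgroup_imp_group[OF assms(1)] .
  have "order (G\<lparr>carrier := H\<rparr>) = p ^ multiplicity p (card H) * m" using m by (simp add: order_def)
  then obtain P where P: "subgroup P (G\<lparr>carrier := H\<rparr>)" "card P = p ^ multiplicity p (card H)"
    using sylow_thm[OF assms(2) H.is_group] sub_fin[OF assms(1)] by auto
  then have s: "sub P" "P \<subseteq> H" using sub_restrict[OF assms(1)] by auto
  have "idx H P = m" using m(1) P(2) by (intro idx_eqI[OF s(1)]) (simp add: mult.commute)
  then show ?thesis using s P m by blast
qed

lemma pi_number_prime_powerI: "prime p \<Longrightarrow> pi_number {p} (p ^ k)"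
  unfolding pi_number_def by (auto simp: prime_gt_0_nat prime_dvd_power_iff dest: prime_dvd_power primes_dvd_imp_eq)

lemma prime_number_idx_coprime: "\<not> p dvd n \<Longrightarrow> pi_number {p} m \<Longrightarrow> prime p \<Longrightarrow> coprime m n"
  by (metis pi_number_prime_power prime_imp_coprime coprime_power_left_iff)

text \<open>A Sylow p-subgroup has index prime to p in V while W has p-power index, so together they
  generate V. This lets a p-group, rather than a p-quotient, act in the counting arguments.\<close>

lemma p_quotient_supplement:
  assumes "nml W V" "pi_number {p} (idx V W)" "prime p"
  shows "\<exists>P. sub P \<and> P \<subseteq> V \<and> card P = p ^ multiplicity p (card V) \<and> V = W <#> P"
proof -
  note W = nmlD[OF assms(1)]
  obtain P where P: "sub P" "P \<subseteq> V" "card P = p ^ multiplicity p (card V)" "\<not> p dvd idx V P"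
    using sylow_exists[OF W(2) assms(3)] by blast
  have "sub (W <#> P)" using W P normalizes_mono by (intro sub_set_mult)
  then have "W <#> P = V" using prime_number_idx_coprime[OF P(4) assms(2,3)] W P
    by (intro idx_coprime_set_mult)
  then show ?thesis using P by blast
qed

text \<open>For \<open>W\<close> normal in \<open>H\<close> this is a Hall \<rho>-subgroup of H/W,
  pulled back. The complement \<open>- \<rho>\<close> is taken in all natural numbers;
  \<open>pi_number\<close> only looks at primes.\<close>

definition hall :: "nat set \<Rightarrow> 'a set \<Rightarrow> 'a set \<Rightarrow> 'a set \<Rightarrow> bool"
  where "hall \<rho> W H T \<longleftrightarrow> sub T \<and> W \<subseteq> T \<and> T \<subseteq> H \<and> pi_number \<rho> (idx T W) \<and> pi_number (- \<rho>) (idx H T)"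

text \<open>The property D of P. Hall for H/W: some Hall \<rho>-subgroup contains a conjugate of
  every \<rho>-subgroup.\<close>

definition hall_dominates :: "nat set \<Rightarrow> 'a set \<Rightarrow> 'a set \<Rightarrow> bool"
  where "hall_dominates \<rho> W H \<longleftrightarrow> (\<exists>T. hall \<rho> W H T \<and>
    (\<forall>L. sub L \<longrightarrow> W \<subseteq> L \<longrightarrow> L \<subseteq> H \<longrightarrow> pi_number \<rho> (idx L W) \<longrightarrow> (\<exists>h\<in>H. cj h L \<subseteq> T)))"

lemma hallD:
  assumes "hall \<rho> W H T"
  shows "sub T" "W \<subseteq> T" "T \<subseteq> H" "pi_number \<rho> (idx T W)" "pi_number (- \<rho>) (idx H T)"
  using assms by (auto simp: hall_def)

text \<open>The Hall subgroup is WS with S Sylow in H. A given L has the form WP with P a p-group,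
  and conjugating P into S carries L into WS.\<close>

lemma sylow_dominates:
  assumes "nml W H" "prime p"
  shows "hall_dominates {p} W H"
proof -
  note W = nmlD[OF assms(1)]
  obtain S where S: "sub S" "S \<subseteq> H" "card S = p ^ multiplicity p (card H)" "\<not> p dvd idx H S"
    using sylow_exists[OF W(2) assms(2)] by blast
  have s: "sub (W <#> S)" using W S normalizes_mono by (intro sub_set_mult)
  have le: "W \<subseteq> W <#> S" "S \<subseteq> W <#> S" "W <#> S \<subseteq> H"
    using set_mult_upper[OF W(1) S(1)] set_mult_least[OF W(2,3) S(2)] by auto
  have "idx (W <#> S) W dvd card S"
    using idx_set_mult[OF W(1) S(1)] idx_card[OF S(1) sub_Int[OF W(1) S(1)]] by (metis Int_lower2 dvd_triv_left)
  then have "pi_number {p} (idx (W <#> S) W)"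
    using pi_number_dvd[OF pi_number_prime_powerI[OF assms(2)]] S(3) by simp
  moreover have "idx H (W <#> S) dvd idx H S" using W S s le by (intro idx_dvd_l)
  then have "pi_number (- {p}) (idx H (W <#> S))"
    using S(4) idx_pos[OF W(2) s le(3)] by (auto simp: pi_number_def intro: dvd_trans)
  ultimately have "hall {p} W H (W <#> S)" using s le by (simp add: hall_def)
  moreover have "\<exists>h\<in>H. cj h L \<subseteq> W <#> S"
    if L: "sub L" "W \<subseteq> L" "L \<subseteq> H" "pi_number {p} (idx L W)" for L
  proof -
    have "nml W L" using nml_restrict[OF assms(1) L(1-3)] .
    then obtain P where P: "sub P" "P \<subseteq> L" "card P = p ^ multiplicity p (card L)" "L = W <#> P"
      using p_quotient_supplement[OF _ L(4) assms(2)] by blast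
    obtain h where h: "h \<in> H" "cj h P \<subseteq> S"
      using p_subgroup_conj_into[OF W(2) S(1,2) P(1) _ P(3) assms(2) S(4)] P L by blast
    have "cj h L = cj h W <#> cj h P"
      unfolding P(4) using h W P sub_carrier sub_memD(1)[OF W(2)] by (intro cj_set_mult) simp_all
    also have "\<dots> \<subseteq> W <#> S" using W(5)[OF h(1)] h(2) by (simp add: mono_set_mult)
    finally show ?thesis using h by blast
  qed
  ultimately show ?thesis unfolding hall_dominates_def by blast
qed

text \<open>Normalizers grow in the p-group J/W. A Sylow p-subgroup P of V fixes the coset V among
  the cosets of V in J, whose number is divisible by p; hence it fixes another coset hV, and h
  normalizes V = WP.\<close>

lemma normalizer_growth:
  assumes "nml W J" "prime p" "pi_number {p} (idx J W)" "sub V" "W \<subseteq> V" "V \<subseteq> J" "V \<noteq> J"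
  shows "\<exists>x\<in>J - V. cj x V = V"
proof -
  note W = nmlD[OF assms(1)]
  have i: "idx V W dvd idx J W" "idx J V dvd idx J W"
    using W assms by (auto intro!: idx_dvd_l idx_dvd_r)
  have "nml W V" using nml_restrict[OF assms(1,4,5,6)] .
  then obtain P where P: "sub P" "P \<subseteq> V" "card P = p ^ multiplicity p (card V)" "V = W <#> P"
    using p_quotient_supplement[OF _ pi_number_dvd[OF assms(3) i(1)] assms(2)] by blast
  have "idx J V \<noteq> 1" using idx_1D[OF W(2) assms(4,6)] assms(7) by blast
  then have "p dvd idx J V"
    using pi_number_prime_power[OF assms(2) pi_number_dvd[OF assms(3) i(2)]] by (metis dvd_power gr0I power_0)
  moreover define F where "F = {C \<in> (\<lambda>h. lcos h V) ` J. \<forall>g\<in>P. lcos g C = C}"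
  ultimately have pF: "p dvd card F"
    using p_group_fixed_lcosets[OF W(2) assms(4,6) P(1) _ P(3) assms(2)] P(2) assms(6) by blast
  have "lcos \<one> V \<in> F"
  proof -
    have "lcos g (lcos \<one> V) = lcos \<one> V" if g: "g \<in> P" for g
    proof -
      have "g \<in> V" "g \<in> carrier G" using g P(2) assms(4) sub_memD(1) by blast+
      then show ?thesis using fixed_lcos_iff[OF assms(4), of g \<one>] by simp
    qed
    then show ?thesis unfolding F_def using one_in[OF W(2)] by blast
  qed
  moreover have "finite F" unfolding F_def using sub_fin[OF W(2)] by simp
  \<comment> \<open>The number of fixed cosets is divisible by p and positive, so there is more than
    one.\<close>
  ultimately have "\<not> F \<subseteq> {lcos \<one> V}"
    using pF assms(2) by (metis card_1_singleton_iff empty_iff nat_dvd_1_iff_1 not_prime_1 One_nat_def subset_singletonD)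
  then obtain h where h: "h \<in> J" "lcos h V \<noteq> lcos \<one> V" "\<And>g. g \<in> P \<Longrightarrow> lcos g (lcos h V) = lcos h V"
    unfolding F_def by blast
  have hc: "h \<in> carrier G" using h W sub_memD(1) by blast
  have "inv h \<otimes> g \<otimes> h \<in> V" if "g \<in> P" for g
    using h(3)[OF that] fixed_lcos_iff[OF assms(4) _ hc, of g] that sub_memD(1)[OF P(1)] by blast
  then have "cj h P \<subseteq> V" unfolding cj_def by blast
  moreover have "cj h V = cj h W <#> cj h P"
    unfolding P(4) using hc W P sub_carrier by (intro cj_set_mult) simp_all
  ultimately have "cj h V \<subseteq> V" using W(5)[OF h(1)] assms(5) set_mult_least[OF assms(4)] by simp
  moreover have "h \<notin> V"
    using h(2) lcos_eq_iff[OF assms(4), of \<one> h] hc by auto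
  ultimately show ?thesis using cj_eqI[OF assms(4) hc] h(1) by blast
qed

end

section \<open>Complements of abelian normal subgroups\<close>

context finite_group
begin

lemma coprime_pow_eq_one:
  assumes "x \<in> carrier G" "x [^] (m::nat) = \<one>" "x [^] (n::nat) = \<one>" "coprime m n"
  shows "x = \<one>"
proof -
  have "ord x dvd m" "ord x dvd n" using assms pow_eq_id by blast+
  then have "ord x = 1" using assms(4) by (metis coprime_def nat_dvd_1_iff_1)
  then show ?thesis using assms(1) ord_eq_1 by blast
qed

lemma pow_card_sub: "sub N \<Longrightarrow> n \<in> N \<Longrightarrow> n [^] card N = \<one>"
proof -
  assume N: "sub N" "n \<in> N"
  interpret N: group "G\<lparr>carrier := N\<rparr>" using subgroup_imp_group[OF N(1)] .
  have "n [^]\<^bsub>G\<lparr>carrier := N\<rparr>\<^esub> order (G\<lparr>carrier := N\<rparr>) = \<one>"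
    using N.pow_order_eq_1[of n] N by simp
  then show ?thesis by (simp add: order_def flip: nat_pow_consistent)
qed

definition abelian :: "'a set \<Rightarrow> bool"
  where "abelian N \<longleftrightarrow> (\<forall>a\<in>N. \<forall>b\<in>N. a \<otimes> b = b \<otimes> a)"

lemma abelian_comm_group: "sub N \<Longrightarrow> abelian N \<Longrightarrow> comm_group (G\<lparr>carrier := N\<rparr>)"
  by (rule group.group_comm_groupI[OF subgroup_imp_group]) (auto simp: abelian_def)

text \<open>The m-th power map is an endomorphism of the finite abelian group \<open>N\<close> with
  trivial kernel, as element orders divide card \<open>N\<close>; injectivity then gives
  surjectivity.\<close>

lemma coprime_root:
  assumes "sub N" "abelian N" "coprime m (card N)"
  shows "inj_on (\<lambda>n. n [^] m) N" "a \<in> N \<Longrightarrow> \<exists>b\<in>N. b [^] m = a"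
proof -
  note N = sub_memD[OF assms(1)]
  have pow: "n [^] k \<in> N" if "n \<in> N" for n and k :: nat
    using that by (induction k) (auto intro: N one_in[OF assms(1)])
  show inj: "inj_on (\<lambda>n. n [^] m) N"
  proof (rule inj_onI)
    fix a b assume ab: "a \<in> N" "b \<in> N" "a [^] m = b [^] m"
    have c: "a \<otimes> inv b = inv b \<otimes> a" using assms(2) ab N unfolding abelian_def by blast
    have "(a \<otimes> inv b) [^] m = a [^] m \<otimes> inv b [^] m"
      using pow_mult_distrib[OF c] ab N(1) by simp
    also have "\<dots> = \<one>" using ab N(1) by (simp add: nat_pow_inv)
    finally have "a \<otimes> inv b = \<one>"
      using coprime_pow_eq_one[OF _ _ pow_card_sub[OF assms(1)] assms(3)] ab N by blast
    then show "a = b" using ab N(1) by (metis inv_closed inv_equality inv_inv)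
  qed
  show "\<exists>b\<in>N. b [^] m = a" if "a \<in> N"
  proof -
    have "(\<lambda>n. n [^] m) ` N = N"
      using pow by (intro endo_inj_surj[OF sub_fin[OF assms(1)] _ inj]) blast
    then show ?thesis using that by (metis imageE)
  qed
qed

lemma finprod_conj:
  assumes "sub N" "abelian N" "x \<in> carrier G" "\<And>n. n \<in> N \<Longrightarrow> x \<otimes> n \<otimes> inv x \<in> N" "f \<in> A \<rightarrow> N"
  shows "finprod (G\<lparr>carrier := N\<rparr>) (\<lambda>i. x \<otimes> f i \<otimes> inv x) A = x \<otimes> finprod (G\<lparr>carrier := N\<rparr>) f A \<otimes> inv x"
  using assms(5)
proof (induction A rule: infinite_finite_induct)
  interpret N: comm_group "G\<lparr>carrier := N\<rparr>" using abelian_comm_group[OF assms(1,2)] .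
  note c = sub_memD(1)[OF assms(1)]
  {
    case (infinite A)
    then show ?case using assms(3) by simp
  next
    case empty
    then show ?case using assms(3) by simp
  next
    case (insert a A)
    have fa: "f a \<in> N" and fA: "f \<in> A \<rightarrow> N" using insert by auto
    have "finprod (G\<lparr>carrier := N\<rparr>) f A \<in> N" using N.finprod_closed[of f A] fA by simp
    then have *: "finprod (G\<lparr>carrier := N\<rparr>) f A \<in> carrier G" "f a \<in> carrier G" using fa c by auto
    have g: "(\<lambda>i. x \<otimes> f i \<otimes> inv x) \<in> A \<rightarrow> carrier (G\<lparr>carrier := N\<rparr>)" using fA assms(4) by auto
    have "finprod (G\<lparr>carrier := N\<rparr>) (\<lambda>i. x \<otimes> f i \<otimes> inv x) (insert a A)
        = (x \<otimes> f a \<otimes> inv x) \<otimes> finprod (G\<lparr>carrier := N\<rparr>) (\<lambda>i. x \<otimes> f i \<otimes> inv x) A"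
      using N.finprod_insert[OF insert(1,2) g] assms(4)[OF fa] by simp
    also have "\<dots> = (x \<otimes> f a \<otimes> inv x) \<otimes> (x \<otimes> finprod (G\<lparr>carrier := N\<rparr>) f A \<otimes> inv x)"
      using insert(3)[OF fA] by simp
    also have "\<dots> = x \<otimes> (f a \<otimes> finprod (G\<lparr>carrier := N\<rparr>) f A) \<otimes> inv x"
      using * assms(3) by (simp add: m_assoc)
    finally show ?case using N.finprod_insert[OF insert(1,2), of f] fA fa by simp
  }
qed

lemma lcos_normal:
  assumes "nml N (carrier G)" "x \<in> carrier G" "n \<in> N"
  shows "lcos n (lcos x N) = lcos x N"
proof -
  note N = nmlD[OF assms(1)]
  have "inv x \<otimes> n \<otimes> x \<in> N" using normalizes_elem[OF N(4) assms(2,3)] .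
  then show ?thesis using fixed_lcos_iff[OF N(1) _ assms(2)] sub_memD(1)[OF N(1) assms(3)] by blast
qed

text \<open>For a transversal \<open>t\<close> of \<open>N\<close>, the product of the elements \<open>x t(C) t(xC)\<inverse>\<close> over all cosets \<open>C\<close> is a crossed
  homomorphism \<open>e\<close> with \<open>e n = n\<^sup>m\<close> on \<open>N\<close>, where \<open>m\<close> is the index; its kernel is the complement.\<close>

lemma abelian_normal_complement:
  assumes "nml N (carrier G)" "abelian N" "coprime (idx (carrier G) N) (card N)"
  shows "\<exists>C. sub C \<and> C \<inter> N = {\<one>} \<and> card C = idx (carrier G) N"
proof -
  note N = nmlD[OF assms(1)] and Nm = sub_memD[OF nmlD(1)[OF assms(1)]]
  have Nn: "x \<otimes> n \<otimes> inv x \<in> N" if "x \<in> carrier G" "n \<in> N" for x n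
    using normalizes_elem[OF N(4), of "inv x" n] that by simp
  interpret M: comm_group "G\<lparr>carrier := N\<rparr>" using abelian_comm_group[OF N(1) assms(2)] .
  define L where "L = (\<lambda>h. lcos h N) ` carrier G"
  have cardL: "card L = idx (carrier G) N"
    unfolding L_def using card_lcosets[OF N(2,1,3)] .
  have finL: "finite L" unfolding L_def using fin by simp
  define t where "t C = (SOME x. x \<in> carrier G \<and> lcos x N = C)" for C
  have t: "t C \<in> carrier G \<and> lcos (t C) N = C" if "C \<in> L" for C
    unfolding t_def by (rule someI_ex) (use that in \<open>auto simp: L_def\<close>)
  have L: "lcos x C \<in> L" if x: "x \<in> carrier G" and "C \<in> L" for x C
  proof -
    obtain h where h: "h \<in> carrier G" "C = lcos h N" using \<open>C \<in> L\<close> unfolding L_def by blast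
    then have "lcos x C = lcos (x \<otimes> h) N" using x lcos_mult[OF x h(1) N(3)] by simp
    then show ?thesis unfolding L_def using x h by blast
  qed
  have LG: "C \<subseteq> carrier G" if "C \<in> L" for C
    using that lcos_carrier N(3) unfolding L_def by blast
  define g where "g x C = x \<otimes> t C \<otimes> inv (t (lcos x C))" for x C
  have gN: "g x C \<in> N" if x: "x \<in> carrier G" and C: "C \<in> L" for x C
  proof -
    let ?s = "t (lcos x C)"
    have s: "?s \<in> carrier G" "lcos ?s N = lcos x C" using t L x C by auto
    have "lcos ?s N = lcos (x \<otimes> t C) N" using s t[OF C] lcos_mult[OF x _ N(3), of "t C"] by simp
    then have "inv ?s \<otimes> (x \<otimes> t C) \<in> N" using lcos_eq_iff[OF N(1)] s t[OF C] x by simp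
    then have "?s \<otimes> (inv ?s \<otimes> (x \<otimes> t C)) \<otimes> inv ?s \<in> N" using Nn s by blast
    then show ?thesis unfolding g_def using s t[OF C] x by (simp add: m_assoc)
  qed
  define e where "e x = finprod (G\<lparr>carrier := N\<rparr>) (g x) L" for x
  have eN: "e x \<in> N" if "x \<in> carrier G" for x
    unfolding e_def using M.finprod_closed[of "g x" L] gN that by auto
  have e_mult: "e (x \<otimes> y) = x \<otimes> e y \<otimes> inv x \<otimes> e x" if x: "x \<in> carrier G" and y: "y \<in> carrier G" for x y
  proof -
    \<comment> \<open>Inserting t(yC) makes the factors telescope. In the product over all cosets
      the second factors give \<open>e x\<close>, because translation by \<open>y\<close> only
      permutes the cosets.\<close>
    have g1: "g (x \<otimes> y) C = (x \<otimes> g y C \<otimes> inv x) \<otimes> g x (lcos y C)" if C: "C \<in> L" for C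
    proof -
      have "lcos (x \<otimes> y) C = lcos x (lcos y C)" using lcos_mult[OF x y LG[OF C]] by simp
      moreover have "t C \<in> carrier G" "t (lcos y C) \<in> carrier G" "t (lcos x (lcos y C)) \<in> carrier G"
        using t L x y C by blast+
      ultimately show ?thesis unfolding g_def using x y by (simp add: m_assoc)
    qed
    have inj: "inj_on (lcos y) L"
    proof (rule inj_onI)
      fix C D assume CD: "C \<in> L" "D \<in> L" and e: "lcos y C = lcos y D"
      have "lcos (inv y) (lcos y E) = E" if "E \<in> L" for E
        using lcos_mult[OF inv_closed[OF y] y LG[OF that]] lcos_one[OF LG[OF that]] y by simp
      note * = this
      show "C = D" using *[OF CD(1)] *[OF CD(2)] unfolding e by (rule subst)
    qed
    have img: "lcos y ` L = L"
      using L y by (intro endo_inj_surj[OF finL _ inj]) blast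
    have c1: "(\<lambda>C. x \<otimes> g y C \<otimes> inv x) \<in> L \<rightarrow> carrier (G\<lparr>carrier := N\<rparr>)"
      and c2: "(\<lambda>C. g x (lcos y C)) \<in> L \<rightarrow> carrier (G\<lparr>carrier := N\<rparr>)"
      and c3: "g y \<in> L \<rightarrow> N" and c4: "g x \<in> lcos y ` L \<rightarrow> carrier (G\<lparr>carrier := N\<rparr>)"
      using gN Nn x y L by auto
    have "e (x \<otimes> y) = finprod (G\<lparr>carrier := N\<rparr>) (\<lambda>C. (x \<otimes> g y C \<otimes> inv x) \<otimes>\<^bsub>G\<lparr>carrier := N\<rparr>\<^esub> g x (lcos y C)) L"
    proof -
      have c5: "(\<lambda>C. x \<otimes> g y C \<otimes> inv x \<otimes> g x (lcos y C)) \<in> L \<rightarrow> N"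
        using Nm(3)[OF Nn[OF x gN[OF y]] gN[OF x L[OF y]]] by blast
      show ?thesis unfolding e_def by (rule M.finprod_cong') (use g1 c5 in simp_all)
    qed
    also have "\<dots> = finprod (G\<lparr>carrier := N\<rparr>) (\<lambda>C. x \<otimes> g y C \<otimes> inv x) L
        \<otimes> finprod (G\<lparr>carrier := N\<rparr>) (\<lambda>C. g x (lcos y C)) L"
      using M.finprod_multf[OF c1 c2] by simp
    also have "finprod (G\<lparr>carrier := N\<rparr>) (\<lambda>C. g x (lcos y C)) L = e x"
      unfolding e_def using M.finprod_reindex[OF c4 inj] img by simp
    also have "finprod (G\<lparr>carrier := N\<rparr>) (\<lambda>C. x \<otimes> g y C \<otimes> inv x) L = x \<otimes> e y \<otimes> inv x"
      unfolding e_def using Nn[OF x] by (intro finprod_conj[OF N(1) assms(2) x _ c3])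
    finally show ?thesis .
  qed
  have e_N: "e n = n [^] idx (carrier G) N" if n: "n \<in> N" for n
  proof -
    \<comment> \<open>Elements of the normal subgroup \<open>N\<close> fix every coset, so the two
      representatives agree and cancel after \<open>n\<close>.\<close>
    have "g n C = n" if C: "C \<in> L" for C
    proof -
      have "lcos n C = C" using C n lcos_normal[OF assms(1)] unfolding L_def by blast
      then show ?thesis unfolding g_def using t[OF C] Nm(1)[OF n] by (simp add: m_assoc)
    qed
    then have "e n = finprod (G\<lparr>carrier := N\<rparr>) (\<lambda>C. n) L"
      unfolding e_def using n by (intro M.finprod_cong') auto
    also have "\<dots> = n [^] card L"
      using M.finprod_const[of n L] n by (simp flip: nat_pow_consistent)
    finally show ?thesis using cardL by simp
  qed
  have root: "\<exists>n\<in>N. n [^] idx (carrier G) N = a" if "a \<in> N" for a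
    using coprime_root(2)[OF N(1) assms(2,3) that] .
  define C where "C = {x \<in> carrier G. e x = \<one>}"
  have e1: "e \<one> = \<one>" using e_N[OF one_in[OF N(1)]] by simp
  have C: "sub C"
  proof (rule subgroupI)
    show "C \<subseteq> carrier G" "C \<noteq> {}" using e1 unfolding C_def by auto
    fix x assume "x \<in> C"
    then have x: "x \<in> carrier G" "e x = \<one>" unfolding C_def by auto
    have "e (inv x \<otimes> x) = inv x \<otimes> e x \<otimes> x \<otimes> e (inv x)" using e_mult[of "inv x" x] x(1) by simp
    then have "e (inv x) = \<one>" using x e1 Nm(1)[OF eN] by simp
    then show "inv x \<in> C" unfolding C_def using x by simp
  next
    fix x y assume "x \<in> C" "y \<in> C"
    then show "x \<otimes> y \<in> C" unfolding C_def using e_mult by simp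
  qed
  have CN: "C \<inter> N = {\<one>}"
  proof -
    have "n = \<one>" if "n \<in> C" "n \<in> N" for n
      using coprime_pow_eq_one[OF Nm(1)[OF that(2)] _ pow_card_sub[OF N(1) that(2)] assms(3)]
        e_N[OF that(2)] that(1) unfolding C_def by simp
    then show ?thesis using one_in[OF C] one_in[OF N(1)] by blast
  qed
  have "N <#> C = carrier G"
  proof (rule subset_antisym)
    show "N <#> C \<subseteq> carrier G" using N(3) sub_carrier[OF C] setmult_subset_G by blast
    show "carrier G \<subseteq> N <#> C"
    proof
      fix x assume x: "x \<in> carrier G"
      \<comment> \<open>By the crossed law e(nx) equals e(x) times the m-th power of n, so an m-th
        root of the inverse of e(x) moves x into the kernel. The root exists because m is prime to
        the order of \<open>N\<close>.\<close>
      obtain n where n: "n \<in> N" "n [^] idx (carrier G) N = inv (e x)"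
        using root Nm(2)[OF eN[OF x]] by blast
      note nc = Nm(1)[OF n(1)] Nm(1)[OF eN[OF x]]
      have comm: "n \<otimes> e x = e x \<otimes> n" using assms(2) n(1) eN[OF x] unfolding abelian_def by blast
      have "e (n \<otimes> x) = (n \<otimes> e x) \<otimes> inv n \<otimes> e n" using e_mult[OF nc(1) x] by simp
      also have "\<dots> = \<one>" unfolding comm using e_N[OF n(1)] n(2) nc by (simp add: m_assoc)
      finally have "n \<otimes> x \<in> C" unfolding C_def using nc x by simp
      then have "inv n \<otimes> (n \<otimes> x) \<in> N <#> C" using Nm(2)[OF n(1)] set_mult_memI by blast
      then show "x \<in> N <#> C" using nc x by simp
    qed
  qed
  then have "card (carrier G) = card C * card N"
    using card_set_mult[OF N(1) C] CN by (simp add: Int_commute mult.commute)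
  then have "idx (carrier G) N = card C" by (rule idx_eqI[OF N(1)])
  then show ?thesis using C CN by auto
qed

text \<open>Write \<open>x = d(x) y\<close> with \<open>d(x) \<in> N\<close> and \<open>y \<in> D\<close> for \<open>x \<in> C\<close>.  Averaging the crossed homomorphism \<open>d\<close> over \<open>C\<close>
  makes it principal, and an element that trivializes it conjugates \<open>C\<close> to \<open>D\<close>.\<close>

lemma abelian_normal_complements_conj:
  assumes "nml N (carrier G)" "abelian N" "coprime (idx (carrier G) N) (card N)"
    and C: "sub C" "C \<inter> N = {\<one>}" "card C = idx (carrier G) N"
    and D: "sub D" "D \<inter> N = {\<one>}" "card D = idx (carrier G) N"
  shows "\<exists>n\<in>N. cj n C = D"
proof -
  note N = nmlD[OF assms(1)] and Nm = sub_memD[OF nmlD(1)[OF assms(1)]]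
  note Cm = sub_memD[OF C(1)] and Dm = sub_memD[OF D(1)]
  have Nn: "x \<otimes> n \<otimes> inv x \<in> N" if "x \<in> carrier G" "n \<in> N" for x n
    using normalizes_elem[OF N(4), of "inv x" n] that by simp
  have comm: "a \<otimes> b = b \<otimes> a" if "a \<in> N" "b \<in> N" for a b
    using assms(2) that unfolding abelian_def by blast
  interpret M: comm_group "G\<lparr>carrier := N\<rparr>" using abelian_comm_group[OF N(1) assms(2)] .
  have "card (N <#> D) = card (carrier G)"
    using card_set_mult[OF N(1) D(1)] D(2,3) idx_card[OF N(2,1,3)] by (simp add: Int_commute mult.commute)
  moreover have "N <#> D \<subseteq> carrier G" using N(3) sub_carrier[OF D(1)] setmult_subset_G by blast
  ultimately have ND: "N <#> D = carrier G" using card_subset_eq[OF fin] by blast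
  define d where "d x = (SOME n. n \<in> N \<and> inv n \<otimes> x \<in> D)" for x
  have d: "d x \<in> N \<and> inv (d x) \<otimes> x \<in> D" if "x \<in> C" for x
    unfolding d_def
  proof (rule someI_ex)
    have "x \<in> N <#> D" using ND Cm(1)[OF that] by simp
    then obtain n y where n: "n \<in> N" "y \<in> D" "x = n \<otimes> y" using set_mult_mem by blast
    then have "inv n \<otimes> x = y" using Nm(1) Dm(1) by simp
    then show "\<exists>n. n \<in> N \<and> inv n \<otimes> x \<in> D" using n by blast
  qed
  \<comment> \<open>The factorization along G = ND is unique as D meets N trivially; this turns the
    choice \<open>d\<close> into a crossed homomorphism.\<close>
  have uniq: "n = k" if "n \<in> N" "k \<in> N" "inv n \<otimes> x \<in> D" "inv k \<otimes> x \<in> D" "x \<in> carrier G" for n k x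
  proof -
    have "(inv n \<otimes> x) \<otimes> inv (inv k \<otimes> x) \<in> D" using Dm that by blast
    moreover have "(inv n \<otimes> x) \<otimes> inv (inv k \<otimes> x) = inv n \<otimes> k"
      using that Nm(1) by (simp add: inv_mult_group m_assoc)
    ultimately have "inv n \<otimes> k = \<one>" using D(2) Nm that by auto
    then show ?thesis using that Nm(1) by (metis inv_closed inv_equality inv_inv)
  qed
  have d_mult: "d (x \<otimes> y) = d x \<otimes> (x \<otimes> d y \<otimes> inv x)" if x: "x \<in> C" and y: "y \<in> C" for x y
  proof (rule uniq[of _ _ "x \<otimes> y"])
    have c: "d x \<in> carrier G" "d y \<in> carrier G" "x \<in> carrier G" "y \<in> carrier G"
      using d x y Nm(1) Cm(1) by auto
    have xd: "x \<otimes> d y \<otimes> inv x \<in> N" using Nn c d y by blast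
    show "d (x \<otimes> y) \<in> N" "inv (d (x \<otimes> y)) \<otimes> (x \<otimes> y) \<in> D" using d Cm(3) x y by auto
    show "d x \<otimes> (x \<otimes> d y \<otimes> inv x) \<in> N" using xd d x Nm(3) by blast
    show "x \<otimes> y \<in> carrier G" using c by simp
    have "d x \<otimes> (x \<otimes> d y \<otimes> inv x) = (x \<otimes> d y \<otimes> inv x) \<otimes> d x" using comm xd d x by blast
    then have "inv (d x \<otimes> (x \<otimes> d y \<otimes> inv x)) \<otimes> (x \<otimes> y) = (inv (d x) \<otimes> x) \<otimes> (inv (d y) \<otimes> y)"
      using c by (simp add: inv_mult_group m_assoc)
    then show "inv (d x \<otimes> (x \<otimes> d y \<otimes> inv x)) \<otimes> (x \<otimes> y) \<in> D"
      using d x y Dm(3) by simp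
  qed
  define a where "a = finprod (G\<lparr>carrier := N\<rparr>) d C"
  have dC: "d \<in> C \<rightarrow> N" using d by blast
  have aN: "a \<in> N" unfolding a_def using M.finprod_closed[of d C] dC by simp
  \<comment> \<open>An m-th root of the product of all values of \<open>d\<close>: the averaging
    step, possible because m is prime to the order of \<open>N\<close>.\<close>
  obtain b where b: "b \<in> N" "b [^] card C = a"
    using coprime_root(2)[OF N(1) assms(2) _ aN, of "card C"] assms(3) C(3) by auto
  have "cj b C \<subseteq> D"
  proof
    fix z assume "z \<in> cj b C"
    then obtain x where x: "x \<in> C" "z = inv b \<otimes> x \<otimes> b" unfolding cj_def by blast
    have xc: "x \<in> carrier G" "b \<in> carrier G" "d x \<in> carrier G" "d x \<in> N" using x b Cm Nm d by auto
    have inj: "inj_on (\<lambda>y. x \<otimes> y) C" by (rule inj_onI) (use xc Cm in simp)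
    have img: "(\<lambda>y. x \<otimes> y) ` C = C"
      using Cm x by (intro endo_inj_surj[OF sub_fin[OF C(1)] _ inj]) blast
    have c1: "d \<in> (\<lambda>y. x \<otimes> y) ` C \<rightarrow> carrier (G\<lparr>carrier := N\<rparr>)" using img dC by simp
    have c2: "(\<lambda>y. x \<otimes> d y \<otimes> inv x) \<in> C \<rightarrow> carrier (G\<lparr>carrier := N\<rparr>)" using Nn xc d by auto
    have c3: "(\<lambda>y. d x) \<in> C \<rightarrow> carrier (G\<lparr>carrier := N\<rparr>)" using xc by simp
    have "a = finprod (G\<lparr>carrier := N\<rparr>) (\<lambda>y. d (x \<otimes> y)) C"
      unfolding a_def using M.finprod_reindex[OF c1 inj] img by simp
    also have "\<dots> = finprod (G\<lparr>carrier := N\<rparr>) (\<lambda>y. d x \<otimes>\<^bsub>G\<lparr>carrier := N\<rparr>\<^esub> (x \<otimes> d y \<otimes> inv x)) C"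
      using d_mult[OF x(1)] c2 xc Nm(3) by (intro M.finprod_cong') auto
    also have "\<dots> = finprod (G\<lparr>carrier := N\<rparr>) (\<lambda>y. d x) C \<otimes> finprod (G\<lparr>carrier := N\<rparr>) (\<lambda>y. x \<otimes> d y \<otimes> inv x) C"
      using M.finprod_multf[OF c3 c2] by simp
    also have "finprod (G\<lparr>carrier := N\<rparr>) (\<lambda>y. d x) C = d x [^] card C"
      using M.finprod_const[of "d x" C] xc by (simp flip: nat_pow_consistent)
    also have "finprod (G\<lparr>carrier := N\<rparr>) (\<lambda>y. x \<otimes> d y \<otimes> inv x) C = x \<otimes> a \<otimes> inv x"
      unfolding a_def using Nn[OF xc(1)] by (intro finprod_conj[OF N(1) assms(2) xc(1) _ dC])
    also have "x \<otimes> a \<otimes> inv x = (x \<otimes> b \<otimes> inv x) [^] card C"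
    proof -
      have "(x \<otimes> b \<otimes> inv x) [^] k = x \<otimes> (b [^] k) \<otimes> inv x" for k :: nat
        using xc by (induction k) (simp_all add: m_assoc)
      then show ?thesis using b(2) by simp
    qed
    also have "d x [^] card C \<otimes> (x \<otimes> b \<otimes> inv x) [^] card C = (d x \<otimes> (x \<otimes> b \<otimes> inv x)) [^] card C"
      using pow_mult_distrib[OF comm[OF xc(4) Nn[OF xc(1) b(1)]]] xc by simp
    finally have "b [^] card C = (d x \<otimes> (x \<otimes> b \<otimes> inv x)) [^] card C" using b(2) by simp
    moreover have "d x \<otimes> (x \<otimes> b \<otimes> inv x) \<in> N" using Nm(3) xc Nn b by blast
    \<comment> \<open>Both sides have the same m-th power, and roots in \<open>N\<close> are unique.
      Solving for d(x) shows that conjugation by b sends x to its D-component.\<close>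
    ultimately have be: "b = d x \<otimes> (x \<otimes> b \<otimes> inv x)"
      using inj_onD[OF coprime_root(1)[OF N(1) assms(2), of "card C"]] assms(3) C(3) b(1) by simp
    have "inv (d x) \<otimes> b = x \<otimes> b \<otimes> inv x"
    proof -
      have "inv (d x) \<otimes> b = inv (d x) \<otimes> (d x \<otimes> (x \<otimes> b \<otimes> inv x))" using be by simp
      then show ?thesis using xc by (simp add: m_assoc)
    qed
    then have "b \<otimes> inv (d x) = x \<otimes> b \<otimes> inv x" using comm[OF b(1) Nm(2)[OF xc(4)]] by simp
    then have "b \<otimes> inv (d x) \<otimes> x = x \<otimes> b" using xc by (simp add: m_assoc)
    then have "inv b \<otimes> (b \<otimes> (inv (d x) \<otimes> x)) = inv b \<otimes> (x \<otimes> b)" using xc by (simp add: m_assoc)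
    then have "z = inv (d x) \<otimes> x" using x(2) xc by (simp add: m_assoc)
    then show "z \<in> D" using d x(1) by simp
  qed
  moreover have "card (cj b C) = card D"
    using C(3) D(3) Nm(1)[OF b(1)] sub_carrier[OF C(1)] by simp
  ultimately have "cj b C = D" using card_subset_eq[OF sub_fin[OF D(1)]] by blast
  then show ?thesis using b by blast
qed

text \<open>Bundles what is needed to apply a theorem about a full group to the section H/W and pull
  the result back: Q is again a \<open>finite_group\<close>, and the subgroups of H above W are
  recovered from their images.\<close>

lemma quotient_correspondence:
  assumes "nml W H"
  defines "Q \<equiv> G\<lparr>carrier := H\<rparr> Mod W" and "q \<equiv> (\<lambda>x. W #> x)"
  shows "finite_group Q"
    and "sub L \<Longrightarrow> W \<subseteq> L \<Longrightarrow> L \<subseteq> H \<Longrightarrow> subgroup (q ` L) Q \<and> card (q ` L) = idx L W"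
    and "subgroup C Q \<Longrightarrow> \<exists>L. sub L \<and> W \<subseteq> L \<and> L \<subseteq> H \<and> q ` L = C"
    and "sub A \<Longrightarrow> W \<subseteq> A \<Longrightarrow> A \<subseteq> H \<Longrightarrow> x \<in> H \<Longrightarrow> q x \<in> q ` A \<Longrightarrow> x \<in> A"
    and "x \<in> H \<Longrightarrow> y \<in> H \<Longrightarrow> q (x \<otimes> y) = q x \<otimes>\<^bsub>Q\<^esub> q y"
    and "x \<in> H \<Longrightarrow> q (inv x) = inv\<^bsub>Q\<^esub> q x"
    and "q ` H = carrier Q" and "\<one>\<^bsub>Q\<^esub> = W"
proof -
  note W = nmlD[OF assms(1)] and Hm = sub_memD[OF nmlD(2)[OF assms(1)]] and Wm = sub_memD[OF nmlD(1)[OF assms(1)]]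
  let ?H = "G\<lparr>carrier := H\<rparr>"
  interpret H: group ?H using subgroup_imp_group[OF W(2)] .
  interpret N: normal W ?H using assms(1) normal_iff_nml[OF W(2)] by blast
  interpret Q: group Q unfolding Q_def by (rule N.factorgroup_is_group)
  have hom: "q \<in> hom ?H Q"
    using N.r_coset_hom_Mod unfolding Q_def q_def by simp
  interpret q: group_hom ?H Q q by unfold_locales (rule hom)
  have carr: "q ` H = carrier Q"
    unfolding Q_def q_def by (simp add: carrier_FactGroup)
  then show "q ` H = carrier Q" .
  show "finite_group Q"
    by unfold_locales (use carr sub_fin[OF W(2)] finite_imageI in metis)
  show one: "\<one>\<^bsub>Q\<^esub> = W" unfolding Q_def by simp
  show mult: "q (x \<otimes> y) = q x \<otimes>\<^bsub>Q\<^esub> q y" if "x \<in> H" "y \<in> H" for x y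
    using q.hom_mult[of x y] that by simp
  show invq: "q (inv x) = inv\<^bsub>Q\<^esub> q x" if "x \<in> H" for x
    using q.hom_inv[of x] that m_inv_consistent[OF W(2)] by simp
  have q_eq: "q x = q y \<longleftrightarrow> x \<otimes> inv y \<in> W" if "x \<in> H" "y \<in> H" for x y
  proof
    assume "q x = q y"
    then have "x \<in> W #> y" using rcos_self[of x W] Hm(1) that W(1) unfolding q_def by blast
    then obtain w where "w \<in> W" "x = w \<otimes> y" unfolding r_coset_def by blast
    then show "x \<otimes> inv y \<in> W" using Hm(1) Wm(1) that by (simp add: m_assoc)
  next
    assume a: "x \<otimes> inv y \<in> W"
    have "x = (x \<otimes> inv y) \<otimes> y" using Hm(1) that by (simp add: m_assoc)
    then have "x \<in> W #> y" using a unfolding r_coset_def by blast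
    then show "q x = q y" unfolding q_def using repr_independence[of x W y] Hm(1) that W(1) by simp
  qed
  show "x \<in> A" if A: "sub A" "W \<subseteq> A" "A \<subseteq> H" and x: "x \<in> H" "q x \<in> q ` A" for A x
  proof -
    obtain a where a: "a \<in> A" "q x = q a" using x by blast
    then have "x \<otimes> inv a \<in> A" using q_eq x A by blast
    then have "(x \<otimes> inv a) \<otimes> a \<in> A" using sub_memD(3)[OF A(1)] a by blast
    moreover have "(x \<otimes> inv a) \<otimes> a = x" using Hm(1) x a A(3) by (simp add: m_assoc subset_iff)
    ultimately show ?thesis by simp
  qed
  show "subgroup (q ` L) Q \<and> card (q ` L) = idx L W" if L: "sub L" "W \<subseteq> L" "L \<subseteq> H" for L
  proof
    have "subgroup L ?H" using L sub_restrict[OF W(2)] by blast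
    then show "subgroup (q ` L) Q" using q.subgroup_img_is_subgroup by blast
    have fib: "card {x \<in> L. q x = c} = card W" if c: "c \<in> q ` L" for c
    proof -
      obtain y where y: "y \<in> L" "c = q y" using c by blast
      have yH: "y \<in> carrier G" using y L Hm by blast
      have "{x \<in> L. q x = c} = (\<lambda>w. w \<otimes> y) ` W"
      proof (intro subset_antisym subsetI)
        fix x assume x: "x \<in> {x \<in> L. q x = c}"
        then have "x \<otimes> inv y \<in> W" using q_eq y L by blast
        moreover have "x = (x \<otimes> inv y) \<otimes> y" using x yH L Hm(1) by (simp add: m_assoc subset_iff)
        ultimately show "x \<in> (\<lambda>w. w \<otimes> y) ` W" by blast
      next
        fix x assume "x \<in> (\<lambda>w. w \<otimes> y) ` W"
        then obtain w where w: "w \<in> W" "x = w \<otimes> y" by blast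
        then have "x \<in> L" using L y sub_memD(3) by blast
        moreover have "x \<otimes> inv y = w" using w yH Wm(1) by (simp add: m_assoc)
        ultimately show "x \<in> {x \<in> L. q x = c}" using q_eq[of x y] w y L by auto
      qed
      moreover have "inj_on (\<lambda>w. w \<otimes> y) W" by (rule inj_onI) (use yH Wm(1) in simp)
      ultimately show ?thesis by (simp add: card_image)
    qed
    have "card L = (\<Sum>c\<in>q ` L. card {x \<in> L. q x = c})"
      using sum.image_gen[of L "\<lambda>_. 1::nat" q] sub_fin[OF L(1)] by simp
    also have "\<dots> = (\<Sum>c\<in>q ` L. card W)" using fib by (intro sum.cong refl)
    finally show "card (q ` L) = idx L W" using idx_eqI[OF W(1), of L "card (q ` L)"] by simp
  qed
  show "\<exists>L. sub L \<and> W \<subseteq> L \<and> L \<subseteq> H \<and> q ` L = C" if C: "subgroup C Q"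
  proof (intro exI conjI)
    let ?L = "{x \<in> H. q x \<in> C}"
    show "sub ?L"
    proof (rule subgroupI)
      show "?L \<subseteq> carrier G" using Hm by blast
      have "q \<one> = \<one>\<^bsub>Q\<^esub>" using q.hom_one by simp
      then show "?L \<noteq> {}" using subgroup.one_closed[OF C] one_in[OF W(2)] by auto
      show "inv x \<in> ?L" if "x \<in> ?L" for x
        using that invq Hm subgroup.m_inv_closed[OF C] by simp
      show "x \<otimes> y \<in> ?L" if "x \<in> ?L" "y \<in> ?L" for x y
        using that mult Hm subgroup.m_closed[OF C] by simp
    qed
    have "q x = W" if "x \<in> W" for x
      unfolding q_def using that coset_join2 Wm(1) W(1) by blast
    then show "W \<subseteq> ?L" using subgroup.one_closed[OF C] one W(3) by auto
    show "?L \<subseteq> H" by blast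
    show "q ` ?L = C"
    proof (intro subset_antisym subsetI)
      fix c assume c: "c \<in> C"
      then have "c \<in> q ` H" using subgroup.subset[OF C] carr by blast
      then show "c \<in> q ` ?L" using c by blast
    qed blast
  qed
qed

lemma nml_carrierI: "sub N \<Longrightarrow> (\<And>x n. x \<in> carrier G \<Longrightarrow> n \<in> N \<Longrightarrow> inv x \<otimes> n \<otimes> x \<in> N) \<Longrightarrow> nml N (carrier G)"
  by (rule nmlI[OF _ sub_carrier_self sub_carrier normalizesI]) simp_all

text \<open>The abelian case of Schur-Zassenhaus in H/W, for the normal subgroup Z/W; that Z/W is
  abelian is expressed by commutators lying in W.\<close>

lemma relative_complements:
  assumes "nml W H" "nml Z H" "W \<subseteq> Z" "coprime (idx H Z) (idx Z W)"
    and ab: "\<And>a b. a \<in> Z \<Longrightarrow> b \<in> Z \<Longrightarrow> inv a \<otimes> inv b \<otimes> a \<otimes> b \<in> W"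
  shows "\<exists>C. sub C \<and> W \<subseteq> C \<and> C \<subseteq> H \<and> C \<inter> Z = W \<and> idx C W = idx H Z"
    and "\<And>C D. \<lbrakk>sub C; W \<subseteq> C; C \<subseteq> H; C \<inter> Z = W; idx C W = idx H Z;
           sub D; W \<subseteq> D; D \<subseteq> H; D \<inter> Z = W; idx D W = idx H Z\<rbrakk> \<Longrightarrow> \<exists>z\<in>Z. cj z C = D"
proof -
  note W = nmlD[OF assms(1)] and Z = nmlD[OF assms(2)]
  note Hm = sub_memD[OF nmlD(2)[OF assms(1)]]
  define Q where "Q = G\<lparr>carrier := H\<rparr> Mod W"
  define q where "q = (\<lambda>x. W #> x)"
  note qc = quotient_correspondence[OF assms(1), folded Q_def q_def]
  interpret Q: finite_group Q by (rule qc(1))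
  have ZQ: "Q.sub (q ` Z)" "card (q ` Z) = idx Z W" using qc(2)[OF Z(1) assms(3) Z(3)] by auto
  have HQ: "card (carrier Q) = idx H W" using qc(2)[OF W(2,3)] qc(7) by simp
  have idxQ: "idx (carrier Q) (q ` Z) = idx H Z"
    using idx_trans[OF W(2) Z(1) W(1) assms(3) Z(3)] ZQ HQ by (intro Q.idx_eqI) auto
  have cap: "q ` A \<inter> q ` Z = q ` (A \<inter> Z)" if A: "sub A" "W \<subseteq> A" "A \<subseteq> H" for A
  proof (intro subset_antisym subsetI)
    fix c assume "c \<in> q ` A \<inter> q ` Z"
    then obtain a where a: "a \<in> A" "c = q a" "q a \<in> q ` Z" by blast
    then have "a \<in> Z" using qc(4)[OF Z(1) assms(3) Z(3)] A(3) by blast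
    then show "c \<in> q ` (A \<inter> Z)" using a by blast
  qed blast
  have qW: "q ` W = {\<one>\<^bsub>Q\<^esub>}"
  proof -
    have "q w = W" if "w \<in> W" for w
      unfolding q_def using coset_join2[OF sub_memD(1)[OF W(1) that] W(1) that] .
    then have "q ` W = {W}" using one_in[OF W(1)] by blast
    then show ?thesis unfolding qc(8) .
  qed
  \<comment> \<open>Subgroups above the kernel W are determined by their images, which pulls
    equalities in Q back to G.\<close>
  have eqI: "A = B" if "sub A" "W \<subseteq> A" "A \<subseteq> H" "sub B" "W \<subseteq> B" "B \<subseteq> H" "q ` A = q ` B" for A B
  proof (intro subset_antisym subsetI)
    fix x
    show "x \<in> B" if "x \<in> A"
    proof (rule qc(4)[OF \<open>sub B\<close> \<open>W \<subseteq> B\<close> \<open>B \<subseteq> H\<close>])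
      show "x \<in> H" using \<open>A \<subseteq> H\<close> that by (rule subsetD)
      show "q x \<in> q ` B" using that \<open>q ` A = q ` B\<close> by (metis imageI)
    qed
    show "x \<in> A" if "x \<in> B"
    proof (rule qc(4)[OF \<open>sub A\<close> \<open>W \<subseteq> A\<close> \<open>A \<subseteq> H\<close>])
      show "x \<in> H" using \<open>B \<subseteq> H\<close> that by (rule subsetD)
      show "q x \<in> q ` A" using that \<open>q ` A = q ` B\<close> by (metis imageI)
    qed
  qed
  have nQ: "Q.nml (q ` Z) (carrier Q)"
  proof (rule Q.nml_carrierI[OF ZQ(1)])
    fix x n assume "x \<in> carrier Q" "n \<in> q ` Z"
    then obtain h z where h: "h \<in> H" "x = q h" "z \<in> Z" "n = q z" using qc(7) by blast
    have "inv h \<otimes> z \<otimes> h \<in> Z" using normalizes_elem[OF Z(4)] h by blast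
    moreover have "q (inv h \<otimes> z \<otimes> h) = inv\<^bsub>Q\<^esub> x \<otimes>\<^bsub>Q\<^esub> n \<otimes>\<^bsub>Q\<^esub> x"
    proof -
      have "z \<in> H" using h(3) Z(3) by blast
      moreover have "inv h \<in> H" "inv h \<otimes> z \<in> H" using calculation h(1) Hm(2,3) by blast+
      ultimately show ?thesis unfolding h(2,4) using h(1) qc(5,6) by simp
    qed
    ultimately show "inv\<^bsub>Q\<^esub> x \<otimes>\<^bsub>Q\<^esub> n \<otimes>\<^bsub>Q\<^esub> x \<in> q ` Z" by (metis imageI)
  qed
  have abQ: "Q.abelian (q ` Z)"
    unfolding Q.abelian_def
  proof (intro ballI)
    fix x y assume "x \<in> q ` Z" "y \<in> q ` Z"
    then obtain a b where a: "a \<in> Z" "x = q a" "b \<in> Z" "y = q b" by blast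
    have h: "a \<in> H" "b \<in> H" using a Z(3) by auto
    then have h': "inv a \<in> H" "inv b \<in> H" "inv a \<otimes> inv b \<in> H" "inv a \<otimes> inv b \<otimes> a \<in> H" using Hm(2,3) by blast+
    have "q (inv a \<otimes> inv b \<otimes> a \<otimes> b) = \<one>\<^bsub>Q\<^esub>" using ab[OF a(1,3)] qW by blast
    moreover have "q (inv a \<otimes> inv b \<otimes> a \<otimes> b) = inv\<^bsub>Q\<^esub> x \<otimes>\<^bsub>Q\<^esub> inv\<^bsub>Q\<^esub> y \<otimes>\<^bsub>Q\<^esub> x \<otimes>\<^bsub>Q\<^esub> y"
      unfolding a(2,4) using h h' qc(5,6) by simp
    moreover have xy: "x \<in> carrier Q" "y \<in> carrier Q" unfolding a(2,4) qc(7)[symmetric] using h by blast+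
    ultimately have "y \<otimes>\<^bsub>Q\<^esub> x \<otimes>\<^bsub>Q\<^esub> (inv\<^bsub>Q\<^esub> x \<otimes>\<^bsub>Q\<^esub> inv\<^bsub>Q\<^esub> y \<otimes>\<^bsub>Q\<^esub> x \<otimes>\<^bsub>Q\<^esub> y) = y \<otimes>\<^bsub>Q\<^esub> x"
      by simp
    then show "x \<otimes>\<^bsub>Q\<^esub> y = y \<otimes>\<^bsub>Q\<^esub> x" using xy by (simp add: Q.m_assoc)
  qed
  have cop: "coprime (idx (carrier Q) (q ` Z)) (card (q ` Z))" using assms(4) idxQ ZQ by simp
  show "\<exists>C. sub C \<and> W \<subseteq> C \<and> C \<subseteq> H \<and> C \<inter> Z = W \<and> idx C W = idx H Z"
  proof -
    obtain C' where C': "Q.sub C'" "C' \<inter> q ` Z = {\<one>\<^bsub>Q\<^esub>}" "card C' = idx (carrier Q) (q ` Z)"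
      using Q.abelian_normal_complement[OF nQ abQ cop] by blast
    obtain C where C: "sub C" "W \<subseteq> C" "C \<subseteq> H" "q ` C = C'" using qc(3)[OF C'(1)] by blast
    have e: "q ` (C \<inter> Z) = q ` W" unfolding cap[OF C(1-3), symmetric] C(4) C'(2) qW by (rule refl)
    have "W \<subseteq> C \<inter> Z" "C \<inter> Z \<subseteq> H" using C(2,3) assms(3) by blast+
    then have "C \<inter> Z = W" by (rule eqI[OF sub_Int[OF C(1) Z(1)] _ _ W(1) subset_refl W(3) e])
    moreover have "idx C W = idx H Z" using qc(2)[OF C(1-3)] C(4) C'(3) idxQ by simp
    ultimately show ?thesis using C by blast
  qed
  show "\<exists>z\<in>Z. cj z C = D"
    if C: "sub C" "W \<subseteq> C" "C \<subseteq> H" "C \<inter> Z = W" "idx C W = idx H Z"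
      and D: "sub D" "W \<subseteq> D" "D \<subseteq> H" "D \<inter> Z = W" "idx D W = idx H Z" for C D
  proof -
    have 1: "Q.sub (q ` C)" "q ` C \<inter> q ` Z = {\<one>\<^bsub>Q\<^esub>}" "card (q ` C) = idx (carrier Q) (q ` Z)"
      using qc(2)[OF C(1-3)] unfolding cap[OF C(1-3)] C(4,5) qW idxQ by simp_all
    have 2: "Q.sub (q ` D)" "q ` D \<inter> q ` Z = {\<one>\<^bsub>Q\<^esub>}" "card (q ` D) = idx (carrier Q) (q ` Z)"
      using qc(2)[OF D(1-3)] unfolding cap[OF D(1-3)] D(4,5) qW idxQ by simp_all
    obtain n where n: "n \<in> q ` Z" "Q.cj n (q ` C) = q ` D"
      using Q.abelian_normal_complements_conj[OF nQ abQ cop 1 2] by blast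
    obtain z where z: "z \<in> Z" "n = q z" using n by blast
    have zH: "z \<in> H" "z \<in> carrier G" using z Z(3) Hm by auto
    have "q (inv z \<otimes> c \<otimes> z) = inv\<^bsub>Q\<^esub> n \<otimes>\<^bsub>Q\<^esub> q c \<otimes>\<^bsub>Q\<^esub> n" if c: "c \<in> C" for c
    proof -
      have h: "c \<in> H" "inv z \<in> H" "inv z \<otimes> c \<in> H" using c C(3) zH(1) Hm(2,3) by blast+
      show ?thesis unfolding z(2) using h zH qc(5,6) by simp
    qed
    then have "q ` cj z C = q ` D"
      unfolding n(2)[symmetric] cj_def Q.cj_def image_image by (rule image_cong[OF refl])
    moreover have "W \<subseteq> cj z C" using cj_mono[OF C(2)] W(5)[OF zH(1)] by metis
    ultimately have "cj z C = D"
      by (intro eqI[OF sub_cj[OF zH(2) C(1)] _ cj_subset_sub[OF W(2) zH(1) C(3)] D(1-3)])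
    then show ?thesis using z by blast
  qed
qed

text \<open>Z is the preimage of the centre of the non-trivial p-group N/W. It is normal in H
  because H acts on N/W, and it exceeds W by counting fixed cosets under conjugation.\<close>

lemma relative_centre:
  assumes "nml W H" "nml N H" "W \<subseteq> N" "W \<noteq> N" "prime p" "pi_number {p} (idx N W)"
  shows "\<exists>Z. nml Z H \<and> W \<subseteq> Z \<and> Z \<subseteq> N \<and> Z \<noteq> W \<and> (\<forall>a\<in>Z. \<forall>b\<in>Z. inv a \<otimes> inv b \<otimes> a \<otimes> b \<in> W)"
proof -
  note W = nmlD[OF assms(1)] and N = nmlD[OF assms(2)]
  note Hm = sub_memD[OF W(2)] and Wm = sub_memD[OF W(1)] and Nm = sub_memD[OF N(1)]
  have Wc: "inv h \<otimes> w \<otimes> h \<in> W" if "h \<in> H" "w \<in> W" for h w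
    using normalizes_elem[OF W(4)] that by blast
  have Nc: "inv h \<otimes> n \<otimes> h \<in> N" if "h \<in> H" "n \<in> N" for h n
    using normalizes_elem[OF N(4)] that by blast
  have Wc': "h \<otimes> w \<otimes> inv h \<in> W" if "h \<in> H" "w \<in> W" for h w
    using Wc[of "inv h" w] that Hm by simp
  have Nc': "h \<otimes> w \<otimes> inv h \<in> N" if "h \<in> H" "w \<in> N" for h w
    using Nc[of "inv h" w] that Hm by simp
  \<comment> \<open>The condition says [z, n] \<in> W for all n in N.\<close>
  define Z where "Z = {z \<in> N. \<forall>n\<in>N. inv z \<otimes> (inv n \<otimes> z \<otimes> n) \<in> W}"
  have carr: "x \<in> carrier G" if "x \<in> N" for x using that Nm by blast
  have Z: "sub Z"
  proof (rule subgroupI)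
    show "Z \<subseteq> carrier G" unfolding Z_def using Nm by blast
    have "inv \<one> \<otimes> (inv n \<otimes> \<one> \<otimes> n) \<in> W" if "n \<in> N" for n
      using one_in[OF W(1)] carr[OF that] by simp
    then show "Z \<noteq> {}" unfolding Z_def using one_in[OF N(1)] by blast
    fix x assume x: "x \<in> Z"
    then have xN: "x \<in> N" unfolding Z_def by blast
    have "inv (inv x) \<otimes> (inv n \<otimes> inv x \<otimes> n) \<in> W" if n: "n \<in> N" for n
    proof -
      let ?w = "inv x \<otimes> (inv n \<otimes> x \<otimes> n)"
      have "?w \<in> W" using x n unfolding Z_def by blast
      then have "x \<otimes> inv ?w \<otimes> inv x \<in> W" using Wc' xN N(3) Wm by blast
      moreover have "x \<otimes> inv ?w \<otimes> inv x = inv (inv x) \<otimes> (inv n \<otimes> inv x \<otimes> n)"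
        using carr[OF xN] carr[OF n] by (simp add: inv_mult_group m_assoc)
      ultimately show ?thesis by simp
    qed
    then show "inv x \<in> Z" unfolding Z_def using xN Nm by blast
  next
    fix x y assume x: "x \<in> Z" and y: "y \<in> Z"
    then have xN: "x \<in> N" "y \<in> N" unfolding Z_def by blast+
    have "inv (x \<otimes> y) \<otimes> (inv n \<otimes> (x \<otimes> y) \<otimes> n) \<in> W" if n: "n \<in> N" for n
    proof -
      let ?w = "inv x \<otimes> (inv n \<otimes> x \<otimes> n)" and ?v = "inv y \<otimes> (inv n \<otimes> y \<otimes> n)"
      have "?w \<in> W" "?v \<in> W" using x y n unfolding Z_def by blast+
      then have "(inv y \<otimes> ?w \<otimes> y) \<otimes> ?v \<in> W" using Wc xN N(3) Wm by blast
      moreover have "(inv y \<otimes> ?w \<otimes> y) \<otimes> ?v = inv (x \<otimes> y) \<otimes> (inv n \<otimes> (x \<otimes> y) \<otimes> n)"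
        using carr[OF xN(1)] carr[OF xN(2)] carr[OF n] by (simp add: inv_mult_group m_assoc)
      ultimately show ?thesis by simp
    qed
    then show "x \<otimes> y \<in> Z" unfolding Z_def using xN Nm by blast
  qed
  have WZ: "W \<subseteq> Z"
  proof
    fix w assume w: "w \<in> W"
    have "inv w \<otimes> (inv n \<otimes> w \<otimes> n) \<in> W" if "n \<in> N" for n
      using w Wm Wc that N(3) by blast
    then show "w \<in> Z" unfolding Z_def using w assms(3) by blast
  qed
  have nZ: "nml Z H"
  proof (intro nmlI normalizesI Z W(2))
    show "Z \<subseteq> H" unfolding Z_def using N(3) by blast
    show "H \<subseteq> carrier G" using sub_carrier[OF W(2)] .
    fix z h assume z: "z \<in> Z" and h: "h \<in> H"
    have zN: "z \<in> N" using z unfolding Z_def by blast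
    have "inv (inv h \<otimes> z \<otimes> h) \<otimes> (inv n \<otimes> (inv h \<otimes> z \<otimes> h) \<otimes> n) \<in> W" if n: "n \<in> N" for n
    proof -
      let ?m = "h \<otimes> n \<otimes> inv h"
      have m: "?m \<in> N" using Nc' h n by blast
      then have "inv z \<otimes> (inv ?m \<otimes> z \<otimes> ?m) \<in> W" using z unfolding Z_def by blast
      then have "inv h \<otimes> (inv z \<otimes> (inv ?m \<otimes> z \<otimes> ?m)) \<otimes> h \<in> W" using Wc h by blast
      moreover have "inv h \<otimes> (inv z \<otimes> (inv ?m \<otimes> z \<otimes> ?m)) \<otimes> h
          = inv (inv h \<otimes> z \<otimes> h) \<otimes> (inv n \<otimes> (inv h \<otimes> z \<otimes> h) \<otimes> n)"
        using carr[OF zN] carr[OF n] Hm(1)[OF h] by (simp add: inv_mult_group m_assoc)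
      ultimately show ?thesis by simp
    qed
    then show "inv h \<otimes> z \<otimes> h \<in> Z" unfolding Z_def using Nc h zN by blast
  qed
  have abZ: "inv a \<otimes> inv b \<otimes> a \<otimes> b \<in> W" if "a \<in> Z" "b \<in> Z" for a b
  proof -
    have "a \<in> N" "b \<in> N" "inv a \<otimes> (inv b \<otimes> a \<otimes> b) \<in> W" using that unfolding Z_def by blast+
    then show ?thesis using carr by (simp add: m_assoc)
  qed
  have "Z \<noteq> W"
  proof
    assume ZW: "Z = W"
    have nWN: "nml W N" using nml_restrict[OF assms(1) N(1) assms(3) N(3)] .
    obtain P where P: "sub P" "P \<subseteq> N" "card P = p ^ multiplicity p (card N)" "N = W <#> P"
      using p_quotient_supplement[OF nWN assms(6,5)] by blast
    have Pc: "g \<in> carrier G" "g \<in> N" "g \<in> H" if "g \<in> P" for g using that P(2) carr N(3) by blast+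
    define X where "X = (\<lambda>h. lcos h W) ` N"
    \<comment> \<open>The inverse turns the right action \<open>cj\<close> into the left action
      required by \<open>p_group_fixed_points\<close>.\<close>
    define f where "f g C = cj (inv g) C" for g C
    have f_lcos: "f g (lcos z W) = lcos (g \<otimes> z \<otimes> inv g) W" if g: "g \<in> H" and z: "z \<in> N" for g z
    proof -
      have c: "g \<in> carrier G" "z \<in> carrier G" using g z Hm carr by auto
      have "cj (inv g) W = W" using W(5) Hm(2)[OF g] by blast
      then have "lcos (g \<otimes> z \<otimes> inv g) W = lcos (g \<otimes> z \<otimes> inv g) (cj (inv g) W)" by simp
      also have "\<dots> = f g (lcos z W)"
        unfolding f_def cj_def lcos_def image_image
        by (rule image_cong[OF refl]) (use c Wm(1) in \<open>simp add: m_assoc\<close>)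
      finally show ?thesis by simp
    qed
    have X: "X \<subseteq> Pow (carrier G)" unfolding X_def using lcos_carrier carr sub_carrier[OF W(1)] by blast
    have fX: "f g C \<in> X" if "g \<in> P" "C \<in> X" for g C
      using that f_lcos Nc' Pc unfolding X_def by auto
    have fm: "f (g \<otimes> h) C = f g (f h C)" if "g \<in> P" "h \<in> P" "C \<in> Pow (carrier G)" for g h C
      unfolding f_def using that Pc by (simp add: cj_mult inv_mult_group)
    have f1: "f \<one> C = C" if "C \<in> Pow (carrier G)" for C using that unfolding f_def by simp
    have cX: "card X = idx N W" unfolding X_def using card_lcosets[OF N(1) W(1) assms(3)] .
    have fin: "finite X" unfolding X_def using sub_fin[OF N(1)] by simp
    have "idx N W \<noteq> 1" using idx_1D[OF N(1) W(1) assms(3)] assms(4) by blast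
    then have "p dvd card X"
      using pi_number_prime_power[OF assms(5,6)] cX by (metis dvd_power gr0I power_0)
    then have pF: "p dvd card {C \<in> X. \<forall>g\<in>P. f g C = C}"
      using p_group_fixed_points[OF P(1,3) assms(5) fm f1 fin X fX] by blast
    \<comment> \<open>A coset zW fixed by P is centralized modulo W by N = WP, since W itself acts
      trivially on cosets here; so z lies in Z = W. Only one fixed coset would remain, against
      divisibility by p.\<close>
    have "{C \<in> X. \<forall>g\<in>P. f g C = C} \<subseteq> {W}"
    proof
      fix C assume C: "C \<in> {C \<in> X. \<forall>g\<in>P. f g C = C}"
      then obtain z where z: "z \<in> N" "C = lcos z W" unfolding X_def by blast
      have zc: "z \<in> carrier G" using carr z by blast
      have zP: "inv z \<otimes> (inv g \<otimes> z \<otimes> g) \<in> W" if g: "g \<in> P" for g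
      proof -
        have "inv g \<in> P" using sub_memD(2)[OF P(1) g] .
        then have "lcos z W = lcos (inv g \<otimes> z \<otimes> inv (inv g)) W"
          using C z f_lcos[of "inv g" z] Pc by simp
        then show ?thesis using lcos_eq_iff[OF W(1) zc, of "inv g \<otimes> z \<otimes> inv (inv g)"] zc Pc(1)[OF g] by simp
      qed
      have "inv z \<otimes> (inv n \<otimes> z \<otimes> n) \<in> W" if n: "n \<in> N" for n
      proof -
        obtain w g where w: "w \<in> W" "g \<in> P" "n = w \<otimes> g" using n P(4) set_mult_mem by metis
        note wc = Wm(1)[OF w(1)] Pc[OF w(2)]
        let ?v = "inv z \<otimes> inv w \<otimes> z"
        have "?v \<otimes> w \<in> W" using Wc[OF _ Wm(2)[OF w(1)], of z] w z N(3) Wm(3) by blast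
        then have "inv g \<otimes> (?v \<otimes> w) \<otimes> g \<in> W" using Wc wc by blast
        then have "(inv z \<otimes> (inv g \<otimes> z \<otimes> g)) \<otimes> (inv g \<otimes> (?v \<otimes> w) \<otimes> g) \<in> W"
          using zP[OF w(2)] Wm(3) by blast
        moreover have "(inv z \<otimes> (inv g \<otimes> z \<otimes> g)) \<otimes> (inv g \<otimes> (?v \<otimes> w) \<otimes> g) = inv z \<otimes> (inv n \<otimes> z \<otimes> n)"
          unfolding w(3) using wc(1,2) zc by (simp add: inv_mult_group m_assoc)
        ultimately show ?thesis by simp
      qed
      then have "z \<in> W" using z ZW unfolding Z_def by blast
      then have "C = W" using z(2) lcos_eq_iff[OF W(1) one_closed, of z] lcos_one[OF sub_carrier[OF W(1)]] zc by simp
      then show "C \<in> {W}" by simp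
    qed
    moreover have "W \<in> {C \<in> X. \<forall>g\<in>P. f g C = C}"
    proof -
      have "W = lcos \<one> W" using lcos_one[OF sub_carrier[OF W(1)]] by simp
      then have "W \<in> X" unfolding X_def using one_in[OF N(1)] by blast
      moreover have "f g W = W" if "g \<in> P" for g
        unfolding f_def using W(5) Hm(2) Pc(3) that by blast
      ultimately show ?thesis by blast
    qed
    ultimately have "{C \<in> X. \<forall>g\<in>P. f g C = C} = {W}" by blast
    then show False using pF assms(5) by simp
  qed
  then show ?thesis using nZ WZ abZ unfolding Z_def by blast
qed

end

section \<open>Hall subgroups and normal series\<close>

context finite_group
begin

text \<open>If N/W is itself a \<rho>-group, a Hall \<rho>-subgroup over N is one over W, and a
  \<rho>-subgroup L over W is carried along inside NL.\<close>

lemma hall_step_pi: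
  assumes "nml W H" "nml N H" "W \<subseteq> N" "pi_number \<rho> (idx N W)" "hall_dominates \<rho> N H"
  shows "hall_dominates \<rho> W H"
proof -
  note W = nmlD[OF assms(1)] and N = nmlD[OF assms(2)]
  obtain T where T: "hall \<rho> N H T"
    and dom: "\<And>L. sub L \<Longrightarrow> N \<subseteq> L \<Longrightarrow> L \<subseteq> H \<Longrightarrow> pi_number \<rho> (idx L N) \<Longrightarrow> \<exists>h\<in>H. cj h L \<subseteq> T"
    using assms(5) unfolding hall_dominates_def by blast
  note T = hallD[OF T]
  have WT: "W \<subseteq> T" using assms(3) T(2) by blast
  have "pi_number \<rho> (idx T W)"
    using idx_trans[OF T(1) N(1) W(1) assms(3) T(2)] T(4) assms(4) by (simp add: pi_number_mult_iff)
  then have "hall \<rho> W H T" using T WT by (simp add: hall_def)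
  moreover have "\<exists>h\<in>H. cj h L \<subseteq> T" if L: "sub L" "W \<subseteq> L" "L \<subseteq> H" "pi_number \<rho> (idx L W)" for L
  proof -
    have nLN: "normalizes L N" using normalizes_mono[OF N(4) L(3)] .
    have s: "sub (N <#> L)" using sub_set_mult[OF N(1) L(1) nLN] .
    have "idx (N <#> L) N dvd idx L W"
      unfolding idx_set_mult[OF N(1) L(1)]
      using assms(3) L(2) by (intro idx_dvd_l[OF L(1) sub_Int[OF N(1) L(1)] W(1)]) blast+
    then have "pi_number \<rho> (idx (N <#> L) N)" using pi_number_dvd L(4) by blast
    then obtain h where h: "h \<in> H" "cj h (N <#> L) \<subseteq> T"
      using dom[OF s set_mult_upper(1)[OF N(1) L(1)] set_mult_least[OF W(2) N(3) L(3)]] by blast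
    then have "cj h L \<subseteq> T" using cj_mono[OF set_mult_upper(2)[OF N(1) L(1)], of h] by blast
    then show ?thesis using h by blast
  qed
  ultimately show ?thesis unfolding hall_dominates_def by blast
qed

text \<open>A Hall subgroup S over Z is an extension of the abelian \<rho>'-group Z/W by a
  \<rho>-group; a complement T of Z/W in S/W is the Hall subgroup over W. A \<rho>-subgroup over W
  first goes into S and then, by conjugacy of complements, into T.\<close>

lemma hall_step_abelian:
  assumes "nml W H" "nml Z H" "W \<subseteq> Z" "pi_number (- \<rho>) (idx Z W)"
    and ab: "\<And>a b. a \<in> Z \<Longrightarrow> b \<in> Z \<Longrightarrow> inv a \<otimes> inv b \<otimes> a \<otimes> b \<in> W"
    and "hall_dominates \<rho> Z H"
  shows "hall_dominates \<rho> W H"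
proof -
  note W = nmlD[OF assms(1)] and Z = nmlD[OF assms(2)]
  obtain S where S: "hall \<rho> Z H S"
    and dom: "\<And>L. sub L \<Longrightarrow> Z \<subseteq> L \<Longrightarrow> L \<subseteq> H \<Longrightarrow> pi_number \<rho> (idx L Z) \<Longrightarrow> \<exists>h\<in>H. cj h L \<subseteq> S"
    using assms(6) unfolding hall_dominates_def by blast
  note S = hallD[OF S]
  have nW: "nml W K" and nZ: "nml Z K" if "sub K" "Z \<subseteq> K" "K \<subseteq> H" for K
    using nml_restrict[OF assms(1) that(1) _ that(3)] nml_restrict[OF assms(2) that] assms(3) that(2) by blast+
  have cop: "coprime n (idx Z W)" if "pi_number \<rho> n" for n
    using pi_number_coprime[OF that assms(4)] by blast
  obtain T where T: "sub T" "W \<subseteq> T" "T \<subseteq> S" "T \<inter> Z = W" "idx T W = idx S Z"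
    using relative_complements(1)[OF nW[OF S(1-3)] nZ[OF S(1-3)] assms(3) cop[OF S(4)] ab] by blast
  have "idx S T * idx T W = idx S Z * idx Z W"
    using idx_trans[OF S(1) T(1) W(1) T(2,3)] idx_trans[OF S(1) Z(1) W(1) assms(3) S(2)] by simp
  then have "idx S T = idx Z W"
    using T(5) idx_pos[OF S(1) Z(1) S(2)] by (simp add: mult.commute)
  then have "pi_number (- \<rho>) (idx H T)"
    using idx_trans[OF W(2) S(1) T(1) T(3) S(3)] S(5) assms(4) by (simp add: pi_number_mult_iff)
  then have hallT: "hall \<rho> W H T" using T S(3,4) by (auto simp: hall_def)
  have ZT: "Z <#> T = S"
  proof -
    have nTZ: "normalizes T Z" using normalizes_mono[OF Z(4)] T(3) S(3) by blast
    have s: "sub (Z <#> T)" using sub_set_mult[OF Z(1) T(1) nTZ] .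
    have le: "Z <#> T \<subseteq> S" using set_mult_least[OF S(1,2) T(3)] .
    have "idx (Z <#> T) Z = idx S Z"
      unfolding idx_set_mult[OF Z(1) T(1)] using T(4,5) by (simp add: Int_commute)
    then have "card (Z <#> T) = card S"
      using idx_card[OF s Z(1) set_mult_upper(1)[OF Z(1) T(1)]] idx_card[OF S(1) Z(1) S(2)] by simp
    then show ?thesis using card_subset_eq[OF sub_fin[OF S(1)] le] by blast
  qed
  have "\<exists>h\<in>H. cj h L \<subseteq> T" if L: "sub L" "W \<subseteq> L" "L \<subseteq> H" "pi_number \<rho> (idx L W)" for L
  proof -
    have nLZ: "normalizes L Z" using normalizes_mono[OF Z(4) L(3)] .
    have s: "sub (Z <#> L)" using sub_set_mult[OF Z(1) L(1) nLZ] .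
    have "idx (Z <#> L) Z dvd idx L W"
      unfolding idx_set_mult[OF Z(1) L(1)]
      using assms(3) L(2) by (intro idx_dvd_l[OF L(1) sub_Int[OF Z(1) L(1)] W(1)]) blast+
    then have "pi_number \<rho> (idx (Z <#> L) Z)" using pi_number_dvd L(4) by blast
    then obtain h where h: "h \<in> H" "cj h (Z <#> L) \<subseteq> S"
      using dom[OF s set_mult_upper(1)[OF Z(1) L(1)] set_mult_least[OF W(2) Z(3) L(3)]] by blast
    have hc: "h \<in> carrier G" using h sub_memD(1)[OF W(2)] by blast
    define M where "M = cj h L"
    have M: "sub M" "W \<subseteq> M" "M \<subseteq> S" "M \<subseteq> H" "idx M W = idx L W"
    proof -
      show "sub M" unfolding M_def using sub_cj[OF hc L(1)] .
      show "W \<subseteq> M" unfolding M_def using cj_mono[OF L(2), of h] W(5)[OF h(1)] by simp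
      show "M \<subseteq> S" unfolding M_def
        using h(2) cj_mono[OF set_mult_upper(2)[OF Z(1) L(1)], of h] by blast
      then show "M \<subseteq> H" using S(3) by blast
      show "idx M W = idx L W" unfolding M_def
        using idx_cj[OF hc sub_carrier[OF L(1)] sub_carrier[OF W(1)]] W(5)[OF h(1)] by simp
    qed
    \<comment> \<open>In K = ZM both M and T \<inter> K are complements of Z modulo W, so an element
      of Z conjugates one to the other.\<close>
    define K where "K = Z <#> M"
    have nMZ: "normalizes M Z" using normalizes_mono[OF Z(4) M(4)] .
    have K: "sub K" "Z \<subseteq> K" "M \<subseteq> K" "K \<subseteq> S" "K \<subseteq> H"
      unfolding K_def using sub_set_mult[OF Z(1) M(1) nMZ] set_mult_upper[OF Z(1) M(1)]
        set_mult_least[OF S(1,2) M(3)] S(3) by auto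
    have iK: "idx K Z = idx M (Z \<inter> M)" unfolding K_def using idx_set_mult[OF Z(1) M(1)] .
    have MZ: "M \<inter> Z = W"
    proof -
      have sMZ: "sub (M \<inter> Z)" using sub_Int[OF M(1) Z(1)] .
      have le: "W \<subseteq> M \<inter> Z" "M \<inter> Z \<subseteq> M" "M \<inter> Z \<subseteq> Z" using M(2) assms(3) by auto
      have "idx (M \<inter> Z) W dvd idx M W" "idx (M \<inter> Z) W dvd idx Z W"
        using idx_dvd_r[OF M(1) sMZ W(1) le(1,2)] idx_dvd_r[OF Z(1) sMZ W(1) le(1,3)] by blast+
      then have "pi_number \<rho> (idx (M \<inter> Z) W)" "pi_number (- \<rho>) (idx (M \<inter> Z) W)"
        using pi_number_dvd assms(4) L(4) M(5) by metis+
      then have "idx (M \<inter> Z) W = 1" using pi_number_disjoint by blast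
      then show ?thesis using idx_1D[OF sMZ W(1) le(1)] by simp
    qed
    have iM: "idx M W = idx K Z" using iK MZ by (simp add: Int_commute)
    have sTK: "sub (T \<inter> K)" using sub_Int[OF T(1) K(1)] .
    have "Z <#> (T \<inter> K) = K"
      using dedekind[OF Z(1) T(1) K(1,2)] ZT K(4) by (simp add: Int_absorb1)
    then have "idx K Z = idx (T \<inter> K) (Z \<inter> (T \<inter> K))" using idx_set_mult[OF Z(1) sTK] by simp
    moreover have TKZ: "(T \<inter> K) \<inter> Z = W" using T(4) K(2) W assms(3) by blast
    ultimately have iT: "idx (T \<inter> K) W = idx K Z" by (simp add: Int_commute)
    have "pi_number \<rho> (idx K Z)" using iM M(5) L(4) by simp
    moreover have "W \<subseteq> T \<inter> K" using T(2) assms(3) K(2) by blast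
    ultimately obtain z where z: "z \<in> Z" "cj z M = T \<inter> K"
      using relative_complements(2)[OF nW[OF K(1,2,5)] nZ[OF K(1,2,5)] assms(3) cop ab
          M(1,2) K(3) MZ iM sTK _ _ TKZ iT] by blast
    have zc: "z \<in> carrier G" "z \<in> H" using z Z(3) sub_memD(1)[OF W(2)] by blast+
    have "cj (h \<otimes> z) L = T \<inter> K"
      using cj_mult[OF hc zc(1) sub_carrier[OF L(1)]] z(2) unfolding M_def by simp
    then show ?thesis using sub_memD(3)[OF W(2) h(1) zc(2)] by blast
  qed
  then show ?thesis unfolding hall_dominates_def using hallT by blast
qed

text \<open>Reduces a p-factor to abelian layers: the relative centre of N/W is split off at the
  bottom until W reaches N.\<close>

lemma hall_step_p:
  assumes "nml N H" "prime p" "p \<notin> \<rho>" "hall_dominates \<rho> N H"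
  shows "nml W H \<Longrightarrow> W \<subseteq> N \<Longrightarrow> pi_number {p} (idx N W) \<Longrightarrow> hall_dominates \<rho> W H"
proof (induction "idx N W" arbitrary: W rule: less_induct)
  case less
  note W = nmlD[OF less(2)] and N = nmlD[OF assms(1)]
  show ?case
  proof (cases "W = N")
    case True
    then show ?thesis using assms by simp
  next
    case False
    obtain Z where Z: "nml Z H" "W \<subseteq> Z" "Z \<subseteq> N" "Z \<noteq> W" "\<And>a b. a \<in> Z \<Longrightarrow> b \<in> Z \<Longrightarrow> inv a \<otimes> inv b \<otimes> a \<otimes> b \<in> W"
      using relative_centre[OF less(2) assms(1) less(3) False assms(2) less(4)] by blast
    note Z' = nmlD[OF Z(1)]
    have e: "idx N W = idx N Z * idx Z W" using idx_trans[OF N(1) Z'(1) W(1) Z(2,3)] .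
    then have "pi_number {p} (idx N Z)" "pi_number {p} (idx Z W)"
      using less(4) by (simp_all add: pi_number_mult_iff)
    moreover have "idx Z W \<noteq> 1" using idx_1D[OF Z'(1) W(1) Z(2)] Z(4) by blast
    then have "idx N Z < idx N W"
      unfolding e using idx_pos[OF N(1) Z'(1) Z(3)] idx_pos[OF Z'(1) W(1) Z(2)] by simp
    ultimately have "hall_dominates \<rho> Z H" "pi_number (- \<rho>) (idx Z W)"
      using less(1)[OF _ Z(1,3)] assms(3) by (auto elim: pi_number_mono)
    then show ?thesis using hall_step_abelian[OF less(2) Z(1,2) _ Z(5)] by blast
  qed
qed

text \<open>One step downwards, from N to W. Its reflexive transitive closure describes descending
  series with all terms normal in the fixed group X; trivial steps are allowed.\<close>

definition chain_step :: "nat set set \<Rightarrow> 'a set \<Rightarrow> 'a set \<Rightarrow> 'a set \<Rightarrow> bool"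
  where "chain_step \<A> X N W \<longleftrightarrow> nml W X \<and> nml N X \<and> W \<subseteq> N \<and> (\<exists>\<rho>\<in>\<A>. pi_number \<rho> (idx N W))"

lemma chain_step_set_mult:
  assumes "chain_step \<A> X N W" "nml M X"
  shows "chain_step \<A> X (N <#> M) (W <#> M)"
proof -
  have s: "nml W X" "nml N X" "W \<subseteq> N" using assms unfolding chain_step_def by auto
  have "idx (N <#> M) (W <#> M) dvd idx N W" using idx_set_mult_dvd[OF s(1,2) assms(2) s(3)] .
  then show ?thesis
    using nml_set_mult[OF s(1) assms(2)] nml_set_mult[OF s(2) assms(2)] mono_set_mult[OF s(3), of M M]
      assms(1) pi_number_dvd unfolding chain_step_def by blast
qed

lemma chain_step_Int:
  assumes "chain_step \<A> X N W" "nml M X"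
  shows "chain_step \<A> X (N \<inter> M) (W \<inter> M)"
proof -
  have s: "nml W X" "nml N X" "W \<subseteq> N" using assms unfolding chain_step_def by auto
  have "nml W N" using nml_restrict[OF s(1) nmlD(1)[OF s(2)] s(3) nmlD(3)[OF s(2)]] .
  then have "idx (N \<inter> M) ((N \<inter> M) \<inter> W) dvd idx N W"
    using idx_Int_dvd sub_Int[OF nmlD(1)[OF s(2)] nmlD(1)[OF assms(2)]] by blast
  moreover have "(N \<inter> M) \<inter> W = W \<inter> M" using s(3) by blast
  ultimately have "idx (N \<inter> M) (W \<inter> M) dvd idx N W" by simp
  then show ?thesis
    using nml_Int[OF s(1) assms(2)] nml_Int[OF s(2) assms(2)] s(3)
      assms(1) pi_number_dvd unfolding chain_step_def by blast
qed

lemma chain_set_mult: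
  "(chain_step \<A> X)\<^sup>*\<^sup>* N W \<Longrightarrow> nml M X \<Longrightarrow> (chain_step \<A> X)\<^sup>*\<^sup>* (N <#> M) (W <#> M)"
  by (induction rule: rtranclp_induct) (auto intro: rtranclp.rtrancl_into_rtrancl chain_step_set_mult)

lemma chain_Int:
  "(chain_step \<A> X)\<^sup>*\<^sup>* N W \<Longrightarrow> nml M X \<Longrightarrow> (chain_step \<A> X)\<^sup>*\<^sup>* (N \<inter> M) (W \<inter> M)"
  by (induction rule: rtranclp_induct) (auto intro: rtranclp.rtrancl_into_rtrancl chain_step_Int)

text \<open>Intersecting the series with D starts it at D; multiplying by U afterwards makes it end
  at U.\<close>

lemma chain_between:
  assumes "(chain_step \<A> X)\<^sup>*\<^sup>* X {\<one>}" "nml U X" "nml D X" "U \<subseteq> D"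
  shows "(chain_step \<A> X)\<^sup>*\<^sup>* D U"
proof -
  have "{\<one>} \<inter> D = {\<one>}" "X \<inter> D = D" using nmlD[OF assms(3)] one_in by auto
  then have "(chain_step \<A> X)\<^sup>*\<^sup>* D {\<one>}" using chain_Int[OF assms(1,3)] by simp
  then have "(chain_step \<A> X)\<^sup>*\<^sup>* (D <#> U) ({\<one>} <#> U)" using chain_set_mult assms(2) by blast
  moreover have "D <#> U = D" using set_mult_absorb nmlD(1) assms by blast
  moreover have "{\<one>} <#> U = U"
    using set_mult_absorb2[OF triv_subgroup nmlD(1)[OF assms(2)]] one_in[OF nmlD(1)[OF assms(2)]] by simp
  ultimately show ?thesis by simp
qed

text \<open>Each term need only be normal in the next one, which is what a composition series
  delivers and what subgroups inherit. \<open>solvable_series_chain\<close> upgrades this to terms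
  normal in a larger group.\<close>

inductive solvable_series :: "nat set set \<Rightarrow> 'a set \<Rightarrow> bool" for \<A>
  where
    trivial: "solvable_series \<A> {\<one>}"
  | extend: "\<lbrakk>solvable_series \<A> N; nml N H; \<rho> \<in> \<A>; pi_number \<rho> (idx H N)\<rbrakk> \<Longrightarrow> solvable_series \<A> H"

lemma solvable_series_subgroup:
  "solvable_series \<A> H \<Longrightarrow> sub L \<Longrightarrow> L \<subseteq> H \<Longrightarrow> solvable_series \<A> L"
proof (induction arbitrary: L rule: solvable_series.induct)
  case trivial
  then have "L = {\<one>}" using one_in by blast
  then show ?case using solvable_series.trivial by simp
next
  case (extend N H \<rho>)
  have "nml (N \<inter> L) L" using nml_Int_sub extend by blast
  moreover have "solvable_series \<A> (N \<inter> L)"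
    using extend sub_Int nmlD(1) by blast
  moreover have "pi_number \<rho> (idx L (N \<inter> L))"
    using idx_Int_dvd[OF extend(2,6,7)] extend(4) pi_number_dvd by (metis Int_commute)
  ultimately show ?case using solvable_series.extend extend(3) by blast
qed

lemma solvable_series_top:
  "solvable_series \<A> H \<Longrightarrow> H \<noteq> {\<one>} \<Longrightarrow>
    \<exists>N \<rho>. nml N H \<and> N \<noteq> H \<and> \<rho> \<in> \<A> \<and> pi_number \<rho> (idx H N)"
proof (induction rule: solvable_series.induct)
  case (extend N H \<rho>)
  then show ?case by (cases "N = H") auto
qed auto

text \<open>This is O^\<rho>(H), generated by the \<rho>'-elements. In this form it is visibly
  characteristic, and it is the same for any two subgroups with the same \<rho>'-elements;
  \<open>pi_residual_eq\<close> identifies it with the least-subgroup definition.\<close>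

definition residual :: "nat set \<Rightarrow> 'a set \<Rightarrow> 'a set"
  where "residual \<rho> H = generate G {x \<in> H. pi_number (- \<rho>) (ord x)}"

lemma residual_sub:
  assumes "sub H"
  shows "sub (residual \<rho> H)" "residual \<rho> H \<subseteq> H"
proof -
  have s: "{x \<in> H. pi_number (- \<rho>) (ord x)} \<subseteq> H" by blast
  show "sub (residual \<rho> H)" unfolding residual_def
    using generate_is_subgroup[of "{x \<in> H. pi_number (- \<rho>) (ord x)}"] s sub_carrier[OF assms] by blast
  show "residual \<rho> H \<subseteq> H" unfolding residual_def
    using generate_subgroup_incl[OF s assms] .
qed

lemma ord_conj:
  assumes "x \<in> carrier G" "a \<in> carrier G"
  shows "ord (inv x \<otimes> a \<otimes> x) = ord a"
proof -
  have pw: "(inv x \<otimes> a \<otimes> x) [^] n = inv x \<otimes> a [^] n \<otimes> x" for n :: nat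
    using assms by (induction n) (simp_all add: m_assoc)
  have "ord (inv x \<otimes> a \<otimes> x) dvd n \<longleftrightarrow> ord a dvd n" for n
  proof -
    have "inv x \<otimes> a [^] n \<otimes> x = \<one> \<longleftrightarrow> a [^] n = \<one>"
    proof
      assume "inv x \<otimes> a [^] n \<otimes> x = \<one>"
      then have "x \<otimes> (inv x \<otimes> a [^] n \<otimes> x) \<otimes> inv x = \<one>" using assms by simp
      then show "a [^] n = \<one>" using assms by (simp add: m_assoc)
    qed (use assms in simp)
    then show ?thesis using pow_eq_id pw assms by (metis inv_closed m_closed)
  qed
  then show ?thesis by (metis dvd_antisym dvd_refl)
qed

lemma residual_cj:
  assumes "sub H" "x \<in> carrier G" "cj x H = H"
  shows "cj x (residual \<rho> H) = residual \<rho> H"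
proof -
  let ?S = "{x \<in> H. pi_number (- \<rho>) (ord x)}"
  note R = residual_sub[OF assms(1), of \<rho>]
  have S: "?S \<subseteq> residual \<rho> H" unfolding residual_def by (rule subsetI, rule generate.incl)
  have "?S \<subseteq> cj x (residual \<rho> H)"
  proof
    fix h assume h: "h \<in> ?S"
    then obtain k where k: "k \<in> H" "h = inv x \<otimes> k \<otimes> x" using assms(3) unfolding cj_def by blast
    then have "k \<in> ?S" using h ord_conj[OF assms(2)] sub_memD(1)[OF assms(1)] by simp
    then show "h \<in> cj x (residual \<rho> H)" unfolding cj_def k(2) using S by blast
  qed
  from generate_subgroup_incl[OF this sub_cj[OF assms(2) R(1)]]
  have "residual \<rho> H \<subseteq> cj x (residual \<rho> H)"
    by (simp only: residual_def[of \<rho> H, symmetric])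
  then have "residual \<rho> H = cj x (residual \<rho> H)"
    using card_subset_eq[OF sub_fin[OF sub_cj[OF assms(2) R(1)]]] card_cj[OF assms(2) sub_carrier[OF R(1)]] by simp
  then show ?thesis by simp
qed

lemma residual_nml:
  assumes "nml H X"
  shows "nml (residual \<rho> H) X"
proof -
  note H = nmlD[OF assms]
  have "normalizes X (residual \<rho> H)"
    unfolding normalizes_def using residual_cj[OF H(1) sub_memD(1)[OF H(2)] H(5)] by blast
  then show ?thesis
    using residual_sub[OF H(1), of \<rho>] H(2,3) by (intro nmlI) simp_all
qed

lemma ord_dvd_card:
  assumes "sub H" "x \<in> H"
  shows "ord x dvd card H"
proof -
  have "generate G {x} \<subseteq> H" using generate_subgroup_incl[OF _ assms(1)] assms(2) by blast
  moreover have "x \<in> carrier G" using sub_memD(1)[OF assms] .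
  then have "sub (generate G {x})" "ord x = card (generate G {x})"
    using generate_is_subgroup[of "{x}"] generate_pow_card by auto
  ultimately show ?thesis using lagrange_dvd[OF assms(1)] by metis
qed

text \<open>For a prime p outside \<rho>, a Sylow p-subgroup consists of \<rho>'-elements, so it
  lies in the residual and p cannot divide the index.\<close>

lemma residual_index:
  assumes "sub H"
  shows "pi_number \<rho> (idx H (residual \<rho> H))"
proof -
  note R = residual_sub[OF assms, of \<rho>]
  have "p \<in> \<rho>" if p: "prime p" "p dvd idx H (residual \<rho> H)" for p
  proof (rule ccontr)
    assume n: "p \<notin> \<rho>"
    obtain P where P: "sub P" "P \<subseteq> H" "card P = p ^ multiplicity p (card H)" "\<not> p dvd idx H P"
      using sylow_exists[OF assms p(1)] by blast
    have "pi_number {p} (ord x)" if "x \<in> P" for x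
      using ord_dvd_card[OF P(1) that] P(3) pi_number_prime_powerI[OF p(1)] pi_number_dvd by metis
    then have "pi_number (- \<rho>) (ord x)" if "x \<in> P" for x
      using pi_number_mono[of "{p}" "ord x" "- \<rho>"] that n by blast
    then have "P \<subseteq> residual \<rho> H"
      unfolding residual_def by (intro subsetI generate.incl) (use P(2) in auto)
    then have "idx H (residual \<rho> H) dvd idx H P" using idx_dvd_l[OF assms R(1) P(1) _ R(2)] by blast
    then show False using p(2) P(4) dvd_trans by blast
  qed
  then show ?thesis using idx_pos[OF assms R] unfolding pi_number_def by blast
qed

text \<open>The index of \<langle>x\<rangle> \<inter> N in \<langle>x\<rangle> is both a
  \<rho>-number and a \<rho>'-number.\<close>

lemma pi_element_in_normal:
  assumes "nml N H" "pi_number \<rho> (idx H N)" "x \<in> H" "pi_number (- \<rho>) (ord x)"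
  shows "x \<in> N"
proof -
  note N = nmlD[OF assms(1)]
  let ?C = "generate G {x}"
  have x: "x \<in> carrier G" using sub_memD(1)[OF N(2) assms(3)] .
  have C: "sub ?C" "card ?C = ord x" "?C \<subseteq> H"
    using generate_is_subgroup[of "{x}"] generate_pow_card[OF x] x generate_subgroup_incl[OF _ N(2), of "{x}"] assms(3) by auto
  have CN: "sub (?C \<inter> N)" using sub_Int[OF C(1) N(1)] .
  have "idx ?C (?C \<inter> N) dvd card ?C" using idx_card[OF C(1) CN] by (metis Int_lower1 dvd_triv_left)
  then have "pi_number (- \<rho>) (idx ?C (?C \<inter> N))" using C(2) assms(4) pi_number_dvd by metis
  moreover have "pi_number \<rho> (idx ?C (?C \<inter> N))"
    using idx_Int_dvd[OF assms(1) C(1,3)] assms(2) pi_number_dvd by blast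
  ultimately have "idx ?C (?C \<inter> N) = 1" using pi_number_disjoint by blast
  then have "?C \<inter> N = ?C" by (rule idx_1D[OF C(1) CN Int_lower1])
  moreover have "x \<in> ?C" by (rule generate.incl) simp
  ultimately show ?thesis by blast
qed

lemma residual_least:
  assumes "nml N H" "pi_number \<rho> (idx H N)"
  shows "residual \<rho> H \<subseteq> N"
  unfolding residual_def
  by (rule generate_subgroup_incl[OF _ nmlD(1)[OF assms(1)]]) (use pi_element_in_normal[OF assms] in blast)

text \<open>A normal subgroup of H with \<rho>-quotient need not be normal in X, but O^\<rho>(H)
  lies inside it, is still proper, and is characteristic in H; it serves as the next term.\<close>

lemma solvable_series_chain:
  "solvable_series \<A> H \<Longrightarrow> nml H X \<Longrightarrow> (chain_step \<A> X)\<^sup>*\<^sup>* H {\<one>}"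
proof (induction "card H" arbitrary: H rule: less_induct)
  case less
  note H = nmlD[OF less(3)]
  show ?case
  proof (cases "H = {\<one>}")
    case False
    then obtain N \<rho> where N: "nml N H" "N \<noteq> H" "\<rho> \<in> \<A>" "pi_number \<rho> (idx H N)"
      using solvable_series_top[OF less(2)] by blast
    let ?R = "residual \<rho> H"
    note R = residual_sub[OF H(1), of \<rho>]
    have "?R \<subset> H" using residual_least[OF N(1,4)] nmlD(3)[OF N(1)] N(2) by blast
    then have "card ?R < card H" using sub_fin[OF H(1)] by (rule psubset_card_mono[rotated])
    moreover have "solvable_series \<A> ?R" using solvable_series_subgroup[OF less(2) R] .
    moreover have nR: "nml ?R X" using residual_nml[OF less(3)] .
    ultimately have "(chain_step \<A> X)\<^sup>*\<^sup>* ?R {\<one>}" using less(1) by blast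
    moreover have "chain_step \<A> X H ?R"
      unfolding chain_step_def using nR less(3) R(2) N(3) residual_index[OF H(1)] by blast
    ultimately show ?thesis by (rule converse_rtranclp_into_rtranclp[rotated])
  qed simp
qed

text \<open>The solubility hypothesis speaks about the factors of composition series, so it yields
  information only once such a series is at hand. A proper normal subgroup of largest order has a
  simple quotient.\<close>

lemma composition_series_exists:
  "sub H \<Longrightarrow> \<exists>Hs. Hs \<noteq> [] \<and> hd Hs = {\<one>} \<and> last Hs = H \<and>
    (\<forall>i. Suc i < length Hs \<longrightarrow> nml (Hs ! i) (Hs ! Suc i) \<and> simple_group (G\<lparr>carrier := Hs ! Suc i\<rparr> Mod Hs ! i))"
proof (induction "card H" arbitrary: H rule: less_induct)
  case less
  note H = less(2)
  show ?case
  proof (cases "H = {\<one>}")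
    case True
    then show ?thesis by (intro exI[of _ "[{\<one>}]"]) simp
  next
    case False
    let ?P = "\<lambda>N. nml N H \<and> N \<noteq> H"
    have P1: "?P {\<one>}" using nml_one[OF H] False by auto
    have "\<forall>N. ?P N \<longrightarrow> card N < Suc (card H)"
      using nmlD(3) sub_fin[OF H] card_mono by (metis less_Suc_eq_le)
    then obtain N where N: "nml N H" "N \<noteq> H" and max: "\<And>M. ?P M \<Longrightarrow> card M \<le> card N"
      using ex_has_greatest_nat[of ?P "{\<one>}" card "Suc (card H)"] P1 by blast
    note N' = nmlD[OF N(1)]
    let ?Q = "G\<lparr>carrier := H\<rparr> Mod N"
    note qc = quotient_correspondence[OF N(1)]
    interpret Q: finite_group ?Q by (rule qc(1))
    have cQ: "card (carrier ?Q) = idx H N" using qc(2)[OF H N'(3)] qc(7) by simp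
    have simple: "simple_group ?Q"
    proof (unfold_locales)
      have "idx H N \<noteq> 1" using idx_1D[OF H N'(1,3)] N(2) by blast
      then show "1 < order ?Q" unfolding order_def cQ using idx_pos[OF H N'(1,3)] by simp
      fix C assume C: "C \<lhd> ?Q"
      then have sC: "subgroup C ?Q" by (rule normal_imp_subgroup)
      obtain L where L: "sub L" "N \<subseteq> L" "L \<subseteq> H" "(\<lambda>x. N #> x) ` L = C" using qc(3)[OF sC] by blast
      have "nml L H"
      proof (intro nmlI normalizesI L(1,3) H sub_carrier)
        fix l x assume lx: "l \<in> L" "x \<in> H"
        have m1: "l \<in> H" "inv x \<in> H" using lx L(3) sub_memD(2)[OF H] by blast+
        have m2: "inv x \<otimes> l \<in> H" using sub_memD(3)[OF H] m1 by blast
        have m: "l \<in> H" "inv x \<in> H" "inv x \<otimes> l \<in> H" "inv x \<otimes> l \<otimes> x \<in> H"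
          using m1 m2 sub_memD(3)[OF H m2 lx(2)] by simp_all
        have "N #> (inv x \<otimes> l \<otimes> x) = inv\<^bsub>?Q\<^esub> (N #> x) \<otimes>\<^bsub>?Q\<^esub> (N #> l) \<otimes>\<^bsub>?Q\<^esub> (N #> x)"
          using m lx qc(5,6) by simp
        also have "\<dots> \<in> C"
        proof (rule normal.inv_op_closed1[OF C])
          show "N #> x \<in> carrier ?Q" unfolding qc(7)[symmetric] using lx(2) by (rule imageI)
          show "N #> l \<in> C" unfolding L(4)[symmetric] using lx(1) by (rule imageI)
        qed
        finally have "N #> (inv x \<otimes> l \<otimes> x) \<in> (\<lambda>x. N #> x) ` L" unfolding L(4) .
        then show "inv x \<otimes> l \<otimes> x \<in> L" using qc(4)[OF L(1-3) m(4)] by blast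
      qed
      then have "L = H \<or> L = N"
        using max[of L] L(2) card_seteq[OF sub_fin[OF L(1)] L(2)] by blast
      then show "C = carrier ?Q \<or> C = {\<one>\<^bsub>?Q\<^esub>}"
      proof
        assume "L = H"
        then show ?thesis using L(4) qc(7) by simp
      next
        assume LN: "L = N"
        have "N #> x = N" if "x \<in> N" for x
          using coset_join2[OF sub_memD(1)[OF N'(1) that] N'(1) that] .
        then have "(\<lambda>x. N #> x) ` N = {N}" using one_in[OF N'(1)] by blast
        then show ?thesis using L(4) LN qc(8) by simp
      qed
    qed
    have "card N < card H"
      using N(2) N'(3) sub_fin[OF H] by (intro psubset_card_mono) auto
    then obtain Hs where Hs: "Hs \<noteq> []" "hd Hs = {\<one>}" "last Hs = N"
      "\<And>i. Suc i < length Hs \<Longrightarrow> nml (Hs ! i) (Hs ! Suc i) \<and> simple_group (G\<lparr>carrier := Hs ! Suc i\<rparr> Mod Hs ! i)"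
      using less(1)[OF _ N'(1)] by blast
    have "nml ((Hs @ [H]) ! i) ((Hs @ [H]) ! Suc i) \<and>
        simple_group (G\<lparr>carrier := (Hs @ [H]) ! Suc i\<rparr> Mod (Hs @ [H]) ! i)" if "Suc i < length (Hs @ [H])" for i
    proof (cases "Suc i < length Hs")
      case True
      then show ?thesis using Hs(4)[OF True] by (simp add: nth_append)
    next
      case False
      then have i: "Suc i = length Hs" using that by simp
      then have "Hs ! i = N" using Hs(1,3) by (metis last_conv_nth diff_Suc_1)
      then show ?thesis using i N(1) simple by (simp add: nth_append)
    qed
    then show ?thesis using Hs(1,2) by (intro exI[of _ "Hs @ [H]"]) simp
  qed
qed

end

definition atoms :: "nat set \<Rightarrow> nat set set"
  where "atoms \<pi> = insert \<pi> {{p} |p. prime p \<and> p \<notin> \<pi>}"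

lemma atoms_disjoint: "\<rho> \<in> atoms \<pi> \<Longrightarrow> \<sigma> \<in> atoms \<pi> \<Longrightarrow> \<rho> \<noteq> \<sigma> \<Longrightarrow> \<rho> \<inter> \<sigma> = {}"
  unfolding atoms_def by auto

section \<open>From composition factors to atomic series and Hall subgroups\<close>

context finite_group
begin

lemma pi_soluble_series:
  assumes "pi_soluble (compl_primes \<pi>) G" "\<forall>p\<in>\<pi>. prime p"
  shows "solvable_series (atoms \<pi>) (carrier G)"
proof -
  obtain Hs where Hs: "Hs \<noteq> []" "hd Hs = {\<one>}" "last Hs = carrier G"
    "\<And>i. Suc i < length Hs \<Longrightarrow> nml (Hs ! i) (Hs ! Suc i) \<and> simple_group (G\<lparr>carrier := Hs ! Suc i\<rparr> Mod Hs ! i)"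
    using composition_series_exists[OF sub_carrier_self] by blast
  have cs: "composition_series G Hs"
    unfolding composition_series_def
  proof (intro conjI allI impI Hs(1-3))
    fix i assume i: "Suc i < length Hs"
    note n = Hs(4)[OF i, THEN conjunct1]
    show "sub (Hs ! i)" using nmlD(1)[OF n] .
    show "Hs ! i \<lhd> G\<lparr>carrier := Hs ! Suc i\<rparr>" using normal_iff_nml[OF nmlD(2)[OF n]] n by blast
    show "simple_group (G\<lparr>carrier := Hs ! Suc i\<rparr> Mod Hs ! i)" using Hs(4)[OF i] by blast
  qed
  have step: "\<exists>\<rho>\<in>atoms \<pi>. pi_number \<rho> (idx (Hs ! Suc i) (Hs ! i))" if i: "Suc i < length Hs" for i
  proof -
    note n = Hs(4)[OF i, THEN conjunct1]
    let ?F = "G\<lparr>carrier := Hs ! Suc i\<rparr> Mod Hs ! i"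
    have "card (carrier ?F) = idx (Hs ! Suc i) (Hs ! i)"
      using quotient_correspondence(2)[OF n nmlD(2)[OF n] nmlD(3)[OF n]] quotient_correspondence(7)[OF n] by simp
    then have oF: "order ?F = idx (Hs ! Suc i) (Hs ! i)" by (simp add: order_def)
    have pos: "idx (Hs ! Suc i) (Hs ! i) > 0" using idx_pos nmlD[OF n] by blast
    have pg: "pi_group \<rho> ?F \<Longrightarrow> pi_number \<rho> (idx (Hs ! Suc i) (Hs ! i))" for \<rho>
      using oF pos unfolding pi_group_def pi_number_def by simp
    have "composition_factor G ?F" unfolding composition_factor_def using cs i by blast
    then consider "pi_group (compl_primes (compl_primes \<pi>)) ?F"
      | p where "p \<in> compl_primes \<pi>" "pi_group {p} ?F"
      using assms(1) unfolding pi_soluble_def pi_separable_def by blast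
    then show ?thesis
    proof cases
      case 1
      \<comment> \<open>The double complement of \<pi> within the primes is contained in
        \<pi>.\<close>
      then have "pi_number \<pi> (idx (Hs ! Suc i) (Hs ! i))"
        using pg pi_number_mono[of "compl_primes (compl_primes \<pi>)" _ \<pi>]
        unfolding compl_primes_def by blast
      then show ?thesis unfolding atoms_def by blast
    next
      case (2 p)
      then show ?thesis using pg unfolding atoms_def compl_primes_def by blast
    qed
  qed
  have "solvable_series (atoms \<pi>) (Hs ! i)" if "i < length Hs" for i
    using that
  proof (induction i)
    case 0
    then have "Hs ! 0 = {\<one>}" using Hs(1,2) by (metis hd_conv_nth)
    then show ?case using solvable_series.trivial by simp
  next
    case (Suc i)
    then show ?case using step[OF Suc(2)] Hs(4)[OF Suc(2)] solvable_series.extend by (metis Suc_lessD)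
  qed
  from this[of "length Hs - 1"] show ?thesis using Hs(1,3) by (simp add: last_conv_nth)
qed

text \<open>Singletons are settled by Sylow's theorem. For \<pi>, descend along a chain from H,
  where H is its own Hall subgroup, to W: a \<pi>-factor and a p-factor with p outside \<pi> are the
  two possible steps.\<close>

lemma solvable_hall_dominates:
  assumes "solvable_series (atoms \<pi>) (carrier G)" "nml W H" "\<rho> \<in> atoms \<pi>"
  shows "hall_dominates \<rho> W H"
proof -
  note W = nmlD[OF assms(2)]
  consider p where "\<rho> = {p}" "prime p" | "\<rho> = \<pi>" using assms(3) unfolding atoms_def by blast
  then show ?thesis
  proof cases
    case 1
    then show ?thesis using sylow_dominates[OF assms(2)] by simp
  next
    case 2
    have "solvable_series (atoms \<pi>) H"
      using solvable_series_subgroup[OF assms(1) W(2) sub_carrier[OF W(2)]] .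
    then have "(chain_step (atoms \<pi>) H)\<^sup>*\<^sup>* H {\<one>}" using solvable_series_chain nml_self[OF W(2)] by blast
    then have "(chain_step (atoms \<pi>) H)\<^sup>*\<^sup>* H W"
      using chain_between[OF _ assms(2) nml_self[OF W(2)] W(3)] by blast
    then show ?thesis
    proof (induction rule: rtranclp_induct)
      case base
      have "hall \<rho> H H H" using W(2) by (simp add: hall_def)
      moreover have "\<exists>h\<in>H. cj h L \<subseteq> H" if "sub L" "L \<subseteq> H" for L
        using that one_in[OF W(2)] cj_one[OF sub_carrier] by (metis)
      ultimately show ?case unfolding hall_dominates_def by blast
    next
      case (step N M)
      obtain \<sigma> where \<sigma>: "\<sigma> \<in> atoms \<pi>" "pi_number \<sigma> (idx N M)" and n: "nml M H" "nml N H" "M \<subseteq> N"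
        using step(2) unfolding chain_step_def by blast
      consider p where "\<sigma> = {p}" "prime p" "p \<notin> \<pi>" | "\<sigma> = \<pi>" using \<sigma>(1) unfolding atoms_def by blast
      then show ?case
      proof cases
        case 1
        then show ?thesis using hall_step_p[OF n(2) 1(2) _ step(3) n(1,3)] \<sigma>(2) 2 by simp
      next
        case 2
        then show ?thesis using hall_step_pi[OF n _ step(3)] \<sigma>(2) \<open>\<rho> = \<pi>\<close> by simp
      qed
    qed
  qed
qed

end

section \<open>Weakly closed subgroups and commuting conjugates\<close>

context finite_group
begin

definition normalizer_in :: "'a set \<Rightarrow> 'a set \<Rightarrow> 'a set"
  where "normalizer_in H W = {x \<in> H. cj x W = W}"

lemma normalizer_in_sub:
  assumes "sub H" "W \<subseteq> carrier G"
  shows "sub (normalizer_in H W)"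
proof (rule subgroupI)
  note H = sub_memD[OF assms(1)]
  show "normalizer_in H W \<subseteq> carrier G" unfolding normalizer_in_def using H by blast
  show "normalizer_in H W \<noteq> {}"
    unfolding normalizer_in_def using one_in[OF assms(1)] cj_one[OF assms(2)] by blast
  show "inv a \<in> normalizer_in H W" if "a \<in> normalizer_in H W" for a
    using that H cj_eq_swap[of a W W] assms(2) unfolding normalizer_in_def by auto
  show "a \<otimes> b \<in> normalizer_in H W" if "a \<in> normalizer_in H W" "b \<in> normalizer_in H W" for a b
    using that H cj_mult[of a b W] assms(2) unfolding normalizer_in_def by auto
qed

lemma normalizer_in_subset: "normalizer_in H W \<subseteq> H"
  unfolding normalizer_in_def by blast

lemma normalizer_in_nml:
  assumes "sub H" "sub W" "W \<subseteq> H"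
  shows "nml W (normalizer_in H W)"
proof (rule nmlI[OF assms(2) normalizer_in_sub[OF assms(1) sub_carrier[OF assms(2)]]])
  show "W \<subseteq> normalizer_in H W" unfolding normalizer_in_def using cj_self[OF assms(2)] assms(3) by blast
  show "normalizes (normalizer_in H W) W" unfolding normalizer_in_def normalizes_def by blast
qed

lemma normalizes_iff_normalizer_in: "B \<subseteq> H \<Longrightarrow> normalizes B W \<longleftrightarrow> B \<subseteq> normalizer_in H W"
  unfolding normalizes_def normalizer_in_def by blast

text \<open>Only single commutators are constrained; for a subgroup N this says [A, B] \<le>
  N.\<close>

definition commutes_mod :: "'a set \<Rightarrow> 'a set \<Rightarrow> 'a set \<Rightarrow> bool"
  where "commutes_mod N A B \<longleftrightarrow> (\<forall>a\<in>A. \<forall>b\<in>B. inv a \<otimes> inv b \<otimes> a \<otimes> b \<in> N)"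

lemma commutes_mod_sym:
  assumes "sub A" "sub B" "sub N" "commutes_mod N A B"
  shows "commutes_mod N B A"
  unfolding commutes_mod_def
proof (intro ballI)
  fix b a assume ab: "b \<in> B" "a \<in> A"
  then have c: "a \<in> carrier G" "b \<in> carrier G" using sub_memD(1) assms by blast+
  have "inv (inv a \<otimes> inv b \<otimes> a \<otimes> b) \<in> N" using assms(4) ab sub_memD(2)[OF assms(3)] unfolding commutes_mod_def by blast
  then show "inv b \<otimes> inv a \<otimes> b \<otimes> a \<in> N" using c by (simp add: inv_mult_group m_assoc)
qed

text \<open>Weak closure of A with respect to X, relative to U. Quantifying over all
  \<rho>-subgroups T over U, and not only over Hall subgroups, frees the property from the choice of
  a Hall subgroup.\<close>

definition weakly_closed :: "nat set \<Rightarrow> 'a set \<Rightarrow> 'a set \<Rightarrow> 'a set \<Rightarrow> bool"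
  where "weakly_closed \<rho> U X A \<longleftrightarrow> (\<forall>x\<in>X. \<forall>T. sub T \<longrightarrow> U \<subseteq> T \<longrightarrow> T \<subseteq> X \<longrightarrow> pi_number \<rho> (idx T U) \<longrightarrow>
    A \<subseteq> T \<longrightarrow> cj x A \<subseteq> T \<longrightarrow> cj x A = A)"

lemma weakly_closedD:
  "weakly_closed \<rho> U X A \<Longrightarrow> x \<in> X \<Longrightarrow> sub T \<Longrightarrow> U \<subseteq> T \<Longrightarrow> T \<subseteq> X \<Longrightarrow> pi_number \<rho> (idx T U) \<Longrightarrow>
    A \<subseteq> T \<Longrightarrow> cj x A \<subseteq> T \<Longrightarrow> cj x A = A"
  unfolding weakly_closed_def by blast

text \<open>Conjugating T back by the inverse of x reduces the comparison of two conjugates of A to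
  that of A with one of its conjugates.\<close>

lemma weakly_closed_conj2:
  assumes "weakly_closed \<rho> U X A" "nml U X" "A \<subseteq> X" "sub T" "U \<subseteq> T" "T \<subseteq> X" "pi_number \<rho> (idx T U)"
    and "x \<in> X" "y \<in> X" "cj x A \<subseteq> T" "cj y A \<subseteq> T"
  shows "cj x A = cj y A"
proof -
  note U = nmlD[OF assms(2)] and Xm = sub_memD[OF nmlD(2)[OF assms(2)]]
  have c: "x \<in> carrier G" "y \<in> carrier G" "A \<subseteq> carrier G" "T \<subseteq> carrier G"
    using assms Xm(1) sub_carrier[OF assms(4)] by blast+
  let ?T = "cj (inv x) T"
  have T: "sub ?T" "U \<subseteq> ?T" "?T \<subseteq> X" "pi_number \<rho> (idx ?T U)"
  proof -
    show "sub ?T" using sub_cj c assms(4) by blast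
    show "U \<subseteq> ?T" using cj_mono[OF assms(5), of "inv x"] U(5)[OF Xm(2)[OF assms(8)]] by simp
    show "?T \<subseteq> X" using cj_subset_sub[OF U(2) Xm(2)[OF assms(8)] assms(6)] .
    show "pi_number \<rho> (idx ?T U)"
      using idx_cj[of "inv x" T U] c U(5)[OF Xm(2)[OF assms(8)]] sub_carrier[OF U(1)] assms(7) by simp
  qed
  have "A \<subseteq> ?T" using cj_mono[OF assms(10), of "inv x"] c by simp
  moreover have "cj (y \<otimes> inv x) A \<subseteq> ?T" using cj_mono[OF assms(11), of "inv x"] c by (simp add: cj_mult)
  ultimately have "cj (y \<otimes> inv x) A = A"
    using weakly_closedD[OF assms(1) _ T] Xm assms(8,9) by blast
  then have "cj x (cj (y \<otimes> inv x) A) = cj x A" by simp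
  then show ?thesis using c by (simp add: cj_mult m_assoc)
qed

lemma weakly_closed_cj:
  assumes "weakly_closed \<rho> U X A" "nml U X" "A \<subseteq> X" "d \<in> X"
  shows "weakly_closed \<rho> U X (cj d A)"
  unfolding weakly_closed_def
proof (intro ballI allI impI)
  note Xm = sub_memD[OF nmlD(2)[OF assms(2)]]
  fix x T assume x: "x \<in> X" and T: "sub T" "U \<subseteq> T" "T \<subseteq> X" "pi_number \<rho> (idx T U)"
    and le: "cj d A \<subseteq> T" "cj x (cj d A) \<subseteq> T"
  have c: "A \<subseteq> carrier G" "x \<in> carrier G" "d \<in> carrier G" using assms x Xm by blast+
  have e: "cj x (cj d A) = cj (d \<otimes> x) A" using c by (simp add: cj_mult)
  show "cj x (cj d A) = cj d A"
    unfolding e using weakly_closed_conj2[OF assms(1-3) T Xm(3)[OF assms(4) x] assms(4)] le e by simp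
qed

lemma idx_set_mult_dvd_sub:
  assumes "nml A X" "sub P" "P \<subseteq> X" "sub U" "U \<subseteq> P" "U \<subseteq> A"
  shows "idx (A <#> P) A dvd idx P U"
  unfolding idx_set_mult[OF nmlD(1)[OF assms(1)] assms(2)]
  using assms(5,6) by (intro idx_dvd_l[OF assms(2) sub_Int[OF nmlD(1)[OF assms(1)] assms(2)] assms(4)]) blast+

lemma normal_set_mult_sub:
  assumes "nml A X" "sub P" "P \<subseteq> X"
  shows "sub (A <#> P)" "A \<subseteq> A <#> P" "P \<subseteq> A <#> P" "A <#> P \<subseteq> X" "nml A (A <#> P)" "A <#> P = P <#> A"
proof -
  note A = nmlD[OF assms(1)]
  have n: "normalizes P A" using normalizes_mono[OF A(4) assms(3)] .
  show "sub (A <#> P)" using sub_set_mult[OF A(1) assms(2) n] .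
  show "A \<subseteq> A <#> P" "P \<subseteq> A <#> P" using set_mult_upper[OF A(1) assms(2)] .
  show "A <#> P \<subseteq> X" using set_mult_least[OF A(2,3) assms(3)] .
  show "nml A (A <#> P)" using nml_in_set_mult[OF A(1) assms(2) n] .
  show "A <#> P = P <#> A" using set_mult_commute_nml[OF A(1) assms(2) n] .
qed

text \<open>Weak closure survives passage from U to a larger normal A. Inside T a Hall
  \<rho>-subgroup S over U satisfies T = SA and contains conjugates of P and of its x-conjugate
  under T; these coincide by weak closure in S, and modulo A the conjugation by T can be
  undone.\<close>

lemma weakly_closed_mod:
  assumes wc: "weakly_closed \<rho> U X P" and dom: "\<And>W H. nml W H \<Longrightarrow> hall_dominates \<rho> W H"
    and "nml U X" "nml A X" "U \<subseteq> A" "sub P" "U \<subseteq> P" "P \<subseteq> X" "pi_number \<rho> (idx P U)"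
  shows "weakly_closed \<rho> A X (A <#> P)"
  unfolding weakly_closed_def
proof (intro ballI allI impI)
  note U = nmlD[OF assms(3)] and A = nmlD[OF assms(4)] and Xm = sub_memD[OF nmlD(2)[OF assms(4)]]
  note AP = normal_set_mult_sub[OF assms(4,6,8)]
  fix x T assume x: "x \<in> X" and T: "sub T" "A \<subseteq> T" "T \<subseteq> X" "pi_number \<rho> (idx T A)"
    and le: "A <#> P \<subseteq> T" "cj x (A <#> P) \<subseteq> T"
  have xc: "x \<in> carrier G" using Xm(1)[OF x] .
  have Pc: "P \<subseteq> carrier G" using sub_carrier[OF assms(6)] .
  have UT: "U \<subseteq> T" using assms(5) T(2) by blast
  have nUT: "nml U T" using nml_restrict[OF assms(3) T(1) UT T(3)] .
  have PT: "P \<subseteq> T" "cj x P \<subseteq> T" using AP(3) le cj_mono[OF AP(3), of x] by blast+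
  obtain S where S: "hall \<rho> U T S"
    and con: "\<And>L. sub L \<Longrightarrow> U \<subseteq> L \<Longrightarrow> L \<subseteq> T \<Longrightarrow> pi_number \<rho> (idx L U) \<Longrightarrow> \<exists>h\<in>T. cj h L \<subseteq> S"
    using dom[OF nUT] unfolding hall_dominates_def by blast
  note S = hallD[OF S]
  obtain t where t: "t \<in> T" "cj t P \<subseteq> S" using con[OF assms(6,7) PT(1) assms(9)] by blast
  have "U \<subseteq> cj x P" using cj_mono[OF assms(7), of x] U(5)[OF x] by simp
  moreover have "pi_number \<rho> (idx (cj x P) U)"
    using idx_cj[OF xc Pc sub_carrier[OF U(1)]] U(5)[OF x] assms(9) by simp
  ultimately obtain t' where t': "t' \<in> T" "cj t' (cj x P) \<subseteq> S"
    using con[OF sub_cj[OF xc assms(6)] _ PT(2)] by blast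
  have c: "t \<in> carrier G" "t' \<in> carrier G" "t \<in> X" "t' \<in> X" using t t' sub_memD(1)[OF T(1)] T(3) by blast+
  have SX: "S \<subseteq> X" using S(3) T(3) by blast
  have e: "cj t P = cj (x \<otimes> t') P"
    using t' c xc Pc
    by (intro weakly_closed_conj2[OF wc assms(3,8) S(1,2) SX S(4)] c x t Xm(3)) (simp add: cj_mult)
  \<comment> \<open>T/A is a \<rho>-group while S has \<rho>'-index in T.\<close>
  have SA: "S <#> A = T"
  proof -
    have nSA: "normalizes S A" using normalizes_mono[OF A(4) SX] .
    have "A <#> S = T"
      using T(4) S(5) sub_set_mult[OF A(1) S(1) nSA] T(2) S(3)
      by (intro idx_coprime_set_mult[OF A(1) S(1) T(1)] pi_number_coprime[of \<rho> _ "- \<rho>"]) auto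
    then show ?thesis using set_mult_commute_nml[OF A(1) S(1) nSA] by simp
  qed
  have Ac: "A \<subseteq> carrier G" using sub_carrier[OF A(1)] .
  have cjA: "A <#> cj y B = cj y (A <#> B)" if "y \<in> X" "B \<subseteq> carrier G" for y B
    using cj_set_mult[OF Xm(1)[OF that(1)] Ac that(2)] A(5)[OF that(1)] by simp
  define R where "R = cj t P"
  have R: "sub R" "R \<subseteq> X" "R \<subseteq> carrier G" "R \<subseteq> S"
    unfolding R_def using sub_cj[OF c(1) assms(6)] cj_subset_sub[OF A(2) c(3) assms(8)] cj_carrier[OF c(1) Pc] t(2) .
  \<comment> \<open>With z = sa, the factor s fixes R by weak closure inside S, and a fixes AR
    because it lies in AR.\<close>
  have *: "A <#> cj z R = A <#> R" if z: "z \<in> T" for z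
  proof -
    obtain s a where s: "s \<in> S" "a \<in> A" "z = s \<otimes> a"
      using z SA set_mult_mem[of z S A] by blast
    have sc: "s \<in> carrier G" "a \<in> carrier G" "s \<in> X" "a \<in> X"
      using s(1,2) SX A(3) Xm(1) by blast+
    have "cj s R = cj (t \<otimes> s) P" unfolding R_def using c sc Pc by (simp add: cj_mult)
    also have "\<dots> = R"
      unfolding R_def
      using weakly_closed_conj2[OF wc assms(3,8) S(1,2) SX S(4) Xm(3)[OF c(3) sc(3)] c(3) _ t(2)]
        cj_subset_sub[OF S(1) s(1) t(2)] c sc Pc by (simp add: cj_mult)
    finally have "cj z R = cj a R" unfolding s(3) cj_mult[OF sc(1,2) R(3), symmetric] by simp
    then have "A <#> cj z R = cj a (A <#> R)" using cjA[OF sc(4) R(3)] by simp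
    also have "\<dots> = A <#> R"
      using normal_set_mult_sub(1,2)[OF assms(4) R(1,2)] s(2) cj_self by blast
    finally show ?thesis .
  qed
  have "cj (inv t) R = P" unfolding R_def using c Pc by simp
  moreover have "cj (inv t') R = cj x P"
    unfolding R_def e using c xc Pc by (simp add: cj_mult m_assoc)
  ultimately have "A <#> cj x P = A <#> P"
    using *[of "inv t"] *[of "inv t'"] t(1) t'(1) sub_memD(2)[OF T(1)] by simp
  then show "cj x (A <#> P) = A <#> P" using cjA[OF x Pc] by simp
qed

text \<open>If Q normalizes AP, then [P, Q] lies in AP \<inter> N, which is A(P \<inter> N) = A by
  the modular law.\<close>

lemma commutator_in_normal_part:
  assumes "nml A X" "nml N X" "A \<subseteq> N" "sub P" "P \<subseteq> X" "P \<inter> N \<subseteq> A" "commutes_mod N P Q"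
    and "Q \<subseteq> X" "\<And>q. q \<in> Q \<Longrightarrow> cj q (A <#> P) = A <#> P"
  shows "commutes_mod A P Q"
  unfolding commutes_mod_def
proof (intro ballI)
  fix p q assume p: "p \<in> P" and q: "q \<in> Q"
  note N = nmlD[OF assms(2)] and Xm = sub_memD[OF nmlD(2)[OF assms(2)]]
  note AP = normal_set_mult_sub[OF assms(1,4,5)]
  have pc: "p \<in> carrier G" "q \<in> carrier G" using p q assms(5,8) Xm(1) by blast+
  have "inv q \<otimes> p \<otimes> q \<in> A <#> P" using assms(9)[OF q] AP(3) p unfolding cj_def by blast
  then have "inv p \<otimes> (inv q \<otimes> p \<otimes> q) \<in> A <#> P" using AP(1,3) p sub_memD(2,3) by blast
  moreover have "inv p \<otimes> (inv q \<otimes> p \<otimes> q) = inv p \<otimes> inv q \<otimes> p \<otimes> q" using pc by (simp add: m_assoc)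
  moreover have "inv p \<otimes> inv q \<otimes> p \<otimes> q \<in> N" using assms(7) p q unfolding commutes_mod_def by blast
  ultimately have "inv p \<otimes> inv q \<otimes> p \<otimes> q \<in> (A <#> P) \<inter> N" by simp
  also have "(A <#> P) \<inter> N = A <#> (P \<inter> N)" using dedekind[OF nmlD(1)[OF assms(1)] assms(4) N(1) assms(3)] .
  also have "\<dots> \<subseteq> A" using set_mult_least[OF nmlD(1)[OF assms(1)] subset_refl assms(6)] .
  finally show "inv p \<otimes> inv q \<otimes> p \<otimes> q \<in> A" .
qed

text \<open>The conjugate of p by q is p[p, q].\<close>

lemma commutes_mod_normalizes:
  assumes "nml N X" "sub P" "P \<subseteq> X" "sub Q" "Q \<subseteq> X" "commutes_mod N P Q"
  shows "normalizes Q (N <#> P)"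
proof (rule normalizesI)
  note N = nmlD[OF assms(1)] and Xm = sub_memD[OF nmlD(2)[OF assms(1)]]
  note NP = normal_set_mult_sub[OF assms(1-3)]
  show "sub (N <#> P)" using NP(1) .
  show "Q \<subseteq> carrier G" using sub_carrier[OF assms(4)] .
  fix a q assume a: "a \<in> N <#> P" and q: "q \<in> Q"
  then obtain n p where np: "n \<in> N" "p \<in> P" "a = n \<otimes> p" using set_mult_mem by blast
  have c: "n \<in> carrier G" "p \<in> carrier G" "q \<in> carrier G" "q \<in> X"
    using np q N(3) assms(3,5) Xm(1) by blast+
  have "inv q \<otimes> n \<otimes> q \<in> N" using normalizes_elem[OF N(4) c(4) np(1)] .
  moreover have "inv p \<otimes> inv q \<otimes> p \<otimes> q \<in> N" using assms(6) np(2) q unfolding commutes_mod_def by blast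
  ultimately have "(inv q \<otimes> n \<otimes> q) \<otimes> (p \<otimes> (inv p \<otimes> inv q \<otimes> p \<otimes> q)) \<in> N <#> P"
    using NP(1-3) np(2) sub_memD(3)[OF NP(1)] by (meson subsetD)
  moreover have "(inv q \<otimes> n \<otimes> q) \<otimes> (p \<otimes> (inv p \<otimes> inv q \<otimes> p \<otimes> q)) = inv q \<otimes> a \<otimes> q"
    unfolding np(3) using c by (simp add: m_assoc)
  ultimately show "inv q \<otimes> a \<otimes> q \<in> N <#> P" by simp
qed

text \<open>By the identity expressing [p, nq] as [p, q] times the conjugate of [p, n] by q, the
  extra factor lies in the normal subgroup N.\<close>

lemma commutes_mod_mult_right:
  assumes "nml N X" "P \<subseteq> X" "Q \<subseteq> X" "commutes_mod N P Q"
  shows "commutes_mod N P (N <#> Q)"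
  unfolding commutes_mod_def
proof (intro ballI)
  note N = nmlD[OF assms(1)] and Xm = sub_memD[OF nmlD(2)[OF assms(1)]] and Nm = sub_memD[OF nmlD(1)[OF assms(1)]]
  fix p b assume p: "p \<in> P" and b: "b \<in> N <#> Q"
  then obtain n q where nq: "n \<in> N" "q \<in> Q" "b = n \<otimes> q" using set_mult_mem by blast
  have c: "n \<in> carrier G" "p \<in> carrier G" "q \<in> carrier G" "q \<in> X" "p \<in> X"
    using nq p N(3) assms(2,3) Xm(1) by blast+
  have "inv p \<otimes> inv n \<otimes> p \<in> N" using normalizes_elem[OF N(4) c(5)] Nm(2) nq(1) by blast
  then have "inv q \<otimes> ((inv p \<otimes> inv n \<otimes> p) \<otimes> n) \<otimes> q \<in> N" using normalizes_elem[OF N(4) c(4)] Nm(3) nq(1) by blast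
  moreover have "inv p \<otimes> inv q \<otimes> p \<otimes> q \<in> N" using assms(4) p nq(2) unfolding commutes_mod_def by blast
  ultimately have "(inv p \<otimes> inv q \<otimes> p \<otimes> q) \<otimes> (inv q \<otimes> ((inv p \<otimes> inv n \<otimes> p) \<otimes> n) \<otimes> q) \<in> N" using Nm(3) by blast
  then have "inv p \<otimes> (inv q \<otimes> (inv n \<otimes> (p \<otimes> (n \<otimes> q)))) \<in> N" using c by (simp add: m_assoc)
  then show "inv p \<otimes> inv b \<otimes> p \<otimes> b \<in> N"
    unfolding nq(3) using c by (simp add: m_assoc inv_mult_group)
qed

end

text \<open>Collects what the arguments on weak closure and injectors use about the atoms and the
  solubility of G.\<close>

locale solvable_setup = finite_group +
  fixes \<A> :: "nat set set"
  assumes disjoint: "\<rho> \<in> \<A> \<Longrightarrow> \<sigma> \<in> \<A> \<Longrightarrow> \<rho> \<noteq> \<sigma> \<Longrightarrow> \<rho> \<inter> \<sigma> = {}"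
    and dominates: "nml W H \<Longrightarrow> \<rho> \<in> \<A> \<Longrightarrow> hall_dominates \<rho> W H"
    and series: "solvable_series \<A> (carrier G)"
begin

text \<open>One step down a normal series. If N/A belongs to the atom of P or of Q, weak closure of
  that subgroup does it without conjugation; otherwise Q must be moved into the normalizer of AP,
  where a Hall \<sigma>-subgroup of NPQ can be found.\<close>

lemma commuting_conjugate_step:
  assumes X: "nml U X" "nml N X" "nml A X" "U \<subseteq> A" "A \<subseteq> N" "\<tau> \<in> \<A>" "pi_number \<tau> (idx N A)"
    and at: "\<rho> \<in> \<A>" "\<sigma> \<in> \<A>" "\<rho> \<noteq> \<sigma>"
    and P: "sub P" "U \<subseteq> P" "P \<subseteq> X" "P \<inter> N = U" "pi_number \<rho> (idx P U)" "weakly_closed \<rho> U X P"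
    and Q: "sub Q" "U \<subseteq> Q" "Q \<subseteq> X" "Q \<inter> N = U" "pi_number \<sigma> (idx Q U)" "weakly_closed \<sigma> U X Q"
    and com: "commutes_mod N P Q"
  shows "\<exists>d\<in>X. commutes_mod A P (cj d Q)"
proof -
  note U = nmlD[OF X(1)] and N = nmlD[OF X(2)] and A = nmlD[OF X(3)] and Xm = sub_memD[OF nmlD(2)[OF X(1)]]
  \<comment> \<open>Here NP/A is a \<rho>-group normalized by Q, so weak closure forces Q to
    normalize AP. Stated with its own variables, since it is used with P and Q in either
    order.\<close>
  have same: "commutes_mod A P Q"
    if P: "sub P" "U \<subseteq> P" "P \<subseteq> X" "P \<inter> N = U" "pi_number \<rho> (idx P U)" "weakly_closed \<rho> U X P"
      and Q: "sub Q" "Q \<subseteq> X" and com: "commutes_mod N P Q" and \<rho>: "\<rho> \<in> \<A>" "pi_number \<rho> (idx N A)" for P Q \<rho>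
  proof -
    note AP = normal_set_mult_sub[OF X(3) P(1,3)] and NP = normal_set_mult_sub[OF X(2) P(1,3)]
    have wc: "weakly_closed \<rho> A X (A <#> P)"
      by (rule weakly_closed_mod[OF P(6) dominates[OF _ \<rho>(1)] X(1,3,4) P(1-3,5)])
    have ANP: "A \<subseteq> N <#> P" "A <#> P \<subseteq> N <#> P"
      using X(5) NP(2) mono_set_mult[OF X(5), of P P] by blast+
    have "idx (N <#> P) A = idx (N <#> P) N * idx N A"
      using idx_trans[OF NP(1) N(1) A(1) X(5) NP(2)] .
    moreover have "pi_number \<rho> (idx (N <#> P) N)"
      using idx_set_mult_dvd_sub[OF X(2) P(1,3) U(1) P(2)] X(4,5) P(5) pi_number_dvd by blast
    ultimately have num: "pi_number \<rho> (idx (N <#> P) A)" using \<rho>(2) by (simp add: pi_number_mult_iff)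
    have nQ: "normalizes Q (N <#> P)" using commutes_mod_normalizes[OF X(2) P(1,3) Q com] .
    have "cj q (A <#> P) = A <#> P" if q: "q \<in> Q" for q
    proof (rule weakly_closedD[OF wc _ NP(1) ANP(1) NP(4) num ANP(2)])
      show "q \<in> X" using q Q(2) by blast
      show "cj q (A <#> P) \<subseteq> N <#> P" using cj_mono[OF ANP(2), of q] normalizesD[OF nQ q] by simp
    qed
    then show ?thesis
      using P(4) X(4) by (intro commutator_in_normal_part[OF X(3,2,5) P(1,3) _ com Q(2)]) simp_all
  qed
  consider "\<tau> = \<rho>" | "\<tau> = \<sigma>" | "\<tau> \<inter> \<rho> = {}" "\<tau> \<inter> \<sigma> = {}" "\<rho> \<inter> \<sigma> = {}"
    using disjoint X(6) at by blast
  then show ?thesis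
  proof cases
    case 1
    then have "commutes_mod A P Q" using same[OF P Q(1,3) com at(1)] X(7) by simp
    then show ?thesis using one_in[OF U(2)] cj_one[OF sub_carrier[OF Q(1)]] by metis
  next
    case 2
    then have "commutes_mod A Q P"
      using same[OF Q P(1,3) commutes_mod_sym[OF P(1) Q(1) N(1) com] at(2)] X(7) by simp
    then have "commutes_mod A P Q" by (rule commutes_mod_sym[OF Q(1) P(1) A(1)])
    then show ?thesis using one_in[OF U(2)] cj_one[OF sub_carrier[OF Q(1)]] by metis
  next
    case 3
    note AP = normal_set_mult_sub[OF X(3) P(1,3)] and NP = normal_set_mult_sub[OF X(2) P(1,3)]
    note AQ = normal_set_mult_sub[OF X(3) Q(1,3)] and NQ = normal_set_mult_sub[OF X(2) Q(1,3)]
    have nQ: "normalizes Q (N <#> P)" using commutes_mod_normalizes[OF X(2) P(1,3) Q(1,3) com] .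
    have nP: "normalizes P (N <#> Q)"
      using commutes_mod_normalizes[OF X(2) Q(1,3) P(1,3) commutes_mod_sym[OF P(1) Q(1) N(1) com]] .
    \<comment> \<open>E = NPQ, in which both NP and NQ are normal because [P, Q] \<le> N.\<close>
    define E where "E = (N <#> P) <#> Q"
    have E: "sub E" "N <#> P \<subseteq> E" "Q \<subseteq> E" "E \<subseteq> X" "nml (N <#> P) E"
      unfolding E_def using sub_set_mult[OF NP(1) Q(1) nQ] set_mult_upper[OF NP(1) Q(1)]
        set_mult_least[OF U(2) NP(4) Q(3)] nml_in_set_mult[OF NP(1) Q(1) nQ] .
    have NE: "N \<subseteq> E" "A \<subseteq> E" "P \<subseteq> E" using NP(2,3) E(2) X(5) by blast+
    have nNE: "nml N E" "nml A E"
      using nml_restrict[OF X(2) E(1) NE(1) E(4)] nml_restrict[OF X(3) E(1) NE(2) E(4)] .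
    have NQE: "normalizes E (N <#> Q)"
      unfolding E_def
    proof (intro normalizes_by_set_mult)
      show "normalizes N (N <#> Q)" using normalizes_self[OF NQ(1,2)] .
      show "normalizes Q (N <#> Q)" using normalizes_self[OF NQ(1,3)] .
      show "normalizes P (N <#> Q)" using nP .
    qed (use sub_carrier N(1) P(1) Q(1) NP(1) NQ(1) in simp_all)
    let ?P = "A <#> P"
    have wc: "weakly_closed \<rho> A X ?P"
      by (rule weakly_closed_mod[OF P(6) dominates[OF _ at(1)] X(1,3,4) P(1-3,5)])
    have numP: "pi_number \<rho> (idx ?P A)"
      using idx_set_mult_dvd_sub[OF X(3) P(1,3) U(1) P(2)] X(4) P(5) pi_number_dvd by blast
    have numQ: "pi_number \<sigma> (idx (A <#> Q) A)"
      using idx_set_mult_dvd_sub[OF X(3) Q(1,3) U(1) Q(2)] X(4) Q(5) pi_number_dvd by blast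
    have PNP: "?P \<subseteq> N <#> P" using mono_set_mult[OF X(5), of P P] by simp
    define B where "B = normalizer_in E ?P"
    have B: "sub B" "B \<subseteq> E" "?P \<subseteq> B"
      unfolding B_def using normalizer_in_sub[OF E(1) sub_carrier[OF AP(1)]] normalizer_in_subset
        nmlD(3)[OF normalizer_in_nml[OF E(1) AP(1)]] PNP E(2) by auto
    have AB: "A \<subseteq> B" using AP(2) B(3) by blast
    \<comment> \<open>Frattini argument: NP is normal in E, and any E-conjugate of AP is conjugate
      to AP under NP, because both go into one Hall \<rho>-subgroup over A, where weak closure makes
      them equal.\<close>
    have "N <#> B = E"
    proof (rule subset_antisym)
      show "N <#> B \<subseteq> E" using set_mult_least[OF E(1) NE(1) B(2)] .
      show "E \<subseteq> N <#> B"
      proof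
        fix e assume e: "e \<in> E"
        have ANP: "A \<subseteq> N <#> P" using X(5) NP(2) by blast
        have nA: "nml A (N <#> P)" using nml_restrict[OF X(3) NP(1) ANP NP(4)] .
        obtain T where T: "hall \<rho> A (N <#> P) T"
          and con: "\<And>L. sub L \<Longrightarrow> A \<subseteq> L \<Longrightarrow> L \<subseteq> N <#> P \<Longrightarrow> pi_number \<rho> (idx L A) \<Longrightarrow> \<exists>h\<in>N <#> P. cj h L \<subseteq> T"
          using dominates[OF nA at(1)] unfolding hall_dominates_def by blast
        note T = hallD[OF T]
        have TX: "T \<subseteq> X" using T(3) NP(4) by blast
        have eX: "e \<in> X" "e \<in> carrier G" using e E(4) Xm(1) by blast+
        obtain h where h: "h \<in> N <#> P" "cj h ?P \<subseteq> T" using con[OF AP(1,2) PNP numP] by blast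
        have "A \<subseteq> cj e ?P" using cj_mono[OF AP(2), of e] A(5)[OF eX(1)] by simp
        moreover have "cj e ?P \<subseteq> N <#> P" using cj_mono[OF PNP, of e] nmlD(5)[OF E(5) e] by simp
        moreover have "pi_number \<rho> (idx (cj e ?P) A)"
          using idx_cj[OF eX(2) sub_carrier[OF AP(1)] sub_carrier[OF A(1)]] A(5)[OF eX(1)] numP by simp
        ultimately obtain h' where h': "h' \<in> N <#> P" "cj h' (cj e ?P) \<subseteq> T"
          using con[OF sub_cj[OF eX(2) AP(1)]] by blast
        have hX: "h \<in> X" "h' \<in> X" "h \<in> carrier G" "h' \<in> carrier G" using h h' NP(4) Xm(1) by blast+
        have Pc: "?P \<subseteq> carrier G" using sub_carrier[OF AP(1)] .
        have "cj (e \<otimes> h') ?P = cj h ?P"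
          using weakly_closed_conj2[OF wc X(3) AP(4) T(1,2) TX T(4) Xm(3)[OF eX(1) hX(2)] hX(1) _ h(2)]
            h'(2) hX eX Pc by (simp add: cj_mult)
        then have "cj (inv h) (cj (e \<otimes> h') ?P) = ?P" using hX Pc by simp
        then have "cj (e \<otimes> (h' \<otimes> inv h)) ?P = ?P" using hX eX Pc by (simp add: cj_mult m_assoc)
        moreover have g: "h' \<otimes> inv h \<in> N <#> P" using h(1) h'(1) sub_memD[OF NP(1)] by blast
        ultimately have b: "e \<otimes> (h' \<otimes> inv h) \<in> B"
          unfolding B_def normalizer_in_def using e E(2) sub_memD(3)[OF E(1)] by blast
        have "N <#> B = B <#> N" and sNB: "sub (N <#> B)" "B \<subseteq> N <#> B" "N \<subseteq> N <#> B"
          using normal_set_mult_sub[OF nNE(1) B(1,2)] by blast+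
        have "N <#> P \<subseteq> N <#> B" using AP(3) B(3) by (intro mono_set_mult) auto
        then have "inv (h' \<otimes> inv h) \<in> N <#> B" using g sub_memD(2)[OF sNB(1)] by blast
        then have "(e \<otimes> (h' \<otimes> inv h)) \<otimes> inv (h' \<otimes> inv h) \<in> N <#> B"
          using b sNB(2) sub_memD(3)[OF sNB(1)] by blast
        then show "e \<in> N <#> B" using eX hX by (simp add: m_assoc inv_mult_group)
      qed
    qed
    then have "card E * card (N \<inter> B) = card N * card B" using card_set_mult[OF N(1) B(1)] by simp
    moreover have "card N = idx N (N \<inter> B) * card (N \<inter> B)"
      using idx_card[OF N(1) sub_Int[OF N(1) B(1)]] by simp
    ultimately have "card E = idx N (N \<inter> B) * card B" using card_sub_pos[OF sub_Int[OF N(1) B(1)]] by simp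
    then have "idx E B = idx N (N \<inter> B)" by (rule idx_eqI[OF B(1)])
    also have "\<dots> dvd idx N A" using X(5) AB by (intro idx_dvd_l[OF N(1) sub_Int[OF N(1) B(1)] A(1)]) auto
    finally have "pi_number \<tau> (idx E B)" using X(7) pi_number_dvd by blast
    \<comment> \<open>The index of B in E divides |N/A|, a number for an atom disjoint from
      \<sigma>; so B contains a full Hall \<sigma>-subgroup of E over A, into which AQ can be
      conjugated.\<close>
    then have EB: "pi_number (- \<sigma>) (idx E B)" using pi_number_mono[of \<tau> _ "- \<sigma>"] 3(2) by blast
    have nAB: "nml A B" using nml_restrict[OF nNE(2) B(1) AB B(2)] .
    obtain S where S: "hall \<sigma> A B S" using dominates[OF nAB at(2)] unfolding hall_dominates_def by blast
    note S = hallD[OF S]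
    have SE: "S \<subseteq> E" using S(3) B(2) by blast
    have ES: "pi_number (- \<sigma>) (idx E S)"
      using idx_trans[OF E(1) B(1) S(1,3) B(2)] EB S(5) by (simp add: pi_number_mult_iff)
    obtain T where T: "hall \<sigma> A E T"
      and con: "\<And>L. sub L \<Longrightarrow> A \<subseteq> L \<Longrightarrow> L \<subseteq> E \<Longrightarrow> pi_number \<sigma> (idx L A) \<Longrightarrow> \<exists>h\<in>E. cj h L \<subseteq> T"
      using dominates[OF nNE(2) at(2)] unfolding hall_dominates_def by blast
    note T = hallD[OF T]
    obtain e where e: "e \<in> E" "cj e S \<subseteq> T" using con[OF S(1,2) SE S(4)] by blast
    have ec: "e \<in> carrier G" using e sub_memD(1)[OF E(1)] by blast
    have AQE: "A <#> Q \<subseteq> E" using set_mult_least[OF E(1) NE(2) E(3)] .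
    obtain e' where e': "e' \<in> E" "cj e' (A <#> Q) \<subseteq> T" using con[OF AQ(1,2) AQE numQ] by blast
    have ec': "e' \<in> carrier G" using e' sub_memD(1)[OF E(1)] by blast
    have "cj e S = T"
    proof -
      have s: "sub (cj e S)" using sub_cj[OF ec S(1)] .
      have "A \<subseteq> cj e S" using cj_mono[OF S(2), of e] nmlD(5)[OF nNE(2) e(1)] by simp
      then have "idx T (cj e S) dvd idx T A" by (intro idx_dvd_l[OF T(1) s A(1) _ e(2)])
      moreover have "idx T (cj e S) dvd idx E (cj e S)" by (rule idx_dvd_r[OF E(1) T(1) s e(2) T(3)])
      moreover have "idx E (cj e S) = idx E S"
        using idx_cj[OF ec sub_carrier[OF E(1)] sub_carrier[OF S(1)]] cj_self[OF E(1) e(1)] by simp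
      ultimately have "pi_number \<sigma> (idx T (cj e S))" "pi_number (- \<sigma>) (idx T (cj e S))"
        using T(4) ES pi_number_dvd by metis+
      then have "idx T (cj e S) = 1" using pi_number_disjoint by blast
      then show ?thesis by (rule idx_1D[OF T(1) s e(2)])
    qed
    then have "cj (inv e) T = S" using ec sub_carrier[OF S(1)] by auto
    then have *: "cj (e' \<otimes> inv e) (A <#> Q) \<subseteq> S"
      using cj_mono[OF e'(2), of "inv e"] ec ec' sub_carrier[OF AQ(1)] by (simp add: cj_mult)
    define d where "d = e' \<otimes> inv e"
    have d: "d \<in> E" "d \<in> X" "d \<in> carrier G" unfolding d_def using e e' sub_memD[OF E(1)] E(4) by blast+
    have dQB: "cj d Q \<subseteq> B" using * cj_mono[OF AQ(3), of d] S(3) unfolding d_def by blast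
    \<comment> \<open>NQ is normal in E, so conjugating Q by d \<in> E does not destroy the
      commutator relation modulo N.\<close>
    have dQN: "cj d Q \<subseteq> N <#> Q"
      using cj_mono[OF NQ(3), of d] normalizesD[OF NQE d(1)] by simp
    have "commutes_mod N P (cj d Q)"
      using commutes_mod_mult_right[OF X(2) P(3) Q(3) com] dQN unfolding commutes_mod_def by blast
    then have "commutes_mod A P (cj d Q)"
    proof (rule commutator_in_normal_part[OF X(3,2,5) P(1,3), rotated])
      show "P \<inter> N \<subseteq> A" using P(4) X(4) by simp
      show "cj d Q \<subseteq> X" using cj_subset_sub[OF U(2) d(2) Q(3)] .
      show "cj q ?P = ?P" if "q \<in> cj d Q" for q
        using that dQB unfolding B_def normalizer_in_def by blast
    qed
    then show ?thesis using d(2) by blast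
  qed
qed

lemma chain_subset: "(chain_step \<A> X)\<^sup>*\<^sup>* N W \<Longrightarrow> W \<subseteq> N"
  by (induction rule: rtranclp_induct) (auto simp: chain_step_def)

lemma chain_exists:
  assumes "nml U X" "nml D X" "U \<subseteq> D"
  shows "(chain_step \<A> X)\<^sup>*\<^sup>* D U"
proof -
  note U = nmlD[OF assms(1)]
  have "solvable_series \<A> X" using solvable_series_subgroup[OF series U(2) sub_carrier[OF U(2)]] .
  then show ?thesis using chain_between[OF _ assms] solvable_series_chain nml_self[OF U(2)] by blast
qed

text \<open>Only Q is replaced by conjugates along the series. Since U and the terms of the series
  are normal in X, a conjugate of Q satisfies the same hypotheses as Q, so the steps
  compose.\<close>

lemma commuting_conjugate:
  assumes X: "nml U X" "nml M X" "nml K X" "U \<subseteq> M \<inter> K"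
    and at: "\<rho> \<in> \<A>" "\<sigma> \<in> \<A>" "\<rho> \<noteq> \<sigma>"
    and P: "sub P" "U \<subseteq> P" "P \<subseteq> M" "P \<inter> K = U" "pi_number \<rho> (idx P U)" "weakly_closed \<rho> U X P"
    and Q: "sub Q" "U \<subseteq> Q" "Q \<subseteq> K" "Q \<inter> M = U" "pi_number \<sigma> (idx Q U)" "weakly_closed \<sigma> U X Q"
  shows "\<exists>d\<in>X. commutes_mod U P (cj d Q)"
proof -
  note U = nmlD[OF X(1)] and M = nmlD[OF X(2)] and K = nmlD[OF X(3)] and Xm = sub_memD[OF nmlD(2)[OF X(1)]]
  have PX: "P \<subseteq> X" and QX: "Q \<subseteq> X" using P(3) Q(3) M(3) K(3) by blast+
  have stepX: "\<exists>d\<in>X. commutes_mod A P (cj d Q)"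
    if s: "chain_step \<A> X N A" "U \<subseteq> A" "N \<subseteq> M \<inter> K" and ex: "\<exists>d\<in>X. commutes_mod N P (cj d Q)" for N A
  proof -
    obtain d where d: "d \<in> X" "commutes_mod N P (cj d Q)" using ex by blast
    have dc: "d \<in> carrier G" using Xm d by blast
    have n: "nml N X" "nml A X" "A \<subseteq> N" using s(1) unfolding chain_step_def by blast+
    obtain \<tau> where \<tau>: "\<tau> \<in> \<A>" "pi_number \<tau> (idx N A)" using s(1) unfolding chain_step_def by blast
    have UN: "U \<subseteq> N" using s(2) n(3) by blast
    have PN: "P \<inter> N = U" using P(2,4) s(3) UN by blast
    have dU: "cj d U = U" using U(5)[OF d(1)] .
    have QN: "cj d Q \<inter> N = U"
    proof -
      have "cj d (Q \<inter> N) = cj d Q \<inter> cj d N"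
        using cj_Int[OF dc sub_carrier[OF Q(1)] sub_carrier[OF nmlD(1)[OF n(1)]]] .
      moreover have "Q \<inter> N = U" using Q(2,4) s(3) UN by blast
      ultimately show ?thesis using dU nmlD(5)[OF n(1) d(1)] by simp
    qed
    have numQ: "pi_number \<sigma> (idx (cj d Q) U)"
      using idx_cj[OF dc sub_carrier[OF Q(1)] sub_carrier[OF U(1)]] dU Q(5) by simp
    have UQ: "U \<subseteq> cj d Q" using cj_mono[OF Q(2), of d] dU by simp
    obtain d' where d': "d' \<in> X" "commutes_mod A P (cj d' (cj d Q))"
      using commuting_conjugate_step[OF X(1) n(1,2) s(2) n(3) \<tau> at P(1,2) PX PN P(5,6)
          sub_cj[OF dc Q(1)] UQ cj_subset_sub[OF U(2) d(1) QX] QN numQ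
          weakly_closed_cj[OF Q(6) X(1) QX d(1)] d(2)] by blast
    have "cj d' (cj d Q) = cj (d \<otimes> d') Q"
      using cj_mult[OF dc Xm(1)[OF d'(1)] sub_carrier[OF Q(1)]] .
    then show ?thesis using d' d Xm(3) by metis
  qed
  have "N \<subseteq> M \<inter> K \<longrightarrow> (\<exists>d\<in>X. commutes_mod N P (cj d Q)) \<longrightarrow> (\<exists>d\<in>X. commutes_mod U P (cj d Q))"
    if "(chain_step \<A> X)\<^sup>*\<^sup>* N U" for N
    using that
  proof (induction rule: converse_rtranclp_induct)
    case (step N A)
    have "A \<subseteq> N" using step(1) unfolding chain_step_def by blast
    show ?case
    proof (intro impI)
      assume le: "N \<subseteq> M \<inter> K" and ex: "\<exists>d\<in>X. commutes_mod N P (cj d Q)"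
      have "\<exists>d\<in>X. commutes_mod A P (cj d Q)"
        by (rule stepX[OF step(1) chain_subset[OF step(2)] le ex])
      then show "\<exists>d\<in>X. commutes_mod U P (cj d Q)"
        using step(3) subset_trans[OF \<open>A \<subseteq> N\<close> le] by blast
    qed
  qed simp
  from this[OF chain_exists[OF X(1) nml_Int[OF X(2,3)] X(4)]]
  have "(\<exists>d\<in>X. commutes_mod (M \<inter> K) P (cj d Q)) \<longrightarrow> (\<exists>d\<in>X. commutes_mod U P (cj d Q))" by simp
  \<comment> \<open>The relation holds at the top without conjugation: [P, Q] lies in both normal
    subgroups M and K.\<close>
  moreover have "commutes_mod (M \<inter> K) P (cj \<one> Q)"
    unfolding cj_one[OF sub_carrier[OF Q(1)]] commutes_mod_def
  proof (intro ballI)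
    fix p q assume p: "p \<in> P" and q: "q \<in> Q"
    have c: "p \<in> M" "q \<in> K" "p \<in> X" "q \<in> X" "p \<in> carrier G" "q \<in> carrier G"
      using p q P(3) Q(3) PX QX Xm(1) by blast+
    have "inv q \<otimes> p \<otimes> q \<in> M" using normalizes_elem[OF M(4) c(4,1)] .
    then have "inv p \<otimes> (inv q \<otimes> p \<otimes> q) \<in> M" using sub_memD[OF M(1)] c(1) by blast
    moreover have "inv p \<otimes> inv q \<otimes> p \<in> K" using normalizes_elem[OF K(4) c(3)] sub_memD(2)[OF K(1) c(2)] by blast
    then have "(inv p \<otimes> inv q \<otimes> p) \<otimes> q \<in> K" using sub_memD[OF K(1)] c(2) by blast
    ultimately show "inv p \<otimes> inv q \<otimes> p \<otimes> q \<in> M \<inter> K" using c by (simp add: m_assoc)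
  qed
  ultimately show ?thesis using one_in[OF U(2)] by blast
qed

end

section \<open>Injectors\<close>

context finite_group
begin

definition subnormal_in :: "'a set \<Rightarrow> 'a set \<Rightarrow> bool"
  where "subnormal_in K H \<longleftrightarrow> sub K \<and> sub H \<and> nml\<^sup>*\<^sup>* K H"

lemma subnormal_in_self: "sub H \<Longrightarrow> subnormal_in H H"
  by (simp add: subnormal_in_def)

lemma subnormal_in_nml: "nml K H \<Longrightarrow> subnormal_in K H"
  unfolding subnormal_in_def using nmlD(1,2) by (auto intro: r_into_rtranclp)

lemma subnormal_in_trans: "subnormal_in K H \<Longrightarrow> subnormal_in H J \<Longrightarrow> subnormal_in K J"
  unfolding subnormal_in_def by (auto intro: rtranclp_trans)

lemma subnormal_in_subset: "subnormal_in K H \<Longrightarrow> K \<subseteq> H"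
proof -
  have "nml\<^sup>*\<^sup>* K H \<Longrightarrow> K \<subseteq> H"
  proof (induction rule: rtranclp_induct)
    case (step M H)
    then show ?case using nmlD(3)[OF step(2)] by blast
  qed simp
  then show "subnormal_in K H \<Longrightarrow> K \<subseteq> H" unfolding subnormal_in_def by blast
qed

lemma subnormal_in_cj:
  assumes "subnormal_in K H" "x \<in> carrier G"
  shows "subnormal_in (cj x K) (cj x H)"
proof -
  have "nml\<^sup>*\<^sup>* K H" using assms(1) unfolding subnormal_in_def by blast
  then have "nml\<^sup>*\<^sup>* (cj x K) (cj x H)"
  proof (induction rule: rtranclp_induct)
    case (step M H)
    show ?case using step(3) nml_cj[OF step(2) assms(2)] by (rule rtranclp.rtrancl_into_rtrancl)
  qed simp
  then show ?thesis using assms sub_cj unfolding subnormal_in_def by blast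
qed

lemma subnormal_in_proper:
  assumes "subnormal_in K H" "K \<noteq> H"
  shows "\<exists>M. nml M H \<and> M \<noteq> H \<and> subnormal_in K M"
proof -
  have "nml\<^sup>*\<^sup>* K H" "sub K" using assms(1) unfolding subnormal_in_def by blast+
  then have "K \<noteq> H \<longrightarrow> (\<exists>M. nml M H \<and> M \<noteq> H \<and> subnormal_in K M)"
  proof (induction rule: rtranclp_induct)
    case (step M H)
    show ?case
    proof (cases "M = H")
      case False
      have "subnormal_in K M" using step nmlD(1) unfolding subnormal_in_def by blast
      then show ?thesis using step(2) False by blast
    qed (use step in blast)
  qed simp
  then show ?thesis using assms(2) by blast
qed

end

locale fitting_setup = solvable_setup +
  fixes \<F> :: "'a set set"
  assumes F_sub: "S \<in> \<F> \<Longrightarrow> sub S"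
    and F_one: "{\<one>} \<in> \<F>"
    and F_nml: "S \<in> \<F> \<Longrightarrow> nml T S \<Longrightarrow> T \<in> \<F>"
    and F_prod: "S \<in> \<F> \<Longrightarrow> T \<in> \<F> \<Longrightarrow> normalizes T S \<Longrightarrow> normalizes S T \<Longrightarrow> S <#> T \<in> \<F>"
    and F_cj: "S \<in> \<F> \<Longrightarrow> x \<in> carrier G \<Longrightarrow> cj x S \<in> \<F>"
    and F_join: "\<rho> \<in> \<A> \<Longrightarrow> nml W J \<Longrightarrow> pi_number \<rho> (idx J W) \<Longrightarrow> S \<in> \<F> \<Longrightarrow> T \<in> \<F> \<Longrightarrow>
      W \<subseteq> S \<Longrightarrow> W \<subseteq> T \<Longrightarrow> S \<subseteq> J \<Longrightarrow> T \<subseteq> J \<Longrightarrow> \<exists>V\<in>\<F>. S \<subseteq> V \<and> T \<subseteq> V \<and> V \<subseteq> J"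
begin

definition Fmax :: "'a set \<Rightarrow> 'a set \<Rightarrow> bool"
  where "Fmax H V \<longleftrightarrow> V \<in> \<F> \<and> V \<subseteq> H \<and> (\<forall>W\<in>\<F>. W \<subseteq> H \<longrightarrow> V \<subseteq> W \<longrightarrow> W = V)"

definition is_injector :: "'a set \<Rightarrow> 'a set \<Rightarrow> bool"
  where "is_injector H V \<longleftrightarrow> sub V \<and> V \<subseteq> H \<and> (\<forall>K. subnormal_in K H \<longrightarrow> Fmax K (V \<inter> K))"

lemma FmaxD:
  assumes "Fmax H V"
  shows "V \<in> \<F>" "V \<subseteq> H" "\<And>W. W \<in> \<F> \<Longrightarrow> W \<subseteq> H \<Longrightarrow> V \<subseteq> W \<Longrightarrow> W = V" "sub V"
  using assms F_sub unfolding Fmax_def by blast+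

lemma Fmax_exists:
  assumes "sub H" "U \<in> \<F>" "U \<subseteq> H"
  shows "\<exists>V. Fmax H V \<and> U \<subseteq> V"
proof -
  let ?P = "\<lambda>V. V \<in> \<F> \<and> U \<subseteq> V \<and> V \<subseteq> H"
  have "\<forall>V. ?P V \<longrightarrow> card V < Suc (card H)"
    using card_mono[OF sub_fin[OF assms(1)]] by (auto simp: less_Suc_eq_le)
  then obtain V where V: "?P V" and max: "\<And>W. ?P W \<Longrightarrow> card W \<le> card V"
    using ex_has_greatest_nat[of ?P U card "Suc (card H)"] assms by blast
  have "W = V" if "W \<in> \<F>" "W \<subseteq> H" "V \<subseteq> W" for W
  proof -
    have "card W \<le> card V" using max that V by blast
    then show ?thesis using card_seteq[OF sub_fin[OF F_sub[OF that(1)]] that(3)] by simp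
  qed
  then show ?thesis using V unfolding Fmax_def by blast
qed

lemma Fmax_cj:
  assumes "Fmax H V" "x \<in> carrier G" "sub H"
  shows "Fmax (cj x H) (cj x V)"
  unfolding Fmax_def
proof (intro conjI ballI impI)
  note V = FmaxD[OF assms(1)]
  show "cj x V \<in> \<F>" using F_cj[OF V(1) assms(2)] .
  show "cj x V \<subseteq> cj x H" using cj_mono[OF V(2)] .
  fix W assume W: "W \<in> \<F>" "W \<subseteq> cj x H" "cj x V \<subseteq> W"
  have "cj (inv x) W = V"
  proof (rule V(3))
    show "cj (inv x) W \<in> \<F>" using F_cj[OF W(1)] assms(2) by simp
    show "cj (inv x) W \<subseteq> H" using cj_mono[OF W(2), of "inv x"] assms(2) sub_carrier[OF assms(3)] by simp
    show "V \<subseteq> cj (inv x) W" using cj_mono[OF W(3), of "inv x"] assms(2) sub_carrier[OF V(4)] by simp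
  qed
  then show "W = cj x V" using cj_inv_cancel(2)[OF assms(2) sub_carrier[OF F_sub[OF W(1)]]] by simp
qed

lemma is_injector_cj:
  assumes "is_injector H V" "x \<in> carrier G" "sub H"
  shows "is_injector (cj x H) (cj x V)"
  unfolding is_injector_def
proof (intro conjI allI impI)
  have V: "sub V" "V \<subseteq> H" "\<And>K. subnormal_in K H \<Longrightarrow> Fmax K (V \<inter> K)" using assms(1) unfolding is_injector_def by blast+
  show "sub (cj x V)" using sub_cj[OF assms(2) V(1)] .
  show "cj x V \<subseteq> cj x H" using cj_mono[OF V(2)] .
  fix K assume K: "subnormal_in K (cj x H)"
  then have sK: "sub K" unfolding subnormal_in_def by blast
  have "subnormal_in (cj (inv x) K) H" using subnormal_in_cj[OF K, of "inv x"] assms(2) sub_carrier[OF assms(3)] by simp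
  then have "Fmax (cj (inv x) K) (V \<inter> cj (inv x) K)" "sub (cj (inv x) K)"
    using V(3) unfolding subnormal_in_def by blast+
  then have "Fmax (cj x (cj (inv x) K)) (cj x (V \<inter> cj (inv x) K))" using Fmax_cj assms(2) by blast
  moreover have "cj x (V \<inter> cj (inv x) K) = cj x V \<inter> K"
    using cj_Int[OF assms(2) sub_carrier[OF V(1)] cj_carrier[OF inv_closed[OF assms(2)] sub_carrier[OF sK]]]
      assms(2) sub_carrier[OF sK] by simp
  ultimately show "Fmax K (cj x V \<inter> K)" using assms(2) sub_carrier[OF sK] by simp
qed

lemma is_injector_subnormal:
  assumes "is_injector H V" "subnormal_in K H"
  shows "is_injector K (V \<inter> K)"
proof -
  have "Fmax L (V \<inter> K \<inter> L)" if L: "subnormal_in L K" for L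
  proof -
    have "V \<inter> K \<inter> L = V \<inter> L" using subnormal_in_subset[OF L] by blast
    then show ?thesis using subnormal_in_trans[OF L assms(2)] assms(1) unfolding is_injector_def by simp
  qed
  then show ?thesis using assms sub_Int unfolding is_injector_def subnormal_in_def by blast
qed

lemma is_injector_Fmax:
  assumes "is_injector H V" "sub H"
  shows "Fmax H V"
proof -
  have "V \<inter> H = V" using assms(1) unfolding is_injector_def by blast
  then show ?thesis using assms(1) subnormal_in_self[OF assms(2)] unfolding is_injector_def by metis
qed

lemma F_Int_nml:
  assumes "V \<in> \<F>" "V \<subseteq> H" "nml K H"
  shows "V \<inter> K \<in> \<F>"
  using F_nml[OF assms(1), of "V \<inter> K"] nml_Int_sub[OF assms(3) F_sub[OF assms(1)] assms(2)] by (simp add: Int_commute)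

text \<open>\<open>V \<inter> K\<close> belongs to \<F>, being normal in V, and it contains the
  maximal member W.\<close>

lemma Fmax_Int_eq:
  assumes "Fmax K W" "V \<in> \<F>" "W \<subseteq> V" "V \<subseteq> H" "nml K H"
  shows "V \<inter> K = W"
proof -
  have "W \<subseteq> V \<inter> K" using assms(3) FmaxD(2)[OF assms(1)] by blast
  then show ?thesis using FmaxD(3)[OF assms(1) F_Int_nml[OF assms(2,4,5)]] by simp
qed

lemma Fmax_unique:
  assumes "\<rho> \<in> \<A>" "nml W J" "pi_number \<rho> (idx J W)" "J \<subseteq> H"
    and "Fmax H S" "Fmax H T" "W \<subseteq> S" "W \<subseteq> T" "S \<subseteq> J" "T \<subseteq> J"
  shows "S = T"
proof -
  obtain V where "V \<in> \<F>" "S \<subseteq> V" "T \<subseteq> V" "V \<subseteq> J"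
    using F_join[OF assms(1-3) FmaxD(1)[OF assms(5)] FmaxD(1)[OF assms(6)] assms(7-10)] by blast
  then show ?thesis using FmaxD(3)[OF assms(5), of V] FmaxD(3)[OF assms(6), of V] assms(4) by blast
qed

text \<open>Two maximal members above W are moved into one Hall \<rho>-subgroup over W of the
  normalizer of W. There \<open>F_join\<close> leaves room for only one maximal member.\<close>

lemma Fmax_over_conj:
  assumes "nml K H" "\<rho> \<in> \<A>" "pi_number \<rho> (idx H K)" "Fmax K W"
    and V1: "Fmax H V1" "W \<subseteq> V1" and V2: "Fmax H V2" "W \<subseteq> V2"
  shows "\<exists>k\<in>K. cj k V1 = V2"
proof -
  note K = nmlD[OF assms(1)] and W = FmaxD[OF assms(4)]
  have WH: "W \<subseteq> H" using W(2) K(3) by blast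
  \<comment> \<open>V1 and V2 both lie in X, because W is the intersection of each with the normal
    subgroup K.\<close>
  define X where "X = normalizer_in H W"
  have X: "sub X" "X \<subseteq> H" "nml W X"
    unfolding X_def using normalizer_in_sub[OF K(2) sub_carrier[OF W(4)]] normalizer_in_subset
      normalizer_in_nml[OF K(2) W(4) WH] .
  have sub_part: "V \<subseteq> X \<and> pi_number \<rho> (idx V W)" if V: "Fmax H V" "W \<subseteq> V" for V
  proof
    note V' = FmaxD[OF V(1)]
    have e: "V \<inter> K = W" using Fmax_Int_eq[OF assms(4) V'(1) V(2) V'(2) assms(1)] .
    have "nml (K \<inter> V) V" using nml_Int_sub[OF assms(1) V'(4,2)] .
    then have "normalizes V W" using nmlD(4) e by (metis Int_commute)
    then show "V \<subseteq> X" unfolding X_def using normalizes_iff_normalizer_in[OF V'(2)] by blast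
    show "pi_number \<rho> (idx V W)"
      using idx_Int_dvd[OF assms(1) V'(4,2)] e assms(3) pi_number_dvd by metis
  qed
  obtain T where T: "hall \<rho> W X T"
    and con: "\<And>L. sub L \<Longrightarrow> W \<subseteq> L \<Longrightarrow> L \<subseteq> X \<Longrightarrow> pi_number \<rho> (idx L W) \<Longrightarrow> \<exists>h\<in>X. cj h L \<subseteq> T"
    using dominates[OF X(3) assms(2)] unfolding hall_dominates_def by blast
  note T = hallD[OF T]
  have nT: "nml W T" using nml_restrict[OF X(3) T(1-3)] .
  have TH: "T \<subseteq> H" using T(3) X(2) by blast
  define C where "C = K \<inter> X"
  have C: "nml C X" unfolding C_def using nml_Int_sub[OF assms(1) X(1,2)] .
  have "pi_number \<rho> (idx X C)"
    unfolding C_def using idx_Int_dvd[OF assms(1) X(1,2)] assms(3) pi_number_dvd by (metis Int_commute)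
  \<comment> \<open>Conjugation by the T-part keeps a subgroup inside T, so the conjugating elements
    can be chosen in C and hence in K.\<close>
  then have CT: "C <#> T = X"
    using T(5) normal_set_mult_sub(1)[OF C T(1,3)]
    by (intro idx_coprime_set_mult[OF nmlD(1)[OF C] T(1) X(1) _ nmlD(3)[OF C] T(3)]
        pi_number_coprime[of \<rho> _ "- \<rho>"]) auto
  have cjX: "W \<subseteq> cj h V" "Fmax H (cj h V)" if V: "Fmax H V" "W \<subseteq> V" and h: "h \<in> X" for h V
  proof -
    have hc: "h \<in> carrier G" "h \<in> H" using h X(2) sub_memD(1)[OF K(2)] by blast+
    show "W \<subseteq> cj h V" using cj_mono[OF V(2), of h] nmlD(5)[OF X(3) h] by simp
    show "Fmax H (cj h V)" using Fmax_cj[OF V(1) hc(1) K(2)] cj_self[OF K(2) hc(2)] by simp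
  qed
  have to_T: "\<exists>c\<in>C. cj c V \<subseteq> T \<and> Fmax H (cj c V) \<and> W \<subseteq> cj c V" if V: "Fmax H V" "W \<subseteq> V" for V
  proof -
    obtain h where h: "h \<in> X" "cj h V \<subseteq> T"
      using con[OF FmaxD(4)[OF V(1)] V(2)] sub_part[OF V] by blast
    obtain c t where ct: "c \<in> C" "t \<in> T" "h = c \<otimes> t" using h(1) CT set_mult_mem[of h C T] by blast
    have cX: "c \<in> X" "c \<in> carrier G" "t \<in> carrier G"
      using ct nmlD(3)[OF C] sub_memD(1)[OF X(1)] sub_memD(1)[OF T(1)] by blast+
    have "cj h V = cj t (cj c V)" unfolding ct(3) using cX sub_carrier[OF FmaxD(4)[OF V(1)]] by (simp add: cj_mult)
    then have "cj (inv t) (cj h V) = cj c V" using cX cj_carrier sub_carrier[OF FmaxD(4)[OF V(1)]] by simp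
    moreover have "cj (inv t) (cj h V) \<subseteq> T" using cj_subset_sub[OF T(1) sub_memD(2)[OF T(1) ct(2)] h(2)] .
    ultimately have "cj c V \<subseteq> T" by simp
    then show ?thesis using ct(1) cjX[OF V cX(1)] by blast
  qed
  obtain c1 where c1: "c1 \<in> C" "cj c1 V1 \<subseteq> T" "Fmax H (cj c1 V1)" "W \<subseteq> cj c1 V1" using to_T[OF V1] by blast
  obtain c2 where c2: "c2 \<in> C" "cj c2 V2 \<subseteq> T" "Fmax H (cj c2 V2)" "W \<subseteq> cj c2 V2" using to_T[OF V2] by blast
  have e: "cj c1 V1 = cj c2 V2"
    by (rule Fmax_unique[OF assms(2) nT T(4) TH c1(3) c2(3) c1(4) c2(4) c1(2) c2(2)])
  have cK: "c1 \<in> K" "c2 \<in> K" using c1(1) c2(1) unfolding C_def by blast+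
  then have cc: "c1 \<in> carrier G" "c2 \<in> carrier G" using sub_memD(1)[OF K(1)] by blast+
  have "cj (c1 \<otimes> inv c2) V1 = cj (inv c2) (cj c2 V2)"
    unfolding e[symmetric] using cc sub_carrier[OF FmaxD(4)[OF V1(1)]] by (simp add: cj_mult)
  also have "\<dots> = V2" using cc sub_carrier[OF FmaxD(4)[OF V2(1)]] by simp
  finally show ?thesis using cK sub_memD[OF K(1)] by blast
qed

text \<open>Aligning the two injectors on K by uniqueness there reduces the claim to
  \<open>Fmax_over_conj\<close>.\<close>

lemma is_injector_conj_over:
  assumes "nml K H" "\<rho> \<in> \<A>" "pi_number \<rho> (idx H K)"
    and uniq: "\<And>V W. is_injector K V \<Longrightarrow> is_injector K W \<Longrightarrow> \<exists>k\<in>K. cj k V = W"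
    and "is_injector H V" "is_injector H W"
  shows "\<exists>k\<in>K. cj k V = W"
proof -
  note K = nmlD[OF assms(1)]
  note s = subnormal_in_nml[OF assms(1)]
  have i: "is_injector K (V \<inter> K)" "is_injector K (W \<inter> K)" using is_injector_subnormal assms(5,6) s by blast+
  obtain k where k: "k \<in> K" "cj k (V \<inter> K) = W \<inter> K" using uniq[OF i] by blast
  have kc: "k \<in> carrier G" "k \<in> H" using k K(3) sub_memD(1)[OF K(2)] by blast+
  have V: "sub V" "sub W" using assms(5,6) unfolding is_injector_def by blast+
  have ik: "is_injector H (cj k V)" using is_injector_cj[OF assms(5) kc(1) K(2)] cj_self[OF K(2) kc(2)] by simp
  have "W \<inter> K \<subseteq> cj k V" using k(2) cj_mono[of "V \<inter> K" V k] by blast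
  then obtain k' where k': "k' \<in> K" "cj k' (cj k V) = W"
    using Fmax_over_conj[OF assms(1-3) is_injector_Fmax[OF i(2) K(1)] is_injector_Fmax[OF ik K(2)] _ is_injector_Fmax[OF assms(6) K(2)]] by blast
  then have "cj (k \<otimes> k') V = W" using cj_mult[OF kc(1) sub_memD(1)[OF K(1) k'(1)] sub_carrier[OF V(1)]] by simp
  then show ?thesis using sub_memD(3)[OF K(1) k(1) k'(1)] by blast
qed

text \<open>Takes the first non-trivial step of a chain from H to W; the induction skips steps that
  stand still.\<close>

lemma maximal_atom_quotient:
  assumes "nml W H" "W \<noteq> H"
  shows "\<exists>M \<rho>. nml M H \<and> W \<subseteq> M \<and> M \<noteq> H \<and> \<rho> \<in> \<A> \<and> pi_number \<rho> (idx H M)"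
proof -
  have "N \<noteq> W \<longrightarrow> (\<exists>M. chain_step \<A> H N M \<and> M \<noteq> N \<and> W \<subseteq> M)" if "(chain_step \<A> H)\<^sup>*\<^sup>* N W" for N
    using that
  proof (induction rule: converse_rtranclp_induct)
    case (step N M)
    show ?case
    proof (cases "M = N")
      case False
      then show ?thesis using step(1) chain_subset[OF step(2)] by blast
    qed (use step in blast)
  qed simp
  from this[OF chain_exists[OF assms(1) nml_self[OF nmlD(2)[OF assms(1)]] nmlD(3)[OF assms(1)]]]
  obtain M where "chain_step \<A> H H M" "M \<noteq> H" "W \<subseteq> M" using assms(2) by blast
  then show ?thesis unfolding chain_step_def by blast
qed

text \<open>Y and a conjugate of it inside T are both maximal members in M, and within T \<inter> M
  they have a common upper bound in \<F>.\<close>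

lemma Fmax_weakly_closed:
  assumes "\<rho> \<in> \<A>" "nml U X" "nml M H" "X \<subseteq> H" "Fmax M Y" "U \<subseteq> Y" "Y \<subseteq> X"
  shows "weakly_closed \<rho> U X Y"
  unfolding weakly_closed_def
proof (intro ballI allI impI)
  fix x T assume x: "x \<in> X" and T: "sub T" "U \<subseteq> T" "T \<subseteq> X" "pi_number \<rho> (idx T U)" "Y \<subseteq> T" "cj x Y \<subseteq> T"
  note M = nmlD[OF assms(3)] and Y = FmaxD[OF assms(5)]
  have xH: "x \<in> H" "x \<in> carrier G" using x assms(4) sub_memD(1)[OF M(2)] by blast+
  have fx: "Fmax M (cj x Y)" using Fmax_cj[OF assms(5) xH(2) M(1)] M(5)[OF xH(1)] by simp
  have Ux: "U \<subseteq> cj x Y" using cj_mono[OF assms(6), of x] nmlD(5)[OF assms(2) x] by simp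
  have UM: "U \<subseteq> T \<inter> M" "Y \<subseteq> T \<inter> M" "cj x Y \<subseteq> T \<inter> M"
    using T(2,5,6) assms(6) Y(2) FmaxD(2)[OF fx] by blast+
  have sTM: "sub (T \<inter> M)" using sub_Int[OF T(1) M(1)] .
  have sU: "sub U" using nmlD(1)[OF assms(2)] .
  have "nml U (T \<inter> M)" using nml_restrict[OF assms(2) sTM UM(1)] T(3) by blast
  moreover have "pi_number \<rho> (idx (T \<inter> M) U)"
    using idx_dvd_r[OF T(1) sTM sU UM(1)] T(4) pi_number_dvd by blast
  ultimately show "cj x Y = Y"
    using Fmax_unique[OF assms(1) _ _ _ assms(5) fx assms(6) Ux UM(2,3)] by blast
qed

theorem injectors_exist_conj:
  "sub H \<Longrightarrow> (\<exists>V. is_injector H V) \<and> (\<forall>V W. is_injector H V \<longrightarrow> is_injector H W \<longrightarrow> (\<exists>h\<in>H. cj h V = W))"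
proof (induction "card H" arbitrary: H rule: less_induct)
  case less
  note H = less(2)
  show ?case
  proof (cases "H = {\<one>}")
    case True
    have "K = {\<one>}" if "subnormal_in K H" for K
      using that subnormal_in_subset[OF that] one_in True unfolding subnormal_in_def by blast
    then have "is_injector H {\<one>}"
      using F_one one_in F_sub triv_subgroup True unfolding is_injector_def Fmax_def by fastforce
    moreover have "V = {\<one>}" if "is_injector H V" for V
      using that one_in True unfolding is_injector_def by blast
    ultimately show ?thesis using cj_one True by (metis one_in H sub_carrier)
  next
    case False
    obtain K \<sigma> where K: "nml K H" "K \<noteq> H" "\<sigma> \<in> \<A>" "pi_number \<sigma> (idx H K)"
      using maximal_atom_quotient[OF nml_one[OF H]] False by blast
    note K' = nmlD[OF K(1)]
    have smaller: "card M < card H" if "nml M H" "M \<noteq> H" for M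
      using nmlD(3)[OF that(1)] that(2) sub_fin[OF H] by (intro psubset_card_mono) auto
    have ex: "\<exists>V. is_injector M V" and uniq: "\<And>V W. is_injector M V \<Longrightarrow> is_injector M W \<Longrightarrow> \<exists>h\<in>M. cj h V = W"
      if "sub M" "card M < card H" for M
      using less(1)[OF that(2,1)] by blast+
    obtain W where W: "is_injector K W" using ex[OF K'(1) smaller[OF K(1,2)]] by blast
    have FW: "Fmax K W" using is_injector_Fmax[OF W K'(1)] .
    have WH: "W \<subseteq> H" using FmaxD(2)[OF FW] K'(3) by blast
    obtain V where V: "Fmax H V" "W \<subseteq> V" using Fmax_exists[OF H FmaxD(1)[OF FW] WH] by blast
    note V' = FmaxD[OF V(1)]
    have VK: "V \<inter> K = W" using Fmax_Int_eq[OF FW V'(1) V(2) V'(2) K(1)] .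
    have part: "is_injector M (V \<inter> M)" if M: "nml M H" "M \<noteq> H" "\<rho> \<in> \<A>" "pi_number \<rho> (idx H M)" for M \<rho>
    proof -
      note M' = nmlD[OF M(1)]
      define D where "D = M \<inter> K"
      have D: "nml D H" unfolding D_def using nml_Int[OF M(1) K(1)] .
      note D' = nmlD[OF D]
      have DM: "D \<subseteq> M" and DK: "D \<subseteq> K" unfolding D_def by blast+
      have nDM: "nml D M" and nDK: "nml D K"
        using nml_restrict[OF D M'(1) DM M'(3)] nml_restrict[OF D K'(1) DK K'(3)] .
      have iMD: "pi_number \<sigma> (idx M D)"
        unfolding D_def using idx_Int_dvd[OF K(1) M'(1,3)] K(4) pi_number_dvd by blast
      have iKD: "pi_number \<rho> (idx K D)"
        unfolding D_def using idx_Int_dvd[OF M(1) K'(1,3)] M(4) pi_number_dvd by (metis Int_commute)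
      have cD: "card D < card H" using smaller[OF M(1,2)] card_mono[OF sub_fin[OF M'(1)] DM] by simp
      define U where "U = V \<inter> D"
      have U: "U = W \<inter> M" "U = W \<inter> D" unfolding U_def D_def using VK by blast+
      have iU: "is_injector D U" unfolding U(2) using is_injector_subnormal[OF W subnormal_in_nml[OF nDK]] .
      have FU: "Fmax D U" using is_injector_Fmax[OF iU D'(1)] .
      have sU: "sub U" "U \<subseteq> H" using FmaxD(4)[OF FU] FmaxD(2)[OF FU] D'(3) by blast+
      obtain Y0 where Y0: "is_injector M Y0" using ex[OF M'(1) smaller[OF M(1,2)]] by blast
      \<comment> \<open>Injectors of D are conjugate under D, so an injector of M can be chosen to
        meet D in the same subgroup U as V does.\<close>
      obtain y where y: "y \<in> D" "cj y (Y0 \<inter> D) = U"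
        using uniq[OF D'(1) cD is_injector_subnormal[OF Y0 subnormal_in_nml[OF nDM]] iU] by blast
      define Y where "Y = cj y Y0"
      have yM: "y \<in> M" "y \<in> carrier G" using y DM sub_memD(1)[OF M'(1)] by blast+
      have Y: "is_injector M Y" unfolding Y_def using is_injector_cj[OF Y0 yM(2) M'(1)] cj_self[OF M'(1) yM(1)] by simp
      have FY: "Fmax M Y" using is_injector_Fmax[OF Y M'(1)] .
      note Y' = FmaxD[OF FY]
      have UY: "U \<subseteq> Y" unfolding Y_def y(2)[symmetric] by (rule cj_mono) blast
      have YD: "Y \<inter> D = U" using Fmax_Int_eq[OF FU Y'(1) UY Y'(2) nDM] .
      have YH: "Y \<subseteq> H" using Y'(2) M'(3) by blast
      \<comment> \<open>It suffices to find an \<F>-maximal subgroup of H that is H-conjugate to V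
        and lies above an H-conjugate of Y: it meets M in that conjugate, and M is normal.\<close>
      have conclude: "is_injector M (V \<inter> M)"
        if V2: "Fmax H V2" "Y2 \<subseteq> V2" "Y2 = cj z Y" "z \<in> H" "cj k V2 = V" "k \<in> H" for V2 Y2 z k
      proof -
        have c: "z \<in> carrier G" "k \<in> carrier G" using that sub_memD(1)[OF H] by blast+
        have iY2: "is_injector M Y2" unfolding V2(3) using is_injector_cj[OF Y c(1) M'(1)] M'(5)[OF V2(4)] by simp
        have "V2 \<inter> M = Y2"
          using Fmax_Int_eq[OF is_injector_Fmax[OF iY2 M'(1)] FmaxD(1)[OF V2(1)] V2(2) FmaxD(2)[OF V2(1)] M(1)] .
        then have "cj k Y2 = V \<inter> M"
          using cj_Int[OF c(2) sub_carrier[OF FmaxD(4)[OF V2(1)]] sub_carrier[OF M'(1)]] V2(5) M'(5)[OF V2(6)] by simp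
        then show ?thesis using is_injector_cj[OF iY2 c(2) M'(1)] M'(5)[OF V2(6)] by simp
      qed
      show ?thesis
      proof (cases "\<rho> = \<sigma>")
        case True
        \<comment> \<open>With equal atoms H/D is a \<rho>-group, so V and any maximal member above
          Y are conjugate under D, as both contain U.\<close>
        obtain V2 where V2: "Fmax H V2" "Y \<subseteq> V2" using Fmax_exists[OF H Y'(1) YH] by blast
        have iHD: "pi_number \<rho> (idx H D)"
          using idx_trans[OF H M'(1) D'(1) DM M'(3)] M(4) iMD True by (simp add: pi_number_mult_iff)
        have "U \<subseteq> V2" "U \<subseteq> V" using UY V2(2) unfolding U_def by blast+
        then obtain k where k: "k \<in> D" "cj k V2 = V"
          using Fmax_over_conj[OF D M(3) iHD FU V2(1) _ V(1)] by blast
        have "Y = cj \<one> Y" using cj_one[OF sub_carrier[OF Y'(4)]] by simp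
        then show ?thesis using conclude[OF V2 _ one_in[OF H] k(2)] k(1) D'(3) by blast
      next
        case False
        \<comment> \<open>W and Y both meet D in U, so they normalize U; inside X they play the
          roles of P and Q of \<open>commuting_conjugate\<close>.\<close>
        define X where "X = normalizer_in H U"
        have X: "sub X" "X \<subseteq> H" "nml U X"
          unfolding X_def using normalizer_in_sub[OF H sub_carrier[OF sU(1)]] normalizer_in_subset
            normalizer_in_nml[OF H sU] .
        have WD: "W \<inter> D = U" using U by simp
        have normU: "Z \<subseteq> X" if "nml (Z \<inter> D) Z" "Z \<inter> D = U" "Z \<subseteq> H" for Z
          unfolding X_def using that normalizes_iff_normalizer_in[OF that(3)] nmlD(4) by metis
        have YX: "Y \<subseteq> X" using normU[OF _ YD YH] nml_Int_sub[OF nDM Y'(4,2)] by (simp add: Int_commute)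
        have WX: "W \<subseteq> X" using normU[OF _ WD WH] nml_Int_sub[OF nDK FmaxD(4)[OF FW] FmaxD(2)[OF FW]] by (simp add: Int_commute)
        have nX: "nml (M \<inter> X) X" "nml (K \<inter> X) X" using nml_Int_sub[OF M(1) X(1,2)] nml_Int_sub[OF K(1) X(1,2)] .
        have UMK: "U \<subseteq> (M \<inter> X) \<inter> (K \<inter> X)" using nmlD(3)[OF X(3)] FmaxD(2)[OF FU] unfolding D_def by blast
        have Y1: "Y \<subseteq> M \<inter> X" "Y \<inter> (K \<inter> X) = U" using Y'(2) YX YD UY UMK unfolding D_def by blast+
        have W1: "W \<subseteq> K \<inter> X" "W \<inter> (M \<inter> X) = U" using FmaxD(2)[OF FW] WX U(1) by blast+
        have UW: "U \<subseteq> W" using U(1) by blast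
        have iY: "pi_number \<sigma> (idx Y U)"
          using idx_Int_dvd[OF nDM Y'(4,2)] YD iMD pi_number_dvd by metis
        have iW: "pi_number \<rho> (idx W U)"
          using idx_Int_dvd[OF nDK FmaxD(4)[OF FW] FmaxD(2)[OF FW]] WD iKD pi_number_dvd by metis
        obtain d where d: "d \<in> X" "commutes_mod U W (cj d Y)"
          using commuting_conjugate[OF X(3) nX(2,1) _ M(3) K(3) False FmaxD(4)[OF FW] UW W1 iW
              Fmax_weakly_closed[OF M(3) X(3) K(1) X(2) FW UW WX]
              Y'(4) UY Y1 iY Fmax_weakly_closed[OF K(3) X(3) M(1) X(2) FY UY YX]] UMK by blast
        have dH: "d \<in> H" "d \<in> carrier G" using d X(2) sub_memD(1)[OF H] by blast+
        define Y2 where "Y2 = cj d Y"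
        have Y2: "Y2 \<in> \<F>" "sub Y2" "Y2 \<subseteq> H" "U \<subseteq> Y2" "Y2 \<subseteq> X"
          unfolding Y2_def using F_cj[OF Y'(1) dH(2)] sub_cj[OF dH(2) Y'(4)] cj_subset_sub[OF H dH(1) YH]
            cj_mono[OF UY, of d] nmlD(5)[OF X(3) d(1)] cj_subset_sub[OF X(1) d(1) YX] by auto
        have com: "commutes_mod U W Y2" using d(2) unfolding Y2_def .
        have sW: "sub W" using FmaxD(4)[OF FW] .
        have "U <#> W = W" "U <#> Y2 = Y2" using set_mult_absorb2 sU(1) sW UW Y2(2,4) by blast+
        \<comment> \<open>U is absorbed by W and by Y2, so commuting modulo U means that the two
          normalize each other and can be multiplied in \<F>.\<close>
        then have n: "normalizes Y2 W" "normalizes W Y2"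
          using commutes_mod_normalizes[OF X(3) sW WX Y2(2,5) com]
            commutes_mod_normalizes[OF X(3) Y2(2,5) sW WX commutes_mod_sym[OF sW Y2(2) sU(1) com]] by simp_all
        have WY: "W <#> Y2 \<in> \<F>" using F_prod[OF FmaxD(1)[OF FW] Y2(1) n] .
        have up: "W \<subseteq> W <#> Y2" "Y2 \<subseteq> W <#> Y2" "W <#> Y2 \<subseteq> H"
          using set_mult_upper[OF sW Y2(2)] set_mult_least[OF H WH Y2(3)] .
        obtain V2 where V2: "Fmax H V2" "W <#> Y2 \<subseteq> V2" using Fmax_exists[OF H WY up(3)] by blast
        have V2': "W \<subseteq> V2" "Y2 \<subseteq> V2" using up V2(2) by blast+
        obtain k where k: "k \<in> K" "cj k V2 = V"
          using Fmax_over_conj[OF K(1,3,4) FW V2(1) V2'(1) V] by blast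
        show ?thesis using conclude[OF V2(1) V2'(2) Y2_def dH(1) k(2)] k(1) K'(3) by blast
      qed
    qed
    have "is_injector H V"
      unfolding is_injector_def
    proof (intro conjI allI impI V'(4,2))
      fix L assume L: "subnormal_in L H"
      show "Fmax L (V \<inter> L)"
      proof (cases "L = H")
        case True
        then show ?thesis using V(1) V'(2) by (simp add: Int_absorb2)
      next
        case False
        then obtain M1 where M1: "nml M1 H" "M1 \<noteq> H" "subnormal_in L M1" using subnormal_in_proper[OF L] by blast
        \<comment> \<open>A proper subnormal subgroup lies in a proper normal one, which is enlarged
          to a normal subgroup with atomic quotient so that \<open>part\<close> applies.\<close>
        obtain M \<rho> where M: "nml M H" "M1 \<subseteq> M" "M \<noteq> H" "\<rho> \<in> \<A>" "pi_number \<rho> (idx H M)"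
          using maximal_atom_quotient[OF M1(1,2)] by blast
        have "nml M1 M" using nml_restrict[OF M1(1) nmlD(1)[OF M(1)] M(2) nmlD(3)[OF M(1)]] .
        then have LM: "subnormal_in L M" using subnormal_in_trans[OF M1(3) subnormal_in_nml] by blast
        have "V \<inter> M \<inter> L = V \<inter> L" using subnormal_in_subset[OF LM] by blast
        then show ?thesis using part[OF M(1,3,4,5)] LM unfolding is_injector_def by metis
      qed
    qed
    moreover have "\<exists>h\<in>H. cj h V = W" if "is_injector H V" "is_injector H W" for V W
      using is_injector_conj_over[OF K(1,3,4) uniq[OF K'(1) smaller[OF K(1,2)]] that] K'(3) by blast
    ultimately show ?thesis by blast
  qed
qed

end

section \<open>Dnormal subgroups and Fitting sets\<close>

context finite_group
begin

lemma pi_group_Mod_iff: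
  assumes "nml N H"
  shows "pi_group \<rho> (G\<lparr>carrier := H\<rparr> Mod N) \<longleftrightarrow> pi_number \<rho> (idx H N)"
proof -
  note N = nmlD[OF assms]
  interpret Q: finite_group "G\<lparr>carrier := H\<rparr> Mod N" by (rule quotient_correspondence(1)[OF assms])
  have "card (carrier (G\<lparr>carrier := H\<rparr> Mod N)) = idx H N"
    using quotient_correspondence(2)[OF assms N(2,3)] quotient_correspondence(7)[OF assms] by simp
  then show ?thesis
    using Q.is_group Q.fin idx_pos[OF N(2,1,3)] unfolding pi_group_def pi_number_def order_def by simp
qed

lemma pi_residual_eq:
  assumes "sub H"
  shows "pi_residual \<pi> (G\<lparr>carrier := H\<rparr>) = residual \<pi> H"
  unfolding pi_residual_def
proof (rule Least_equality)
  have n: "nml (residual \<pi> H) H" using residual_nml[OF nml_self[OF assms]] .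
  show "residual \<pi> H \<lhd> G\<lparr>carrier := H\<rparr> \<and> pi_group \<pi> (G\<lparr>carrier := H\<rparr> Mod residual \<pi> H)"
    using n normal_iff_nml[OF assms] pi_group_Mod_iff[OF n] residual_index[OF assms] by blast
  fix N assume "N \<lhd> G\<lparr>carrier := H\<rparr> \<and> pi_group \<pi> (G\<lparr>carrier := H\<rparr> Mod N)"
  then have "nml N H" "pi_number \<pi> (idx H N)" using normal_iff_nml[OF assms] pi_group_Mod_iff by blast+
  then show "residual \<pi> H \<subseteq> N" by (rule residual_least)
qed

text \<open>The library normalizer uses left conjugation, so membership is compared through
  inverses.\<close>

lemma normalizer_eq:
  assumes "sub J" "H \<subseteq> J"
  shows "normalizer (G\<lparr>carrier := J\<rparr>) H = normalizer_in J H"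
proof -
  have Hc: "H \<subseteq> carrier G" using assms sub_carrier by blast
  have e: "x <# H #> inv x = cj (inv x) H" if "x \<in> J" for x
  proof -
    have "x \<in> carrier G" using that sub_memD(1)[OF assms(1)] by blast
    then show ?thesis using conj_set_eq[of "inv x" H] Hc unfolding conj_set_def by simp
  qed
  have "normalizer (G\<lparr>carrier := J\<rparr>) H = {x \<in> J. x <# H #> inv x = H}"
    unfolding normalizer_def stabilizer_def using assms m_inv_consistent[OF assms(1)] by auto
  also have "\<dots> = normalizer_in J H"
    unfolding normalizer_in_def
  proof (rule Collect_cong, rule conj_cong[OF refl])
    fix x assume x: "x \<in> J"
    then have "x \<in> carrier G" using sub_memD(1)[OF assms(1)] by blast
    then show "x <# H #> inv x = H \<longleftrightarrow> cj x H = H" unfolding e[OF x] using cj_eq_swap[of x H H] Hc by auto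
  qed
  finally show ?thesis .
qed

lemma sylow_subgroup_iff:
  "sub J \<Longrightarrow> sylow_subgroup p P (G\<lparr>carrier := J\<rparr>) \<longleftrightarrow> sub P \<and> P \<subseteq> J \<and> card P = p ^ multiplicity p (card J)"
  unfolding sylow_subgroup_def using sub_restrict by (auto simp: order_def)

lemma Npi_Dnormal_iff:
  assumes "sub J"
  shows "Npi_Dnormal \<pi> H (G\<lparr>carrier := J\<rparr>) \<longleftrightarrow> sub H \<and> H \<subseteq> J \<and>
    (\<forall>p P. sub P \<longrightarrow> P \<subseteq> J \<longrightarrow> card P = p ^ multiplicity p (card J) \<longrightarrow> card (P \<inter> H) = p ^ multiplicity p (card H) \<longrightarrow>
      (prime p \<and> p \<notin> \<pi> \<longrightarrow> normalizes P H) \<and>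
      (p \<in> \<pi> \<longrightarrow> normalizes P (if \<pi> = {p} then H else residual \<pi> H)))"
proof (cases "sub H \<and> H \<subseteq> J")
  case True
  then have H: "sub H" "H \<subseteq> J" by blast+
  have R: "residual \<pi> H \<subseteq> J" using residual_sub[OF H(1)] H(2) by blast
  have red: "sylow_reduces p P H (G\<lparr>carrier := J\<rparr>) \<longleftrightarrow> card (P \<inter> H) = p ^ multiplicity p (card H)"
    if "sub P" for p P
    unfolding sylow_reduces_def using sylow_subgroup_iff[OF H(1)] sub_Int[OF that H(1)] by simp
  have n: "P \<subseteq> normalizer (G\<lparr>carrier := J\<rparr>) A \<longleftrightarrow> normalizes P A" if "P \<subseteq> J" "A \<subseteq> J" for P A
    using normalizer_eq[OF assms that(2)] normalizes_iff_normalizer_in[OF that(1)] by simp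
  have s: "subgroup H (G\<lparr>carrier := J\<rparr>)" using H sub_restrict[OF assms] by blast
  have pr: "pi_residual \<pi> (G\<lparr>carrier := J\<rparr>\<lparr>carrier := H\<rparr>) = residual \<pi> H"
    using pi_residual_eq[OF H(1)] by simp
  show ?thesis
    unfolding Npi_Dnormal_def sylow_subgroup_iff[OF assms] pr compl_primes_def
    using s H R red n by auto
next
  case False
  then show ?thesis unfolding Npi_Dnormal_def using sub_restrict[OF assms] by blast
qed

lemma nml_imp_Dnormal:
  assumes "nml H J"
  shows "Npi_Dnormal \<pi> H (G\<lparr>carrier := J\<rparr>)"
proof -
  note H = nmlD[OF assms]
  have "normalizes P H" "normalizes P (residual \<pi> H)" if "P \<subseteq> J" for P
    using normalizes_mono[OF H(4) that] normalizes_mono[OF nmlD(4)[OF residual_nml[OF assms]] that] .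
  then show ?thesis unfolding Npi_Dnormal_iff[OF H(2)] using H(1,3) by simp
qed

text \<open>Between \<open>W\<close> and \<open>J\<close> the \<open>\<pi>\<close>-residual is constant, as all \<open>\<pi>'\<close>-elements of \<open>J\<close> lie in \<open>W\<close>.\<close>

lemma pi_quotient_Dnormal:
  assumes "nml W J" "pi_number \<pi> (idx J W)" "sub S" "W \<subseteq> S" "S \<subseteq> J" "\<And>q. \<pi> \<noteq> {q}"
  shows "Npi_Dnormal \<pi> S (G\<lparr>carrier := J\<rparr>)"
proof -
  note W = nmlD[OF assms(1)]
  have el: "x \<in> S" if "x \<in> J" "pi_number (- \<pi>) (ord x)" for x
    using pi_element_in_normal[OF assms(1,2) that] assms(4) by blast
  then have "{x \<in> S. pi_number (- \<pi>) (ord x)} = {x \<in> J. pi_number (- \<pi>) (ord x)}" using assms(5) by blast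
  then have "residual \<pi> S = residual \<pi> J" unfolding residual_def by simp
  then have n: "normalizes P (residual \<pi> S)" if "P \<subseteq> J" for P
    using normalizes_mono[OF nmlD(4)[OF residual_nml[OF nml_self[OF W(2)]]] that] by simp
  have "normalizes P S" if P: "sub P" "P \<subseteq> J" "card P = p ^ k" "prime p" "p \<notin> \<pi>" for P p k
  proof (rule normalizes_self[OF assms(3)], rule subsetI)
    fix x assume x: "x \<in> P"
    have "pi_number {p} (ord x)"
      using ord_dvd_card[OF P(1) x] P(3) pi_number_prime_powerI[OF P(4)] pi_number_dvd by metis
    then have "pi_number (- \<pi>) (ord x)" using pi_number_mono[of "{p}" _ "- \<pi>"] P(5) by blast
    then show "x \<in> S" using el x P(2) by blast
  qed
  then show ?thesis unfolding Npi_Dnormal_iff[OF W(2)] using assms(3,5,6) n by metis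
qed

lemma generate_union:
  assumes "sub S" "sub T"
  shows "sub (generate G (S \<union> T))" "S \<subseteq> generate G (S \<union> T)" "T \<subseteq> generate G (S \<union> T)"
    "sub J \<Longrightarrow> S \<subseteq> J \<Longrightarrow> T \<subseteq> J \<Longrightarrow> generate G (S \<union> T) \<subseteq> J"
proof -
  show "sub (generate G (S \<union> T))"
    by (rule generate_is_subgroup) (simp add: sub_carrier assms)
  show "S \<subseteq> generate G (S \<union> T)" "T \<subseteq> generate G (S \<union> T)"
    by (rule subsetI, rule generate.incl, simp)+
  show "generate G (S \<union> T) \<subseteq> J" if "sub J" "S \<subseteq> J" "T \<subseteq> J"
    by (rule generate_subgroup_incl[OF _ that(1)]) (use that in simp)
qed

text \<open>A largest member of \<F> above S in J is normal in J, because otherwise the growth of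
  normalizers in the p-group J/W would enlarge it; two such normal members can be multiplied. The
  closure properties are assumed explicitly, as this lemma serves to establish
  \<open>F_join\<close>.\<close>

lemma prime_quotient_join:
  assumes F_sub: "\<And>S. S \<in> \<F> \<Longrightarrow> sub S"
    and F_prod: "\<And>S T. S \<in> \<F> \<Longrightarrow> T \<in> \<F> \<Longrightarrow> normalizes T S \<Longrightarrow> normalizes S T \<Longrightarrow> S <#> T \<in> \<F>"
    and F_cj: "\<And>S x. S \<in> \<F> \<Longrightarrow> x \<in> carrier G \<Longrightarrow> cj x S \<in> \<F>"
    and J: "nml W J" "prime p" "pi_number {p} (idx J W)"
    and "S \<in> \<F>" "T \<in> \<F>" "W \<subseteq> S" "W \<subseteq> T" "S \<subseteq> J" "T \<subseteq> J"
  shows "\<exists>V\<in>\<F>. S \<subseteq> V \<and> T \<subseteq> V \<and> V \<subseteq> J"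
proof -
  note W = nmlD[OF J(1)] and Jm = sub_memD[OF nmlD(2)[OF J(1)]]
  have normal: "\<exists>V\<in>\<F>. S \<subseteq> V \<and> V \<subseteq> J \<and> normalizes J V" if S: "S \<in> \<F>" "W \<subseteq> S" "S \<subseteq> J" for S
  proof -
    let ?P = "\<lambda>V. V \<in> \<F> \<and> S \<subseteq> V \<and> V \<subseteq> J"
    have "\<forall>V. ?P V \<longrightarrow> card V < Suc (card J)"
      using card_mono[OF sub_fin[OF W(2)]] by (auto simp: less_Suc_eq_le)
    then obtain V where V: "?P V" and max: "\<And>U. ?P U \<Longrightarrow> card U \<le> card V"
      using ex_has_greatest_nat[of ?P S card "Suc (card J)"] S by blast
    have sV: "sub V" "V \<subseteq> carrier G" using V F_sub sub_carrier by blast+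
    define X where "X = normalizer_in J V"
    have VJ: "V \<subseteq> J" using V by blast
    have X: "sub X" "X \<subseteq> J" "nml V X"
      unfolding X_def using normalizer_in_sub[OF W(2) sV(2)] normalizer_in_subset
        normalizer_in_nml[OF W(2) sV(1) VJ] .
    have "X = J"
    proof (rule ccontr)
      assume "X \<noteq> J"
      have "W \<subseteq> X" using S(2) V nmlD(3)[OF X(3)] by blast
      \<comment> \<open>x normalizes X but not V, so V and its x-conjugate are two different normal
        subgroups of X and their product is a larger member of \<F>.\<close>
      then obtain x where x: "x \<in> J" "x \<notin> X" "cj x X = X"
        using normalizer_growth[OF J X(1) _ X(2) \<open>X \<noteq> J\<close>] by blast
      have xc: "x \<in> carrier G" using Jm x(1) by blast
      have sU: "sub (cj x V)" using sub_cj[OF xc sV(1)] .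
      have "normalizes (cj x X) (cj x V)"
        using normalizes_cj[OF nmlD(4)[OF X(3)] xc sV(2) sub_carrier[OF X(1)]] .
      then have n1: "normalizes V (cj x V)" using x(3) nmlD(3)[OF X(3)] normalizes_mono by metis
      have "cj x V \<subseteq> X" using cj_mono[OF nmlD(3)[OF X(3)], of x] x(3) by simp
      then have n2: "normalizes (cj x V) V" using nmlD(4)[OF X(3)] normalizes_mono by blast
      have "V <#> cj x V \<in> \<F>" using F_prod[OF _ F_cj n2 n1] V xc by blast
      moreover have "V <#> cj x V \<subseteq> J"
        by (rule set_mult_least[OF W(2) VJ cj_subset_sub[OF W(2) x(1) VJ]])
      moreover have up: "V \<subseteq> V <#> cj x V" "cj x V \<subseteq> V <#> cj x V" using set_mult_upper[OF sV(1) sU] .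
      ultimately have "card (V <#> cj x V) \<le> card V" "finite (V <#> cj x V)"
        using max V F_sub sub_fin by (metis subset_trans)+
      then have "V <#> cj x V = V" using card_seteq up(1) by metis
      then have "cj x V = V" using cj_eqI[OF sV(1) xc] up(2) by simp
      then show False using x(1,2) unfolding X_def normalizer_in_def by blast
    qed
    then have "normalizes J V" using nmlD(4)[OF X(3)] by simp
    then show ?thesis using V by blast
  qed
  obtain V where V: "V \<in> \<F>" "S \<subseteq> V" "V \<subseteq> J" "normalizes J V" using normal[OF assms(7,9,11)] by blast
  obtain U where U: "U \<in> \<F>" "T \<subseteq> U" "U \<subseteq> J" "normalizes J U" using normal[OF assms(8,10,12)] by blast
  have s: "sub V" "sub U" using F_sub V(1) U(1) by blast+
  have "V <#> U \<in> \<F>" using F_prod[OF V(1) U(1)] normalizes_mono[OF V(4) U(3)] normalizes_mono[OF U(4) V(3)] by blast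
  moreover have "S \<subseteq> V <#> U" "T \<subseteq> V <#> U" using set_mult_upper[OF s] V(2) U(2) by blast+
  moreover have "V <#> U \<subseteq> J" by (rule set_mult_least[OF W(2) V(3) U(3)])
  ultimately show ?thesis by blast
qed

lemma subnormal_iff:
  assumes "sub H"
  shows "subnormal K (G\<lparr>carrier := H\<rparr>) \<longleftrightarrow> subnormal_in K H"
proof
  assume "subnormal K (G\<lparr>carrier := H\<rparr>)"
  then obtain k :: nat and C where C: "C 0 = K" "C k = H"
    "\<And>i. i < k \<Longrightarrow> subgroup (C i) (G\<lparr>carrier := H\<rparr>) \<and> C i \<lhd> G\<lparr>carrier := C (Suc i)\<rparr>"
    unfolding subnormal_def by auto
  have s: "sub (C i)" if "i \<le> k" for i
    using that C(2,3) assms sub_restrict[OF assms] by (cases "i = k") auto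
  have n: "nml (C i) (C (Suc i))" if "i < k" for i
    using normal_iff_nml[OF s[of "Suc i"]] C(3)[OF that] that by simp
  have "subnormal_in K (C i)" if "i \<le> k" for i
    using that
  proof (induction i)
    case 0
    then show ?case using subnormal_in_self[OF s[of 0]] C(1) by simp
  next
    case (Suc i)
    then show ?case using subnormal_in_trans[OF _ subnormal_in_nml[OF n[of i]]] by simp
  qed
  then show "subnormal_in K H" using C(2) by auto
next
  assume K: "subnormal_in K H"
  then have "nml\<^sup>*\<^sup>* K H" unfolding subnormal_in_def by blast
  then obtain k where "(nml ^^ k) K H" using rtranclp_power by metis
  then obtain C where C: "C 0 = K" "C k = H" "\<And>i. i < k \<Longrightarrow> nml (C i) (C (Suc i))"
    using relpowp_fun_conv[of k nml K H] by blast
  have up: "C i \<subseteq> H" if "i \<le> k" for i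
    using that
  proof (induction rule: inc_induct)
    case base
    then show ?case using C(2) by simp
  next
    case (step i)
    then show ?case using nmlD(3)[OF C(3)[of i]] by simp
  qed
  have "subgroup (C i) (G\<lparr>carrier := H\<rparr>) \<and> C i \<lhd> G\<lparr>carrier := H\<rparr>\<lparr>carrier := C (Suc i)\<rparr>" if i: "i < k" for i
    using sub_restrict[OF assms] up[of i] i nmlD(1,2)[OF C(3)[OF i]] normal_iff_nml[of "C (Suc i)" "C i"] C(3)[OF i]
    by simp
  then show "subnormal K (G\<lparr>carrier := H\<rparr>)" unfolding subnormal_def using C(1,2) by auto
qed

end

text \<open>The first conclusion opens the way to the injector theory; the second, inheritance by
  subgroups between W and J, is kept for intersections of injectors with Dnormal subgroups.\<close>

lemma Npi_Fitting_set_setup: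
  fixes G (structure)
  assumes "group G" "finite (carrier G)" "\<forall>p\<in>\<pi>. prime p" "pi_soluble (compl_primes \<pi>) G"
    "Npi_Fitting_set \<pi> G \<F>"
  shows "fitting_setup G (atoms \<pi>) \<F>"
    and "\<lbrakk>finite_group.nml G W J; J \<in> \<F>; pi_number \<pi> (idx J W); subgroup S G; W \<subseteq> S; S \<subseteq> J; \<And>q. \<pi> \<noteq> {q}\<rbrakk> \<Longrightarrow> S \<in> \<F>"
proof -
  interpret finite_group G using assms(1,2) by (simp add: finite_group_def finite_group_axioms_def)
  have ne: "\<F> \<noteq> {}" and F_sub: "\<And>S. S \<in> \<F> \<Longrightarrow> sub S"
    and FS1: "\<And>S T. S \<in> \<F> \<Longrightarrow> Npi_Dsubnormal \<pi> T (G\<lparr>carrier := S\<rparr>) \<Longrightarrow> T \<in> \<F>"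
    and FS2: "\<And>S T. S \<in> \<F> \<Longrightarrow> T \<in> \<F> \<Longrightarrow> Npi_Dnormal \<pi> S (G\<lparr>carrier := generate G (S \<union> T)\<rparr>) \<Longrightarrow>
      Npi_Dnormal \<pi> T (G\<lparr>carrier := generate G (S \<union> T)\<rparr>) \<Longrightarrow> generate G (S \<union> T) \<in> \<F>"
    and FS3: "\<And>S x. S \<in> \<F> \<Longrightarrow> x \<in> carrier G \<Longrightarrow> conj_set G S x \<in> \<F>"
    using assms(5) unfolding Npi_Fitting_set_def by blast+
  \<comment> \<open>A Dsubnormal chain of length one.\<close>
  have FD: "T \<in> \<F>" if S: "S \<in> \<F>" and T: "sub T" "T \<subseteq> S" "Npi_Dnormal \<pi> T (G\<lparr>carrier := S\<rparr>)" for S T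
  proof (rule FS1[OF S])
    have "subgroup T (G\<lparr>carrier := S\<rparr>)" using T sub_restrict[OF F_sub[OF S]] by blast
    then show "Npi_Dsubnormal \<pi> T (G\<lparr>carrier := S\<rparr>)"
      unfolding Npi_Dsubnormal_def
      by (intro exI[of _ "1::nat"] exI[of _ "\<lambda>i. if i = 0 then T else S"]) (use T in simp)
  qed
  show "S \<in> \<F>" if "nml W J" "J \<in> \<F>" "pi_number \<pi> (idx J W)" "sub S" "W \<subseteq> S" "S \<subseteq> J" "\<And>q. \<pi> \<noteq> {q}" for W J S
    using FD[OF that(2,4,6)] pi_quotient_Dnormal[OF that(1,3,4,5,6,7)] by blast
  have F_nml: "T \<in> \<F>" if "S \<in> \<F>" "nml T S" for S T
    using FD[OF that(1)] nmlD(1,3)[OF that(2)] nml_imp_Dnormal[OF that(2)] by blast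
  have F_one: "{\<one>} \<in> \<F>" using ne F_nml nml_one F_sub by blast
  have F_prod: "S <#> T \<in> \<F>" if "S \<in> \<F>" "T \<in> \<F>" "normalizes T S" "normalizes S T" for S T
  proof -
    have s: "sub S" "sub T" using that F_sub by blast+
    note g = generate_union[OF s]
    have sST: "sub (S <#> T)" using sub_set_mult[OF s that(3)] .
    have e: "generate G (S \<union> T) = S <#> T"
      using g(4)[OF sST set_mult_upper[OF s]] set_mult_least[OF g(1-3)] by (rule subset_antisym)
    have "nml S (S <#> T)" using nml_in_set_mult[OF s that(3)] .
    moreover have "nml T (S <#> T)"
      using nml_in_set_mult[OF s(2,1) that(4)] set_mult_commute_nml[OF s that(3)] by simp
    ultimately show ?thesis using FS2[OF that(1,2)] nml_imp_Dnormal unfolding e by blast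
  qed
  have F_cj: "cj x S \<in> \<F>" if "S \<in> \<F>" "x \<in> carrier G" for S x
    using FS3[OF that] conj_set_eq[OF that(2) sub_carrier[OF F_sub[OF that(1)]]] by simp
  have F_join: "\<exists>V\<in>\<F>. S \<subseteq> V \<and> T \<subseteq> V \<and> V \<subseteq> J"
    if \<rho>: "\<rho> \<in> atoms \<pi>" and J: "nml W J" "pi_number \<rho> (idx J W)"
      and ST: "S \<in> \<F>" "T \<in> \<F>" "W \<subseteq> S" "W \<subseteq> T" "S \<subseteq> J" "T \<subseteq> J" for \<rho> W J S T
  proof (cases "\<exists>p. prime p \<and> \<rho> = {p}")
    case True
    then obtain p where p: "prime p" "\<rho> = {p}" by blast
    show ?thesis
      using prime_quotient_join[of \<F>, OF F_sub F_prod F_cj J(1) p(1) _ ST] J(2) p(2) by blast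
  next
    case False
    then have \<rho>\<pi>: "\<rho> = \<pi>" using \<rho> unfolding atoms_def by blast
    \<comment> \<open>If \<pi> were a singleton, its element would be prime and the previous case
      would apply.\<close>
    have nq: "\<pi> \<noteq> {q}" for q using False \<rho>\<pi> assms(3) by blast
    have s: "sub S" "sub T" using ST F_sub by blast+
    note g = generate_union[OF s]
    let ?K = "generate G (S \<union> T)"
    have KJ: "?K \<subseteq> J" using g(4)[OF nmlD(2)[OF J(1)] ST(5,6)] .
    have WK: "W \<subseteq> ?K" using ST(3) g(2) by blast
    have nK: "nml W ?K" using nml_restrict[OF J(1) g(1) WK KJ] .
    have iK: "pi_number \<pi> (idx ?K W)"
      using idx_dvd_r[OF nmlD(2)[OF J(1)] g(1) nmlD(1)[OF J(1)] WK KJ] J(2) \<rho>\<pi> pi_number_dvd by blast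
    have "?K \<in> \<F>"
      by (rule FS2[OF ST(1,2) pi_quotient_Dnormal[OF nK iK s(1) ST(3) g(2) nq] pi_quotient_Dnormal[OF nK iK s(2) ST(4) g(3) nq]])
    then show ?thesis using g(2,3) KJ by blast
  qed
  have series: "solvable_series (atoms \<pi>) (carrier G)" using pi_soluble_series[OF assms(4,3)] .
  show "fitting_setup G (atoms \<pi>) \<F>"
    by (rule fitting_setup.intro solvable_setup.intro finite_group_axioms
        solvable_setup_axioms.intro fitting_setup_axioms.intro series F_one | (erule (2) atoms_disjoint) | (erule (1) solvable_hall_dominates[OF series])
        | (erule (8) F_join) | (erule (3) F_prod) | (erule (1) F_nml) | (erule (1) F_cj) | (erule F_sub))+
qed

context fitting_setup
begin

lemma maximal_in_iff_Fmax:
  assumes "sub K"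
  shows "maximal_in G \<F> K V \<longleftrightarrow> Fmax K V"
  unfolding maximal_in_def Fmax_def sub_restrict[OF assms] using F_sub by blast

lemma injector_iff:
  assumes "sub H"
  shows "injector G \<F> H V \<longleftrightarrow> is_injector H V"
proof -
  have "maximal_in G \<F> K (V \<inter> K) \<longleftrightarrow> Fmax K (V \<inter> K)" if "subnormal_in K H" for K
    using that maximal_in_iff_Fmax unfolding subnormal_in_def by blast
  then show ?thesis
    unfolding injector_def is_injector_def sub_restrict[OF assms] subnormal_iff[OF assms] by blast
qed

end

section \<open>The residual of the product class\<close>

text \<open>Surjectivity matters because the second entry of each commutator ranges over the whole
  group.\<close>

lemma lower_central_hom:
  assumes "group_hom A B f" "f ` carrier A = carrier B"
  shows "lower_central B n = f ` lower_central A n"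
proof -
  interpret group_hom A B f by fact
  have sub: "lower_central A n \<subseteq> carrier A" for n
  proof (induction n)
    case (Suc n)
    have "{inv\<^bsub>A\<^esub> x \<otimes>\<^bsub>A\<^esub> inv\<^bsub>A\<^esub> y \<otimes>\<^bsub>A\<^esub> x \<otimes>\<^bsub>A\<^esub> y | x y. x \<in> lower_central A n \<and> y \<in> carrier A} \<subseteq> carrier A"
      using Suc by auto
    then show ?case using G.generate_incl by simp
  qed simp
  show ?thesis
  proof (induction n)
    case 0
    then show ?case using assms(2) by simp
  next
    case (Suc n)
    let ?S = "{inv\<^bsub>A\<^esub> x \<otimes>\<^bsub>A\<^esub> inv\<^bsub>A\<^esub> y \<otimes>\<^bsub>A\<^esub> x \<otimes>\<^bsub>A\<^esub> y | x y. x \<in> lower_central A n \<and> y \<in> carrier A}"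
    have S: "?S \<subseteq> carrier A" using sub[of n] by auto
    have h: "f (inv\<^bsub>A\<^esub> x \<otimes>\<^bsub>A\<^esub> inv\<^bsub>A\<^esub> y \<otimes>\<^bsub>A\<^esub> x \<otimes>\<^bsub>A\<^esub> y) = inv\<^bsub>B\<^esub> f x \<otimes>\<^bsub>B\<^esub> inv\<^bsub>B\<^esub> f y \<otimes>\<^bsub>B\<^esub> f x \<otimes>\<^bsub>B\<^esub> f y"
      if "x \<in> carrier A" "y \<in> carrier A" for x y using that by simp
    have "{inv\<^bsub>B\<^esub> x \<otimes>\<^bsub>B\<^esub> inv\<^bsub>B\<^esub> y \<otimes>\<^bsub>B\<^esub> x \<otimes>\<^bsub>B\<^esub> y | x y. x \<in> lower_central B n \<and> y \<in> carrier B} = f ` ?S"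
    proof (intro subset_antisym subsetI)
      fix z assume "z \<in> {inv\<^bsub>B\<^esub> x \<otimes>\<^bsub>B\<^esub> inv\<^bsub>B\<^esub> y \<otimes>\<^bsub>B\<^esub> x \<otimes>\<^bsub>B\<^esub> y | x y. x \<in> lower_central B n \<and> y \<in> carrier B}"
      then obtain u v where z: "z = inv\<^bsub>B\<^esub> u \<otimes>\<^bsub>B\<^esub> inv\<^bsub>B\<^esub> v \<otimes>\<^bsub>B\<^esub> u \<otimes>\<^bsub>B\<^esub> v" "u \<in> lower_central B n" "v \<in> carrier B"
        by blast
      obtain x where x: "x \<in> lower_central A n" "u = f x" using z(2) Suc by blast
      obtain y where y: "y \<in> carrier A" "v = f y" using z(3) assms(2) by blast
      have "z = f (inv\<^bsub>A\<^esub> x \<otimes>\<^bsub>A\<^esub> inv\<^bsub>A\<^esub> y \<otimes>\<^bsub>A\<^esub> x \<otimes>\<^bsub>A\<^esub> y)"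
        unfolding z(1) x(2) y(2) using h[of x y] x(1) y(1) sub[of n] by (simp add: subset_iff)
      moreover have "inv\<^bsub>A\<^esub> x \<otimes>\<^bsub>A\<^esub> inv\<^bsub>A\<^esub> y \<otimes>\<^bsub>A\<^esub> x \<otimes>\<^bsub>A\<^esub> y \<in> ?S" using x(1) y(1) by blast
      ultimately show "z \<in> f ` ?S" by (rule image_eqI)
    next
      fix z assume "z \<in> f ` ?S"
      then obtain x y where x: "x \<in> lower_central A n" and y: "y \<in> carrier A"
        and z: "z = f (inv\<^bsub>A\<^esub> x \<otimes>\<^bsub>A\<^esub> inv\<^bsub>A\<^esub> y \<otimes>\<^bsub>A\<^esub> x \<otimes>\<^bsub>A\<^esub> y)" by blast
      have xc: "x \<in> carrier A" using x sub[of n] by blast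
      have "f x \<in> lower_central B n" unfolding Suc using x by (rule imageI)
      moreover have "f y \<in> carrier B" unfolding assms(2)[symmetric] using y by (rule imageI)
      ultimately
      show "z \<in> {inv\<^bsub>B\<^esub> x \<otimes>\<^bsub>B\<^esub> inv\<^bsub>B\<^esub> y \<otimes>\<^bsub>B\<^esub> x \<otimes>\<^bsub>B\<^esub> y | x y. x \<in> lower_central B n \<and> y \<in> carrier B}"
        unfolding z h[OF xc y] by (intro CollectI exI[of _ "f x"] exI[of _ "f y"] conjI refl)
    qed
    then show ?case unfolding lower_central.simps(2) by (simp only: generate_img[OF S])
  qed
qed

context finite_group
begin

text \<open>The lower central series of a subgroup as subsets of the ambient group, so that series
  of different subgroups can be compared; see \<open>lower_central_eq\<close>.\<close>

primrec lcs :: "'a set \<Rightarrow> nat \<Rightarrow> 'a set"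
  where
    "lcs B 0 = B"
  | "lcs B (Suc n) = generate G {inv x \<otimes> inv y \<otimes> x \<otimes> y | x y. x \<in> lcs B n \<and> y \<in> B}"

lemma commutators_subset:
  assumes "sub B" "A \<subseteq> B"
  shows "{inv x \<otimes> inv y \<otimes> x \<otimes> y | x y. x \<in> A \<and> y \<in> B} \<subseteq> B"
proof
  fix z assume "z \<in> {inv x \<otimes> inv y \<otimes> x \<otimes> y | x y. x \<in> A \<and> y \<in> B}"
  then obtain x y where z: "z = inv x \<otimes> inv y \<otimes> x \<otimes> y" "x \<in> A" "y \<in> B" by blast
  have x: "x \<in> B" using z(2) assms(2) by blast
  show "z \<in> B"
    unfolding z(1) by (intro sub_memD(3)[OF assms(1)] sub_memD(2)[OF assms(1)] x z(3))
qed

lemma lcs_sub: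
  assumes "sub B"
  shows "sub (lcs B n)" "lcs B n \<subseteq> B"
proof -
  have "sub (lcs B n) \<and> lcs B n \<subseteq> B"
  proof (induction n)
    case (Suc n)
    have S: "{inv x \<otimes> inv y \<otimes> x \<otimes> y | x y. x \<in> lcs B n \<and> y \<in> B} \<subseteq> B"
      using commutators_subset[OF assms] Suc by blast
    show ?case
      unfolding lcs.simps
      using generate_is_subgroup[OF subset_trans[OF S sub_carrier[OF assms]]] generate_subgroup_incl[OF S assms] by (rule conjI)
  qed (use assms in simp)
  then show "sub (lcs B n)" "lcs B n \<subseteq> B" by blast+
qed

lemma lcs_mono: "B \<subseteq> C \<Longrightarrow> lcs B n \<subseteq> lcs C n"
proof (induction n)
  case (Suc n)
  show ?case unfolding lcs.simps by (rule mono_generate) (use Suc in blast)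
qed simp

lemma lcs_decreasing:
  assumes "sub B" "m \<le> n"
  shows "lcs B n \<subseteq> lcs B m"
proof -
  have "lcs B (Suc k) \<subseteq> lcs B k" for k
  proof (induction k)
    case 0
    show ?case using lcs_sub(2)[OF assms(1), of "Suc 0"] by simp
  next
    case (Suc k)
    show ?case unfolding lcs.simps(2)[of B "Suc k"] unfolding lcs.simps(2)[of B k]
      by (rule mono_generate) (use Suc in \<open>unfold lcs.simps(2)[symmetric], blast\<close>)
  qed
  then show ?thesis using lift_Suc_antimono_le[of "lcs B" m n] assms(2) by blast
qed

lemma lower_central_eq:
  assumes "sub B"
  shows "lower_central (G\<lparr>carrier := B\<rparr>) n = lcs B n"
proof (induction n)
  case (Suc n)
  let ?S = "{inv x \<otimes> inv y \<otimes> x \<otimes> y | x y. x \<in> lcs B n \<and> y \<in> B}"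
  have S: "?S \<subseteq> B" using commutators_subset[OF assms lcs_sub(2)[OF assms]] .
  have i: "inv\<^bsub>G\<lparr>carrier := B\<rparr>\<^esub> x = inv x" if "x \<in> B" for x using m_inv_consistent[OF assms that] .
  have "{inv\<^bsub>G\<lparr>carrier := B\<rparr>\<^esub> x \<otimes> inv\<^bsub>G\<lparr>carrier := B\<rparr>\<^esub> y \<otimes> x \<otimes> y | x y. x \<in> lcs B n \<and> y \<in> B} = ?S"
    using i subsetD[OF lcs_sub(2)[OF assms, of n]] by (intro Collect_cong ex_cong1) auto
  then show ?case using Suc generate_consistent[OF S assms] by simp
qed simp

text \<open>Internal form of the membership of G/N in the product class: G/N is the direct product
  of A/N and B/N, and nilpotency of B/N reads \<open>lcs B n \<subseteq> N\<close>. In this form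
  closure under intersection can be checked inside G.\<close>

definition Npi_normal :: "nat set \<Rightarrow> 'a set \<Rightarrow> bool"
  where "Npi_normal \<pi> N \<longleftrightarrow> (\<exists>A B n. nml N (carrier G) \<and> nml A (carrier G) \<and> nml B (carrier G) \<and>
    A \<inter> B = N \<and> A <#> B = carrier G \<and> pi_number \<pi> (idx A N) \<and> pi_number (- \<pi>) (idx B N) \<and> lcs B n \<subseteq> N)"

lemma Npi_normal_idx:
  assumes "nml A (carrier G)" "nml B (carrier G)" "A \<inter> B = N" "A <#> B = carrier G"
  shows "idx (carrier G) A = idx B N" "idx (carrier G) B = idx A N"
proof -
  note A = nmlD[OF assms(1)] and B = nmlD[OF assms(2)]
  show "idx (carrier G) A = idx B N" using idx_set_mult[OF A(1) B(1)] assms(3,4) by simp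
  have "B <#> A = carrier G"
    using set_mult_commute_nml[OF A(1) B(1) normalizes_mono[OF A(4) B(3)]] assms(4) by simp
  then show "idx (carrier G) B = idx A N" using idx_set_mult[OF B(1) A(1)] assms(3) by (simp add: Int_commute)
qed

lemma Npi_normal_carrier: "Npi_normal \<pi> (carrier G)"
proof -
  note n = nml_self[OF sub_carrier_self]
  have "idx (carrier G) (carrier G) = 1" using idx_self[OF sub_carrier_self] .
  moreover have "carrier G <#> carrier G = carrier G"
    using set_mult_absorb[OF sub_carrier_self sub_carrier_self] by simp
  moreover have "lcs (carrier G) 0 \<subseteq> carrier G" by simp
  ultimately show ?thesis unfolding Npi_normal_def using n
    by (intro exI[of _ "carrier G"] exI[of _ "0::nat"]) simp
qed

text \<open>(A \<inter> A')/(N \<inter> N') is built from sections embedding in A/N and in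
  A'/N'.\<close>

lemma idx_Int_number:
  assumes "nml N A" "nml N' A'" "sub A" "sub A'" "pi_number \<rho> (idx A N)" "pi_number \<rho> (idx A' N')"
  shows "pi_number \<rho> (idx (A \<inter> A') (N \<inter> N'))"
proof -
  note N = nmlD[OF assms(1)] and N' = nmlD[OF assms(2)]
  have s: "sub (A \<inter> A')" "sub (N \<inter> A')" "sub (N \<inter> N')" using sub_Int assms(3,4) N(1) N'(1) by blast+
  have e1: "(A \<inter> A') \<inter> N = N \<inter> A'" "(N \<inter> A') \<inter> N' = N \<inter> N'" using N(3) N'(3) by blast+
  have "idx (A \<inter> A') (N \<inter> A') dvd idx A N"
    using idx_Int_dvd[OF assms(1) s(1) Int_lower1] unfolding e1 .
  moreover have "idx (N \<inter> A') (N \<inter> N') dvd idx A' N'"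
    using idx_Int_dvd[OF assms(2) s(2) Int_lower2] unfolding e1 .
  moreover have "idx (A \<inter> A') (N \<inter> N') = idx (A \<inter> A') (N \<inter> A') * idx (N \<inter> A') (N \<inter> N')"
  proof (rule idx_trans[OF s])
    show "N \<inter> N' \<subseteq> N \<inter> A'" "N \<inter> A' \<subseteq> A \<inter> A'" using N(3) N'(3) by blast+
  qed
  ultimately show ?thesis
    using pi_number_dvd[OF assms(5)] pi_number_dvd[OF assms(6)] by (simp add: pi_number_mult_iff)
qed

lemma Npi_normal_Int:
  assumes "Npi_normal \<pi> N" "Npi_normal \<pi> N'"
  shows "Npi_normal \<pi> (N \<inter> N')"
proof -
  obtain A B n where N: "nml N (carrier G)" "nml A (carrier G)" "nml B (carrier G)" "A \<inter> B = N"
      "A <#> B = carrier G" "pi_number \<pi> (idx A N)" "pi_number (- \<pi>) (idx B N)" "lcs B n \<subseteq> N"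
    using assms(1) unfolding Npi_normal_def by blast
  obtain A' B' n' where N': "nml N' (carrier G)" "nml A' (carrier G)" "nml B' (carrier G)" "A' \<inter> B' = N'"
      "A' <#> B' = carrier G" "pi_number \<pi> (idx A' N')" "pi_number (- \<pi>) (idx B' N')" "lcs B' n' \<subseteq> N'"
    using assms(2) unfolding Npi_normal_def by blast
  note s = nmlD(1)[OF N(2)] nmlD(1)[OF N(3)] nmlD(1)[OF N'(2)] nmlD(1)[OF N'(3)]
  have r: "nml N A" "nml N B" "nml N' A'" "nml N' B'"
    using nml_restrict[OF N(1) s(1)] nml_restrict[OF N(1) s(2)] nml_restrict[OF N'(1) s(3)] nml_restrict[OF N'(1) s(4)]
      N(4) N'(4) sub_carrier[OF s(1)] sub_carrier[OF s(2)] sub_carrier[OF s(3)] sub_carrier[OF s(4)] by blast+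
  have nI: "nml (A \<inter> A') (carrier G)" "nml (B \<inter> B') (carrier G)" "nml (N \<inter> N') (carrier G)"
    using nml_Int N(1-3) N'(1-3) by blast+
  have iA: "pi_number (- \<pi>) (idx (carrier G) (A \<inter> A'))"
    using idx_Int_number[OF N(2) N'(2) sub_carrier_self sub_carrier_self]
      Npi_normal_idx(1)[OF N(2-5)] Npi_normal_idx(1)[OF N'(2-5)] N(7) N'(7) by simp
  have iB: "pi_number \<pi> (idx (carrier G) (B \<inter> B'))"
    using idx_Int_number[OF N(3) N'(3) sub_carrier_self sub_carrier_self]
      Npi_normal_idx(2)[OF N(2-5)] Npi_normal_idx(2)[OF N'(2-5)] N(6) N'(6) by simp
  \<comment> \<open>The two intersections have coprime indices in G.\<close>
  have "(A \<inter> A') <#> (B \<inter> B') = carrier G"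
    using nmlD(1)[OF nml_set_mult[OF nI(1,2)]] nmlD(1,3)[OF nI(1)] nmlD(1,3)[OF nI(2)] iA iB
    by (intro idx_coprime_set_mult sub_carrier_self pi_number_coprime[of "- \<pi>" _ \<pi>]) auto
  moreover have "lcs (B \<inter> B') (max n n') \<subseteq> N \<inter> N'"
  proof -
    have "lcs (B \<inter> B') (max n n') \<subseteq> lcs B n"
      using lcs_mono[of "B \<inter> B'" B "max n n'"] lcs_decreasing[OF s(2), of n "max n n'"] by simp
    moreover have "lcs (B \<inter> B') (max n n') \<subseteq> lcs B' n'"
      using lcs_mono[of "B \<inter> B'" B' "max n n'"] lcs_decreasing[OF s(4), of n' "max n n'"] by simp
    ultimately show ?thesis using N(8) N'(8) by blast
  qed
  moreover have "(A \<inter> A') \<inter> (B \<inter> B') = N \<inter> N'" using N(4) N'(4) by blast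
  ultimately show ?thesis
    unfolding Npi_normal_def
    using nI idx_Int_number[OF r(1,3) s(1,3) N(6) N'(6)] idx_Int_number[OF r(2,4) s(2,4) N(7) N'(7)] by blast
qed

text \<open>Multiplication maps A/N \<times> B/N isomorphically onto G/N: the factors commute as
  [A, B] \<le> A \<inter> B = N.\<close>

lemma Npi_normal_imp_group:
  assumes "Npi_normal \<pi> N"
  shows "N \<lhd> G \<and> Npi_group \<pi> (G Mod N)"
proof
  obtain A B n where N: "nml N (carrier G)" "nml A (carrier G)" "nml B (carrier G)" "A \<inter> B = N"
      "A <#> B = carrier G" "pi_number \<pi> (idx A N)" "pi_number (- \<pi>) (idx B N)" "lcs B n \<subseteq> N"
    using assms(1) unfolding Npi_normal_def by blast
  show "N \<lhd> G" using normal_iff_nml[OF sub_carrier_self] N(1) by simp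
  define Q where "Q = G Mod N"
  define q where "q = (\<lambda>x. N #> x)"
  have Qe: "G\<lparr>carrier := carrier G\<rparr> Mod N = Q" unfolding Q_def by simp
  note qc = quotient_correspondence[OF N(1), folded q_def, unfolded Qe]
  interpret Q: finite_group Q by (rule qc(1))
  have NA: "N \<subseteq> A" "N \<subseteq> B" using N(4) by blast+
  note A = nmlD[OF N(2)] and B = nmlD[OF N(3)]
  note Am = sub_memD[OF A(1)] and Bm = sub_memD[OF B(1)]
  have qA: "Q.sub (q ` A)" "card (q ` A) = idx A N" using qc(2)[OF A(1) NA(1) A(3)] by blast+
  have qB: "Q.sub (q ` B)" "card (q ` B) = idx B N" using qc(2)[OF B(1) NA(2) B(3)] by blast+
  let ?H = "Q\<lparr>carrier := q ` A\<rparr>" and ?K = "Q\<lparr>carrier := q ` B\<rparr>"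
  have gH: "group ?H" and gK: "group ?K" using Q.subgroup_imp_group qA(1) qB(1) by blast+
  have piH: "pi_group \<pi> ?H"
    using gH qA(2) N(6) Q.sub_fin[OF qA(1)] unfolding pi_group_def pi_number_def order_def by simp
  have piK: "pi_group (compl_primes \<pi>) ?K"
    using gK qB(2) N(7) Q.sub_fin[OF qB(1)] unfolding pi_group_def pi_number_def order_def compl_primes_def by simp
  have hq: "group_hom (G\<lparr>carrier := B\<rparr>) ?K q"
  proof -
    have "q (x \<otimes> y) = q x \<otimes>\<^bsub>Q\<^esub> q y" if "x \<in> B" "y \<in> B" for x y
      using qc(5) Bm(1) that by blast
    then have "q \<in> hom (G\<lparr>carrier := B\<rparr>) ?K" unfolding hom_def by auto
    then show ?thesis using gK subgroup_imp_group[OF B(1)] by (simp add: group_hom_def group_hom_axioms_def)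
  qed
  have qN: "q x = \<one>\<^bsub>Q\<^esub>" if "x \<in> N" for x
    unfolding qc(8) q_def using coset_join2[OF sub_memD(1)[OF nmlD(1)[OF N(1)] that] nmlD(1)[OF N(1)] that] .
  have nilK: "nilpotent_group ?K"
  proof -
    have "lower_central ?K n = q ` lcs B n"
      using lower_central_hom[OF hq] lower_central_eq[OF B(1)] by simp
    moreover have "q ` lcs B n = {\<one>\<^bsub>Q\<^esub>}"
      using N(8) qN one_in[OF lcs_sub(1)[OF B(1)]] by (intro subset_antisym subsetI) (auto intro!: image_eqI[of _ q \<one>] simp: one_in[OF nmlD(1)[OF N(1)]])
    ultimately have "lower_central ?K n = {\<one>\<^bsub>?K\<^esub>}" by simp
    then show ?thesis unfolding nilpotent_group_def using gK by blast
  qed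
  let ?f = "\<lambda>(x, y). x \<otimes>\<^bsub>Q\<^esub> y"
  have comm: "q a \<otimes>\<^bsub>Q\<^esub> q b = q b \<otimes>\<^bsub>Q\<^esub> q a" if a: "a \<in> A" and b: "b \<in> B" for a b
  proof -
    have c: "a \<in> carrier G" "b \<in> carrier G" using a b Am(1) Bm(1) by blast+
    have "inv b \<otimes> a \<otimes> b \<in> A" using normalizes_elem[OF A(4) c(2) a] .
    then have m1: "inv a \<otimes> (inv b \<otimes> a \<otimes> b) \<in> A" using Am a by blast
    have "inv a \<otimes> inv b \<otimes> a \<in> B" using normalizes_elem[OF B(4) c(1)] Bm(2) b by blast
    then have "(inv a \<otimes> inv b \<otimes> a) \<otimes> b \<in> B" using Bm b by blast
    then have "inv a \<otimes> (inv b \<otimes> a \<otimes> b) \<in> B" using c by (simp add: m_assoc)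
    then have "inv a \<otimes> (inv b \<otimes> a \<otimes> b) \<in> N" using m1 N(4) by blast
    then have "q (inv a \<otimes> (inv b \<otimes> a \<otimes> b)) = \<one>\<^bsub>Q\<^esub>" using qN by blast
    moreover have "q (a \<otimes> b) = q ((b \<otimes> a) \<otimes> (inv a \<otimes> (inv b \<otimes> a \<otimes> b)))"
      using c by (simp add: m_assoc)
    moreover have "\<dots> = q (b \<otimes> a) \<otimes>\<^bsub>Q\<^esub> q (inv a \<otimes> (inv b \<otimes> a \<otimes> b))"
      using qc(5) c by simp
    moreover have "q (b \<otimes> a) \<in> carrier Q" using qc(7) c by blast
    ultimately have "q (a \<otimes> b) = q (b \<otimes> a)" by simp
    then show ?thesis using qc(5) c by simp
  qed
  have hom: "?f \<in> hom (?H \<times>\<times> ?K) Q"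
  proof -
    have "(q a \<otimes>\<^bsub>Q\<^esub> q a') \<otimes>\<^bsub>Q\<^esub> (q b \<otimes>\<^bsub>Q\<^esub> q b') = (q a \<otimes>\<^bsub>Q\<^esub> q b) \<otimes>\<^bsub>Q\<^esub> (q a' \<otimes>\<^bsub>Q\<^esub> q b')"
      if "a \<in> A" "a' \<in> A" "b \<in> B" "b' \<in> B" for a a' b b'
    proof -
      have m: "q a \<in> carrier Q" "q a' \<in> carrier Q" "q b \<in> carrier Q" "q b' \<in> carrier Q"
        using that Am(1) Bm(1) qc(7) by blast+
      have "(q a \<otimes>\<^bsub>Q\<^esub> q a') \<otimes>\<^bsub>Q\<^esub> (q b \<otimes>\<^bsub>Q\<^esub> q b') = q a \<otimes>\<^bsub>Q\<^esub> (q a' \<otimes>\<^bsub>Q\<^esub> q b) \<otimes>\<^bsub>Q\<^esub> q b'"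
        using m by (simp add: Q.m_assoc)
      also have "\<dots> = q a \<otimes>\<^bsub>Q\<^esub> (q b \<otimes>\<^bsub>Q\<^esub> q a') \<otimes>\<^bsub>Q\<^esub> q b'" using comm[OF that(2,3)] by simp
      also have "\<dots> = (q a \<otimes>\<^bsub>Q\<^esub> q b) \<otimes>\<^bsub>Q\<^esub> (q a' \<otimes>\<^bsub>Q\<^esub> q b')" using m by (simp add: Q.m_assoc)
      finally show ?thesis .
    qed
    moreover have "q a \<in> carrier Q" "q b \<in> carrier Q" if "a \<in> A" "b \<in> B" for a b
      using that Am(1) Bm(1) qc(7) by blast+
    ultimately show ?thesis unfolding hom_def by auto
  qed
  have surj: "?f ` (q ` A \<times> q ` B) = carrier Q"
  proof (intro subset_antisym subsetI)
    fix z assume "z \<in> carrier Q"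
    then obtain x where x: "x \<in> carrier G" "z = q x" using qc(7) by blast
    then obtain a b where ab: "a \<in> A" "b \<in> B" "x = a \<otimes> b" using N(5) set_mult_mem[of x A B] by blast
    then have "z = ?f (q a, q b)" using x(2) qc(5) Am(1) Bm(1) by simp
    then show "z \<in> ?f ` (q ` A \<times> q ` B)" using ab by blast
  next
    fix z assume "z \<in> ?f ` (q ` A \<times> q ` B)"
    then obtain a b where ab: "a \<in> A" "b \<in> B" "z = q a \<otimes>\<^bsub>Q\<^esub> q b" by auto
    then have "q a \<in> carrier Q" "q b \<in> carrier Q" using Am(1) Bm(1) qc(7) by blast+
    then show "z \<in> carrier Q" using ab by simp
  qed
  \<comment> \<open>Injectivity comes from surjectivity by comparing orders.\<close>
  have "inj_on ?f (q ` A \<times> q ` B)"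
  proof (rule eq_card_imp_inj_on)
    show "finite (q ` A \<times> q ` B)" using Q.sub_fin qA(1) qB(1) by blast
    have "card (carrier Q) = idx (carrier G) N"
      using qc(2)[OF sub_carrier_self nmlD(3)[OF N(1)]] qc(7) by simp
    also have "\<dots> = idx B N * idx A N"
      using idx_trans[OF sub_carrier_self A(1) nmlD(1)[OF N(1)] NA(1) A(3)] Npi_normal_idx(1)[OF N(2-5)] by simp
    finally show "card (?f ` (q ` A \<times> q ` B)) = card (q ` A \<times> q ` B)"
      unfolding surj card_cartesian_product qA(2) qB(2) by simp
  qed
  then have "?f \<in> iso (?H \<times>\<times> ?K) Q" using hom surj by (simp add: iso_def bij_betw_def)
  then have "?H \<times>\<times> ?K \<cong> Q" by (rule is_isoI)
  then have "Q \<cong> ?H \<times>\<times> ?K" using group.iso_sym[OF DirProd_group[OF gH gK]] by blast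
  then show "Npi_group \<pi> (G Mod N)"
    unfolding Npi_group_def Q_def[symmetric] using Q.is_group piH nilK piK by blast
qed

lemma Npi_group_imp_normal:
  assumes "N \<lhd> G" "Npi_group \<pi> (G Mod N)"
  shows "Npi_normal \<pi> N"
proof -
  have nN: "nml N (carrier G)" using normal_iff_nml[OF sub_carrier_self] assms(1) by simp
  define Q where "Q = G Mod N"
  define q where "q = (\<lambda>x. N #> x)"
  have Qe: "G\<lparr>carrier := carrier G\<rparr> Mod N = Q" unfolding Q_def by simp
  note qc = quotient_correspondence[OF nN, folded q_def, unfolded Qe]
  interpret Q: finite_group Q by (rule qc(1))
  obtain H K :: "'a set monoid" where HK: "pi_group \<pi> H" "nilpotent_group K" "pi_group (compl_primes \<pi>) K" "Q \<cong> H \<times>\<times> K"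
    using assms(2) unfolding Npi_group_def Q_def by blast
  interpret H: group H using HK(1) unfolding pi_group_def by blast
  interpret K: group K using HK(3) unfolding pi_group_def by blast
  obtain \<phi> where \<phi>: "\<phi> \<in> iso Q (H \<times>\<times> K)" using HK(4) unfolding is_iso_def by blast
  have \<phi>h: "\<phi> \<in> hom Q (H \<times>\<times> K)" and \<phi>b: "bij_betw \<phi> (carrier Q) (carrier H \<times> carrier K)"
    using \<phi> unfolding iso_def by auto
  have qG: "q x \<in> carrier Q" if "x \<in> carrier G" for x using qc(7) that by blast
  define f where "f x = fst (\<phi> (q x))" for x
  define g where "g x = snd (\<phi> (q x))" for x
  have mem: "f x \<in> carrier H" "g x \<in> carrier K" if "x \<in> carrier G" for x
    using bij_betwE[OF \<phi>b] qG[OF that] unfolding f_def g_def by (auto simp: mem_Times_iff)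
  have mult: "f (x \<otimes> y) = f x \<otimes>\<^bsub>H\<^esub> f y" "g (x \<otimes> y) = g x \<otimes>\<^bsub>K\<^esub> g y" if "x \<in> carrier G" "y \<in> carrier G" for x y
  proof -
    have "\<phi> (q (x \<otimes> y)) = \<phi> (q x) \<otimes>\<^bsub>H \<times>\<times> K\<^esub> \<phi> (q y)"
      using hom_mult[OF \<phi>h] qG that qc(5) by simp
    then show "f (x \<otimes> y) = f x \<otimes>\<^bsub>H\<^esub> f y" "g (x \<otimes> y) = g x \<otimes>\<^bsub>K\<^esub> g y"
      unfolding f_def g_def mult_DirProd' by simp_all
  qed
  have surj: "\<exists>x\<in>carrier G. f x = h \<and> g x = k" if "h \<in> carrier H" "k \<in> carrier K" for h k
  proof -
    have "(h, k) \<in> \<phi> ` carrier Q" using \<phi>b that unfolding bij_betw_def by blast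
    then obtain z where "z \<in> carrier Q" "\<phi> z = (h, k)" by (metis imageE)
    then show ?thesis using qc(7) unfolding f_def g_def by (metis fst_conv snd_conv imageE)
  qed
  have gf: "group_hom G H f" and gg: "group_hom G K g"
    using mem mult by (auto simp: group_hom_def group_hom_axioms_def hom_def is_group H.is_group K.is_group)
  interpret f: group_hom G H f by (rule gf)
  interpret g: group_hom G K g by (rule gg)
  have ker: "x \<in> N" if "x \<in> carrier G" "f x = \<one>\<^bsub>H\<^esub>" "g x = \<one>\<^bsub>K\<^esub>" for x
  proof -
    have "\<phi> (q x) = \<phi> (q \<one>)"
      using that f.hom_one g.hom_one unfolding f_def g_def by (simp add: prod_eq_iff)
    then have "q x = q \<one>" using \<phi>b qG that(1) unfolding bij_betw_def inj_on_def by blast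
    moreover have "q \<one> \<in> q ` N" using one_in[OF nmlD(1)[OF nN]] by blast
    ultimately show ?thesis using qc(4)[OF nmlD(1)[OF nN] subset_refl nmlD(3)[OF nN] that(1)] by simp
  qed
  have Nker: "f x = \<one>\<^bsub>H\<^esub>" "g x = \<one>\<^bsub>K\<^esub>" if "x \<in> N" for x
  proof -
    have "q x = q \<one>"
      unfolding q_def using coset_join2[OF _ nmlD(1)[OF nN]] that one_in[OF nmlD(1)[OF nN]] sub_memD(1)[OF nmlD(1)[OF nN]] by simp
    then show "f x = \<one>\<^bsub>H\<^esub>" "g x = \<one>\<^bsub>K\<^esub>" using f.hom_one g.hom_one unfolding f_def g_def by simp_all
  qed
  \<comment> \<open>The roles cross over: A is the kernel of the projection to K, so A/N corresponds
    to the \<pi>-group H, and B/N to K.\<close>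
  define A where "A = kernel G K g"
  define B where "B = kernel G H f"
  have A: "nml A (carrier G)" and B: "nml B (carrier G)"
    unfolding A_def B_def using normal_iff_nml[OF sub_carrier_self] g.normal_kernel f.normal_kernel by simp_all
  have Ai: "x \<in> A \<longleftrightarrow> x \<in> carrier G \<and> g x = \<one>\<^bsub>K\<^esub>" and Bi: "x \<in> B \<longleftrightarrow> x \<in> carrier G \<and> f x = \<one>\<^bsub>H\<^esub>" for x
    unfolding A_def B_def kernel_def by auto
  have AB: "A \<inter> B = N"
  proof (intro subset_antisym subsetI)
    show "x \<in> N" if "x \<in> A \<inter> B" for x using ker[of x] that Ai[of x] Bi[of x] by simp
    fix x assume x: "x \<in> N"
    have "x \<in> carrier G" using nmlD(3)[OF nN] x by (rule subsetD)
    then show "x \<in> A \<inter> B" using Nker[OF x] Ai[of x] Bi[of x] by simp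
  qed
  have NA: "N \<subseteq> A" "N \<subseteq> B" using AB by blast+
  have prod: "A <#> B = carrier G"
  proof (rule subset_antisym)
    show "A <#> B \<subseteq> carrier G" using setmult_subset_G nmlD(3)[OF A] nmlD(3)[OF B] by blast
    show "carrier G \<subseteq> A <#> B"
    proof
      fix x assume x: "x \<in> carrier G"
      obtain a where a: "a \<in> carrier G" "f a = f x" "g a = \<one>\<^bsub>K\<^esub>" using surj[OF mem(1)[OF x] K.one_closed] by blast
      have "f (inv a \<otimes> x) = \<one>\<^bsub>H\<^esub>" using a x mem by simp
      then have "a \<in> A" "inv a \<otimes> x \<in> B" using a x Ai Bi by simp_all
      moreover have "x = a \<otimes> (inv a \<otimes> x)" using a x by simp
      ultimately show "x \<in> A <#> B" using set_mult_memI by metis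
    qed
  qed
  have cA: "card (q ` A) = order H"
  proof -
    have "\<phi> ` q ` A = carrier H \<times> {\<one>\<^bsub>K\<^esub>}"
    proof (intro subset_antisym subsetI)
      fix z assume "z \<in> \<phi> ` q ` A"
      then obtain x where x: "x \<in> A" "z = \<phi> (q x)" by blast
      then have "z = (f x, g x)" unfolding f_def g_def by simp
      then show "z \<in> carrier H \<times> {\<one>\<^bsub>K\<^esub>}" using x(1) Ai mem by simp
    next
      fix z assume "z \<in> carrier H \<times> {\<one>\<^bsub>K\<^esub>}"
      then obtain h where h: "h \<in> carrier H" "z = (h, \<one>\<^bsub>K\<^esub>)" by blast
      obtain x where x: "x \<in> carrier G" "f x = h" "g x = \<one>\<^bsub>K\<^esub>" using surj[OF h(1) K.one_closed] by blast
      have "z = \<phi> (q x)" using h(2) x(2,3) unfolding f_def g_def by (simp add: prod_eq_iff)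
      then show "z \<in> \<phi> ` q ` A" using x Ai by blast
    qed
    moreover have "q ` A \<subseteq> carrier Q" using Ai qG by blast
    then have "card (\<phi> ` q ` A) = card (q ` A)"
      using \<phi>b unfolding bij_betw_def by (intro card_image) (auto intro: inj_on_subset)
    ultimately show ?thesis unfolding order_def by (simp add: card_cartesian_product)
  qed
  have cB: "card (q ` B) = order K"
  proof -
    have "\<phi> ` q ` B = {\<one>\<^bsub>H\<^esub>} \<times> carrier K"
    proof (intro subset_antisym subsetI)
      fix z assume "z \<in> \<phi> ` q ` B"
      then obtain x where x: "x \<in> B" "z = \<phi> (q x)" by blast
      then have "z = (f x, g x)" unfolding f_def g_def by simp
      then show "z \<in> {\<one>\<^bsub>H\<^esub>} \<times> carrier K" using x(1) Bi mem by simp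
    next
      fix z assume "z \<in> {\<one>\<^bsub>H\<^esub>} \<times> carrier K"
      then obtain k where k: "k \<in> carrier K" "z = (\<one>\<^bsub>H\<^esub>, k)" by blast
      obtain x where x: "x \<in> carrier G" "f x = \<one>\<^bsub>H\<^esub>" "g x = k" using surj[OF H.one_closed k(1)] by blast
      have "z = \<phi> (q x)" using k(2) x(2,3) unfolding f_def g_def by (simp add: prod_eq_iff)
      then show "z \<in> \<phi> ` q ` B" using x Bi by blast
    qed
    moreover have "q ` B \<subseteq> carrier Q" using Bi qG by blast
    then have "card (\<phi> ` q ` B) = card (q ` B)"
      using \<phi>b unfolding bij_betw_def by (intro card_image) (auto intro: inj_on_subset)
    ultimately show ?thesis unfolding order_def by (simp add: card_cartesian_product)
  qed
  have "idx A N = order H" "idx B N = order K"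
    using qc(2)[OF nmlD(1)[OF A] NA(1) nmlD(3)[OF A]] qc(2)[OF nmlD(1)[OF B] NA(2) nmlD(3)[OF B]] cA cB by simp_all
  then have num: "pi_number \<pi> (idx A N)" "pi_number (- \<pi>) (idx B N)"
    using HK(1,3) H.order_gt_0_iff_finite K.order_gt_0_iff_finite
    unfolding pi_group_def pi_number_def compl_primes_def by auto
  obtain n where n: "lower_central K n = {\<one>\<^bsub>K\<^esub>}" using HK(2) unfolding nilpotent_group_def by blast
  have "lcs B n \<subseteq> N"
  proof -
    have "g \<in> hom (G\<lparr>carrier := B\<rparr>) K" using mem mult Bi unfolding hom_def by auto
    then have gB: "group_hom (G\<lparr>carrier := B\<rparr>) K g"
      using subgroup_imp_group[OF nmlD(1)[OF B]] by (simp add: group_hom_def group_hom_axioms_def K.is_group)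
    have "g ` B = carrier K"
    proof (intro subset_antisym subsetI)
      fix k assume k: "k \<in> carrier K"
      obtain x where "x \<in> carrier G" "f x = \<one>\<^bsub>H\<^esub>" "g x = k" using surj[OF H.one_closed k] by blast
      then show "k \<in> g ` B" using Bi by blast
    qed (use mem Bi in blast)
    then have "lower_central K n = g ` lcs B n"
      using lower_central_hom[OF gB] lower_central_eq[OF nmlD(1)[OF B]] by simp
    then have "g x = \<one>\<^bsub>K\<^esub>" if "x \<in> lcs B n" for x using n that by blast
    then have gl: "g x = \<one>\<^bsub>K\<^esub>" if "x \<in> lcs B n" for x using that .
    show ?thesis
    proof
      fix x assume x: "x \<in> lcs B n"
      have xB: "x \<in> B" using lcs_sub(2)[OF nmlD(1)[OF B]] x by (rule subsetD)
      then have "x \<in> A" using Ai[of x] Bi[of x] gl[OF x] by simp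
      then show "x \<in> N" using xB AB by blast
    qed
  qed
  then show ?thesis unfolding Npi_normal_def using nN A B AB prod num by blast
qed

text \<open>A subgroup of smallest order with \<open>Npi_normal\<close> is also least for inclusion,
  since it can be intersected with any other one; hence \<open>LEAST\<close> denotes it.\<close>

lemma Npi_residual_normal: "Npi_normal \<pi> (Npi_residual \<pi> G)"
proof -
  have "\<exists>N. Npi_normal \<pi> N \<and> (\<forall>M. Npi_normal \<pi> M \<longrightarrow> card N \<le> card M)"
    using ex_has_least_nat[of "Npi_normal \<pi>" "carrier G" card] Npi_normal_carrier by blast
  then obtain N where N: "Npi_normal \<pi> N" and min: "\<And>M. Npi_normal \<pi> M \<Longrightarrow> card N \<le> card M" by blast
  have fN: "finite N" using N sub_fin nmlD(1) unfolding Npi_normal_def by blast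
  have "Npi_residual \<pi> G = N"
    unfolding Npi_residual_def
  proof (rule Least_equality)
    show "N \<lhd> G \<and> Npi_group \<pi> (G Mod N)" using Npi_normal_imp_group[OF N] .
    fix M assume "M \<lhd> G \<and> Npi_group \<pi> (G Mod M)"
    then have "Npi_normal \<pi> M" using Npi_group_imp_normal by blast
    then have "card N \<le> card (N \<inter> M)" using min Npi_normal_Int[OF N] by blast
    then have "N \<inter> M = N" using card_seteq[OF fN, of "N \<inter> M"] by blast
    then show "N \<subseteq> M" by blast
  qed
  then show ?thesis using N by simp
qed

end

section \<open>Dnormal subgroups and the main theorem\<close>

context finite_group
begin

text \<open>With T = KS, both A and B are shown to supplement T; the index of T then divides the
  coprime numbers |A/K| and |B/K|.\<close>

lemma Npi_normal_supplement:
  assumes "Npi_normal \<pi> K" "sub S"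
    and sup: "\<And>M \<rho>. nml M (carrier G) \<Longrightarrow> \<rho> \<in> atoms \<pi> \<Longrightarrow> pi_number \<rho> (idx (carrier G) M) \<Longrightarrow> M <#> S = carrier G"
  shows "K <#> S = carrier G"
proof (rule ccontr)
  assume neq: "K <#> S \<noteq> carrier G"
  obtain A B n where K: "nml K (carrier G)" "nml A (carrier G)" "nml B (carrier G)" "A \<inter> B = K"
      "A <#> B = carrier G" "pi_number \<pi> (idx A K)" "pi_number (- \<pi>) (idx B K)" "lcs B n \<subseteq> K"
    using assms(1) unfolding Npi_normal_def by blast
  note A = nmlD[OF K(2)] and B = nmlD[OF K(3)] and Sc = sub_carrier[OF assms(2)]
  note Am = sub_memD[OF A(1)] and Bm = sub_memD[OF B(1)]
  have KA: "K \<subseteq> A" "K \<subseteq> B" using K(4) by blast+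
  note iC = Npi_normal_idx[OF K(2-5)]
  define T where "T = K <#> S"
  have T: "sub T" "K \<subseteq> T" "S \<subseteq> T" "T \<subseteq> carrier G"
    unfolding T_def using normal_set_mult_sub(1-4)[OF K(1) assms(2) Sc] by blast+
  have iA: "pi_number (- \<pi>) (idx (carrier G) A)" and iB: "pi_number \<pi> (idx (carrier G) B)"
    using iC K(6,7) by simp_all
  \<comment> \<open>G/B has the order of A/K, a \<pi>-number, and \<pi> is an atom.\<close>
  have BT: "B <#> T = carrier G"
  proof (rule subset_antisym)
    show "B <#> T \<subseteq> carrier G" using set_mult_least[OF sub_carrier_self B(3) T(4)] .
    have "B <#> S = carrier G" using sup[OF K(3) _ iB] unfolding atoms_def by blast
    then show "carrier G \<subseteq> B <#> T" using mono_set_mult[of B B S T G] T(3) by simp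
  qed
  \<comment> \<open>G/A is isomorphic to B/K and so nilpotent. A maximal subgroup above AT would be
    normal of prime power index, hence supplemented by S; but it contains S.\<close>
  have AT: "A <#> T = carrier G"
  proof (rule ccontr)
    assume neqA: "A <#> T \<noteq> carrier G"
    note AT = normal_set_mult_sub[OF K(2) T(1,4)]
    let ?P = "\<lambda>M. sub M \<and> A <#> T \<subseteq> M \<and> M \<noteq> carrier G"
    have "\<forall>M. ?P M \<longrightarrow> card M < Suc (card (carrier G))"
      using card_mono[OF fin sub_carrier] by (auto simp: less_Suc_eq_le)
    moreover have "?P (A <#> T)" using AT(1) neqA by simp
    ultimately obtain M where M: "sub M" "A <#> T \<subseteq> M" "M \<noteq> carrier G"
      and max: "\<And>L. ?P L \<Longrightarrow> card L \<le> card M"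
      using ex_has_greatest_nat[of ?P "A <#> T" card "Suc (card (carrier G))"] by blast
    have maxM: "L = carrier G \<or> L = M" if L: "sub L" "M \<subseteq> L" for L
    proof (rule disjCI)
      assume "L \<noteq> M"
      then have "card M < card L" using L sub_fin by (intro psubset_card_mono) auto
      then have "\<not> card L \<le> card M" by simp
      then have "\<not> ?P L" using max[of L] by blast
      then show "L = carrier G" using L M(2) by blast
    qed
    have AM: "A \<subseteq> M" "T \<subseteq> M" using AT(2,3) M(2) by blast+
    have KM: "K \<subseteq> M" using KA AM by blast
    have "\<not> lcs B 0 \<subseteq> M"
    proof
      assume "lcs B 0 \<subseteq> M"
      then have "A <#> B \<subseteq> M" using set_mult_least[OF M(1) AM(1)] by simp
      then show False using K(5) M(3) sub_carrier[OF M(1)] by blast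
    qed
    moreover have "lcs B n \<subseteq> M" using K(8) KM by blast
    \<comment> \<open>The last term of the series not inside M provides an x outside M that
      normalizes M, since M contains A and the commutators of x with B.\<close>
    ultimately obtain i where i: "\<not> lcs B i \<subseteq> M" "lcs B (Suc i) \<subseteq> M"
      using ex_least_nat_less[of "\<lambda>k. lcs B k \<subseteq> M" n] by blast
    obtain x where x: "x \<in> lcs B i" "x \<notin> M" using i(1) by blast
    have xB: "x \<in> B" using lcs_sub(2)[OF B(1)] x(1) by blast
    have xc: "x \<in> carrier G" using Bm(1)[OF xB] .
    have nx: "cj x M = M"
    proof (rule cj_eqI[OF M(1) xc], rule subsetI)
      fix z assume "z \<in> cj x M"
      then obtain m where m: "m \<in> M" "z = inv x \<otimes> m \<otimes> x" unfolding cj_def by blast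
      have "m \<in> A <#> B" using m(1) sub_memD(1)[OF M(1)] K(5) by simp
      then obtain a b where ab: "a \<in> A" "b \<in> B" "m = a \<otimes> b" using set_mult_mem by blast
      have c: "a \<in> carrier G" "b \<in> carrier G" using Am(1) Bm(1) ab by blast+
      have 1: "inv x \<otimes> a \<otimes> x \<in> M" using normalizes_elem[OF A(4) xc ab(1)] AM(1) by blast
      have "inv x \<otimes> inv b \<otimes> x \<otimes> b \<in> lcs B (Suc i)"
        unfolding lcs.simps by (rule generate.incl) (use x(1) ab(2) in blast)
      then have com: "inv x \<otimes> inv b \<otimes> x \<otimes> b \<in> M" using i(2) by blast
      have bM: "b \<in> M"
      proof -
        have "inv a \<otimes> m \<in> M" using ab(1) AM(1) m(1) sub_memD[OF M(1)] by blast
        then show ?thesis unfolding ab(3) using c by simp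
      qed
      have "inv (inv x \<otimes> inv b \<otimes> x \<otimes> b) \<in> M" using com sub_memD(2)[OF M(1)] by blast
      then have "b \<otimes> inv (inv x \<otimes> inv b \<otimes> x \<otimes> b) \<in> M" using bM sub_memD(3)[OF M(1)] by blast
      then have 2: "(inv x \<otimes> a \<otimes> x) \<otimes> (b \<otimes> inv (inv x \<otimes> inv b \<otimes> x \<otimes> b)) \<in> M"
        using 1 sub_memD(3)[OF M(1)] by blast
      have "(inv x \<otimes> a \<otimes> x) \<otimes> (b \<otimes> inv (inv x \<otimes> inv b \<otimes> x \<otimes> b)) = z"
        unfolding m(2) ab(3) using c xc by (simp add: m_assoc inv_mult_group)
      then show "z \<in> M" using 2 by simp
    qed
    have nM: "nml M (carrier G)"
    proof -
      note n = normalizer_in_sub[OF sub_carrier_self sub_carrier[OF M(1)]]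
        normalizer_in_nml[OF sub_carrier_self M(1) sub_carrier[OF M(1)]]
      have "x \<in> normalizer_in (carrier G) M" unfolding normalizer_in_def using xc nx by blast
      then have "normalizer_in (carrier G) M \<noteq> M" using x(2) by blast
      then have "normalizer_in (carrier G) M = carrier G" using maxM[OF n(1) nmlD(3)[OF n(2)]] by blast
      then show ?thesis using n(2) by simp
    qed
    have "idx (carrier G) M \<noteq> 1" using idx_1D[OF sub_carrier_self M(1) sub_carrier[OF M(1)]] M(3) by blast
    \<comment> \<open>For a prime p dividing the index, M and a Sylow p-subgroup generate G by
      maximality of M, so the index is a power of p.\<close>
    then obtain p where p: "prime p" "p dvd idx (carrier G) M" using prime_factor_nat by blast
    have "idx (carrier G) M dvd idx (carrier G) A"
      by (rule idx_dvd_l[OF sub_carrier_self M(1) A(1) AM(1) sub_carrier[OF M(1)]])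
    then have p\<pi>: "p \<notin> \<pi>" using p pi_number_dvd[OF iA] unfolding pi_number_def by blast
    obtain P where P: "sub P" "P \<subseteq> carrier G" "card P = p ^ multiplicity p (card (carrier G))" "\<not> p dvd idx (carrier G) P"
      using sylow_exists[OF sub_carrier_self p(1)] by blast
    have "\<not> P \<subseteq> M"
      using idx_dvd_l[OF sub_carrier_self M(1) P(1) _ sub_carrier[OF M(1)]] p(2) P(4) dvd_trans by blast
    then have "M <#> P = carrier G"
      using maxM[OF normal_set_mult_sub(1,2)[OF nM P(1,2)]] normal_set_mult_sub(3)[OF nM P(1,2)] by blast
    then have "idx (carrier G) M = idx P (M \<inter> P)" using idx_set_mult[OF M(1) P(1)] by simp
    moreover have "card P = idx P (M \<inter> P) * card (M \<inter> P)" using idx_card[OF P(1) sub_Int[OF M(1) P(1)]] by simp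
    ultimately have "idx (carrier G) M dvd p ^ multiplicity p (card (carrier G))" using P(3) by (metis dvd_triv_left)
    then have "pi_number {p} (idx (carrier G) M)" using pi_number_dvd[OF pi_number_prime_powerI[OF p(1)]] by blast
    moreover have "{p} \<in> atoms \<pi>" unfolding atoms_def using p(1) p\<pi> by blast
    ultimately have "M <#> S = carrier G" using sup[OF nM] by blast
    moreover have "M <#> S = M" using set_mult_absorb[OF M(1) assms(2)] T(3) AM(2) by blast
    ultimately show False using M(3) by simp
  qed
  have "idx (carrier G) T dvd idx A K"
  proof -
    have nTA: "normalizes T A" using normalizes_mono[OF A(4) T(4)] .
    have "T <#> A = carrier G" using set_mult_commute_nml[OF A(1) T(1) nTA] AT by simp
    then have "idx (carrier G) T = idx A (T \<inter> A)" using idx_set_mult[OF T(1) A(1)] by simp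
    also have "\<dots> dvd idx A K"
      by (rule idx_dvd_l[OF A(1) sub_Int[OF T(1) A(1)] nmlD(1)[OF K(1)]]) (use T(2) KA in auto)
    finally show ?thesis .
  qed
  moreover have "idx (carrier G) T dvd idx B K"
  proof -
    have nTB: "normalizes T B" using normalizes_mono[OF B(4) T(4)] .
    have "T <#> B = carrier G" using set_mult_commute_nml[OF B(1) T(1) nTB] BT by simp
    then have "idx (carrier G) T = idx B (T \<inter> B)" using idx_set_mult[OF T(1) B(1)] by simp
    also have "\<dots> dvd idx B K"
      by (rule idx_dvd_l[OF B(1) sub_Int[OF T(1) B(1)] nmlD(1)[OF K(1)]]) (use T(2) KA in auto)
    finally show ?thesis .
  qed
  ultimately have "idx (carrier G) T = 1"
    using pi_number_disjoint[of \<pi> _ "- \<pi>"] pi_number_dvd[OF K(6)] pi_number_dvd[OF K(7)] by blast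
  then show False using idx_1D[OF sub_carrier_self T(1,4)] neq unfolding T_def by blast
qed

section \<open>Sylow subgroups that reduce into a given subgroup\<close>

lemma sylow_idx:
  assumes "sub H" "sub P" "P \<subseteq> H" "card P = p ^ multiplicity p (card H)" "prime p"
  shows "\<not> p dvd idx H P"
proof
  assume "p dvd idx H P"
  then obtain k where k: "idx H P = p * k" by blast
  define m where "m = multiplicity p (card H)"
  have "card H = p * k * p ^ m"
    using idx_card[OF assms(1-3)] assms(4) k unfolding m_def by simp
  then have "p ^ Suc m dvd card H" by simp
  then have "p ^ Suc (multiplicity p (card H)) dvd card H" unfolding m_def .
  moreover have "\<not> is_unit p" "card H \<noteq> 0" using assms(5) card_sub_pos[OF assms(1)] by (auto simp: prime_nat_iff)
  ultimately show False using multiplicity_geI by (metis Suc_n_not_le_n)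
qed

lemma sylow_cardI:
  assumes "sub H" "sub P" "P \<subseteq> H" "card P = p ^ k" "prime p" "\<not> p dvd idx H P"
  shows "card P = p ^ multiplicity p (card H)"
proof -
  have e: "card H = p ^ k * idx H P" using idx_card[OF assms(1-3)] assms(4) by simp
  have "multiplicity p (card H) = k"
  proof (rule multiplicity_eqI)
    show "p ^ k dvd card H" using e by simp
    show "\<not> p ^ Suc k dvd card H" unfolding e using assms(5,6) by (simp add: prime_gt_0_nat mult.commute)
  qed
  then show ?thesis using assms(4) by simp
qed

lemma p_subgroup_card:
  assumes "sub P" "card P = p ^ k" "prime p" "sub Q" "Q \<subseteq> P"
  shows "\<exists>j. card Q = p ^ j"
  using lagrange_dvd[OF assms(1,4,5)] assms(2,3) divides_primepow_nat by metis

lemma sylow_above: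
  assumes "sub H" "sub Q" "Q \<subseteq> H" "card Q = p ^ k" "prime p"
  shows "\<exists>P. sub P \<and> P \<subseteq> H \<and> Q \<subseteq> P \<and> card P = p ^ multiplicity p (card H)"
proof -
  obtain S where S: "sub S" "S \<subseteq> H" "card S = p ^ multiplicity p (card H)" "\<not> p dvd idx H S"
    using sylow_exists[OF assms(1,5)] by blast
  obtain h where h: "h \<in> H" "cj h Q \<subseteq> S" using p_subgroup_conj_into[OF assms(1) S(1,2) assms(2-5) S(4)] by blast
  have hc: "h \<in> carrier G" "inv h \<in> H" using h(1) sub_memD[OF assms(1)] by blast+
  have "Q \<subseteq> cj (inv h) S" using cj_mono[OF h(2), of "inv h"] hc sub_carrier[OF assms(2)] by simp
  moreover have "cj (inv h) S \<subseteq> H" using cj_subset_sub[OF assms(1) hc(2) S(2)] .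
  moreover have "sub (cj (inv h) S)" "card (cj (inv h) S) = card S"
    using sub_cj[OF _ S(1)] card_cj[OF _ sub_carrier[OF S(1)]] hc by simp_all
  ultimately show ?thesis using S(3) by metis
qed

text \<open>A Sylow subgroup of N is extended to one of H, so for every prime the conditions in the
  definition of Dnormality have an instance.\<close>

lemma sylow_reducing_exists:
  assumes "sub N" "N \<subseteq> H" "sub H" "prime p"
  shows "\<exists>P. sub P \<and> P \<subseteq> H \<and> card P = p ^ multiplicity p (card H) \<and> card (P \<inter> N) = p ^ multiplicity p (card N)"
proof -
  obtain S where S: "sub S" "S \<subseteq> N" "card S = p ^ multiplicity p (card N)" "\<not> p dvd idx N S"
    using sylow_exists[OF assms(1,4)] by blast
  have SH: "S \<subseteq> H" using S(2) assms(2) by blast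
  obtain P where P: "sub P" "P \<subseteq> H" "S \<subseteq> P" "card P = p ^ multiplicity p (card H)"
    using sylow_above[OF assms(3) S(1) SH S(3) assms(4)] by blast
  have PN: "sub (P \<inter> N)" using sub_Int[OF P(1) assms(1)] .
  obtain j where j: "card (P \<inter> N) = p ^ j" using p_subgroup_card[OF P(1,4) assms(4) PN] by blast
  have "idx N (P \<inter> N) dvd idx N S" using S P(3) by (intro idx_dvd_l[OF assms(1) PN]) auto
  then have "\<not> p dvd idx N (P \<inter> N)" using S(4) dvd_trans by blast
  then have "card (P \<inter> N) = p ^ multiplicity p (card N)"
    using sylow_cardI[OF assms(1) PN _ j assms(4)] by blast
  then show ?thesis using P by blast
qed

text \<open>No prime can divide the index of a subgroup that contains a Sylow subgroup for each
  prime.\<close>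

lemma eq_if_contains_sylows:
  assumes "sub H" "sub X" "X \<subseteq> H"
    and "\<And>p. prime p \<Longrightarrow> \<exists>P. sub P \<and> P \<subseteq> X \<and> card P = p ^ multiplicity p (card H)"
  shows "X = H"
proof (rule ccontr)
  assume "X \<noteq> H"
  then have "idx H X \<noteq> 1" using idx_1D[OF assms(1-3)] by blast
  then obtain p where p: "prime p" "p dvd idx H X" using prime_factor_nat by blast
  obtain P where P: "sub P" "P \<subseteq> X" "card P = p ^ multiplicity p (card H)" using assms(4)[OF p(1)] by blast
  have PH: "P \<subseteq> H" using P(2) assms(3) by blast
  have "idx H X dvd idx H P" by (rule idx_dvd_l[OF assms(1,2) P(1,2) assms(3)])
  then show False using p sylow_idx[OF assms(1) P(1) PH P(3) p(1)] dvd_trans by blast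
qed

text \<open>For \<pi> = {q} both clauses of Dnormality put a reducing Sylow subgroup into the
  normalizer of N, and such a subgroup exists for every prime.\<close>

lemma Dnormal_nml:
  assumes "Npi_Dnormal \<pi> N G" "\<forall>p\<in>\<pi>. prime p" "\<pi> = {q}"
  shows "nml N (carrier G)"
proof -
  have D: "sub N" "N \<subseteq> carrier G" "\<And>p P. prime p \<Longrightarrow> sub P \<Longrightarrow> P \<subseteq> carrier G \<Longrightarrow>
      card P = p ^ multiplicity p (card (carrier G)) \<Longrightarrow> card (P \<inter> N) = p ^ multiplicity p (card N) \<Longrightarrow> normalizes P N"
    using assms(1) Npi_Dnormal_iff[OF sub_carrier_self, of \<pi> N] unfolding assms(3) by auto
  note n = normalizer_in_sub[OF sub_carrier_self D(2)] normalizer_in_nml[OF sub_carrier_self D(1,2)]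
  have "normalizer_in (carrier G) N = carrier G"
  proof (rule eq_if_contains_sylows[OF sub_carrier_self n(1) normalizer_in_subset])
    fix p :: nat assume p: "prime p"
    obtain P where P: "sub P" "P \<subseteq> carrier G" "card P = p ^ multiplicity p (card (carrier G))"
      "card (P \<inter> N) = p ^ multiplicity p (card N)" using sylow_reducing_exists[OF D(1,2) sub_carrier_self p] by blast
    have "P \<subseteq> normalizer_in (carrier G) N"
      using D(3)[OF p P] normalizes_iff_normalizer_in[OF P(2)] by blast
    then show "\<exists>P. sub P \<and> P \<subseteq> normalizer_in (carrier G) N \<and> card P = p ^ multiplicity p (card (carrier G))"
      using P(1,3) by blast
  qed
  then show ?thesis using n(2) by simp
qed

text \<open>Every Sylow \<open>p\<close>-subgroup with \<open>p \<notin> \<pi>\<close> reduces into \<open>N\<close>, because \<open>O\<^sup>\<pi>(N)\<close> is normal in \<open>G\<close> and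
  contains all \<open>\<pi>'\<close>-elements of \<open>N\<close>; hence \<open>O\<^sup>\<pi>(G)\<close> normalizes \<open>N\<close>.\<close>

lemma Dnormal_normalized_by_residual:
  assumes "Npi_Dnormal \<pi> N G" "\<And>q. \<pi> \<noteq> {q}"
  shows "sub N" "normalizes (residual \<pi> (carrier G)) N"
proof -
  let ?C = "carrier G" and ?R = "residual \<pi> N"
  have D: "sub N" "N \<subseteq> ?C"
    and D1: "\<And>p P. prime p \<Longrightarrow> p \<notin> \<pi> \<Longrightarrow> sub P \<Longrightarrow> P \<subseteq> ?C \<Longrightarrow>
      card P = p ^ multiplicity p (card ?C) \<Longrightarrow> card (P \<inter> N) = p ^ multiplicity p (card N) \<Longrightarrow> normalizes P N"
    and D2: "\<And>p P. p \<in> \<pi> \<Longrightarrow> sub P \<Longrightarrow> P \<subseteq> ?C \<Longrightarrow>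
      card P = p ^ multiplicity p (card ?C) \<Longrightarrow> card (P \<inter> N) = p ^ multiplicity p (card N) \<Longrightarrow> normalizes P ?R"
    using assms Npi_Dnormal_iff[OF sub_carrier_self, of \<pi> N] by auto
  show "sub N" using D(1) .
  note R = residual_sub[OF D(1), of \<pi>]
  have Rc: "?R \<subseteq> ?C" using sub_carrier[OF R(1)] .
  \<comment> \<open>For p outside \<pi> a reducing Sylow subgroup normalizes N and therefore its
    characteristic subgroup; for p in \<pi> this is the second clause of Dnormality.\<close>
  have nR: "nml ?R ?C"
  proof -
    note n = normalizer_in_sub[OF sub_carrier_self Rc] normalizer_in_nml[OF sub_carrier_self R(1) Rc]
    have "normalizer_in ?C ?R = ?C"
    proof (rule eq_if_contains_sylows[OF sub_carrier_self n(1) normalizer_in_subset])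
      fix p :: nat assume p: "prime p"
      obtain P where P: "sub P" "P \<subseteq> ?C" "card P = p ^ multiplicity p (card ?C)"
        "card (P \<inter> N) = p ^ multiplicity p (card N)" using sylow_reducing_exists[OF D(1,2) sub_carrier_self p] by blast
      have "normalizes P ?R"
      proof (cases "p \<in> \<pi>")
        case True
        then show ?thesis using D2[OF _ P] by blast
      next
        case False
        then have "normalizes P N" using D1[OF p _ P] by blast
        then show ?thesis unfolding normalizes_def using residual_cj[OF D(1)] P(2) by blast
      qed
      then show "\<exists>P. sub P \<and> P \<subseteq> normalizer_in ?C ?R \<and> card P = p ^ multiplicity p (card ?C)"
        using P normalizes_iff_normalizer_in[OF P(2)] by blast
    qed
    then show ?thesis using n(2) by simp
  qed
  have nRN: "nml ?R N" using residual_nml[OF nml_self[OF D(1)]] .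
  have iNR: "pi_number \<pi> (idx N ?R)" using residual_index[OF D(1)] .
  define X where "X = normalizer_in ?C N"
  have X: "sub X" "X \<subseteq> ?C" unfolding X_def using normalizer_in_sub[OF sub_carrier_self D(2)] normalizer_in_subset .
  have pX: "Q \<subseteq> X" if p: "prime p" "p \<notin> \<pi>" and Q: "sub Q" "card Q = p ^ k" for p Q k
  proof -
    obtain P where P: "sub P" "P \<subseteq> ?C" "Q \<subseteq> P" "card P = p ^ multiplicity p (card ?C)"
      using sylow_above[OF sub_carrier_self Q(1) sub_carrier[OF Q(1)] Q(2) p(1)] by blast
    have PN: "sub (P \<inter> N)" using sub_Int[OF P(1) D(1)] .
    obtain j where j: "card (P \<inter> N) = p ^ j" using p_subgroup_card[OF P(1,4) p(1) PN] by blast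
    have "P \<inter> N \<subseteq> ?R"
    proof
      fix x assume x: "x \<in> P \<inter> N"
      have "pi_number {p} (ord x)"
        using pi_number_dvd[OF pi_number_prime_powerI[OF p(1)]] ord_dvd_card[OF P(1), of x] x P(4) by simp
      then have "pi_number (- \<pi>) (ord x)" using pi_number_mono[of "{p}" _ "- \<pi>"] p(2) by blast
      then show "x \<in> ?R" using pi_element_in_normal[OF nRN iNR] x by blast
    qed
    \<comment> \<open>P \<inter> N is thus the intersection of P with a normal subgroup of G, hence
      Sylow there, and the \<pi>-index above it contributes no factor p.\<close>
    then have e: "P \<inter> N = ?R \<inter> P" using R(2) by blast
    note RP = normal_set_mult_sub[OF nR P(1,2)]
    have nPR: "P <#> ?R = ?R <#> P" using RP(6) by simp
    have "idx ?R (P \<inter> ?R) = idx (P <#> ?R) P" using idx_set_mult[OF P(1) R(1)] by simp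
    also have "\<dots> dvd idx ?C P" unfolding nPR by (rule idx_dvd_r[OF sub_carrier_self RP(1) P(1) RP(3,4)])
    finally have "\<not> p dvd idx ?R (P \<inter> ?R)"
      using sylow_idx[OF sub_carrier_self P(1,2,4) p(1)] dvd_trans by blast
    moreover have "\<not> p dvd idx N ?R" using iNR p unfolding pi_number_def by blast
    moreover have "idx N (P \<inter> N) = idx N ?R * idx ?R (P \<inter> ?R)"
      using idx_trans[OF D(1) R(1) sub_Int[OF P(1) R(1)] Int_lower2 R(2)] e by (simp add: Int_commute)
    ultimately have "\<not> p dvd idx N (P \<inter> N)" using p(1) by (simp add: prime_dvd_mult_iff)
    then have "card (P \<inter> N) = p ^ multiplicity p (card N)"
      using sylow_cardI[OF D(1) PN Int_lower2 j p(1)] by blast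
    then have "normalizes P N" using D1[OF p P(1,2,4)] by blast
    then show ?thesis unfolding X_def using normalizes_iff_normalizer_in[OF P(2)] P(3) by blast
  qed
  have "residual \<pi> ?C \<subseteq> X"
    unfolding residual_def
  proof (rule generate_subgroup_incl[OF subsetI X(1)])
    fix x assume "x \<in> {x \<in> ?C. pi_number (- \<pi>) (ord x)}"
    then have x: "x \<in> ?C" "pi_number (- \<pi>) (ord x)" by blast+
    let ?L = "generate G {x}"
    have L: "sub ?L" "card ?L = ord x"
      using generate_is_subgroup[of "{x}"] generate_pow_card[OF x(1)] x(1) by simp_all
    have LX: "sub (?L \<inter> X)" using sub_Int[OF L(1) X(1)] .
    \<comment> \<open>The cyclic group generated by a \<pi>'-element has non-trivial Sylow subgroups
      only for primes outside \<pi>, and these lie in X.\<close>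
    have "?L \<inter> X = ?L"
    proof (rule eq_if_contains_sylows[OF L(1) LX Int_lower1])
      fix p :: nat assume p: "prime p"
      obtain Q where Q: "sub Q" "Q \<subseteq> ?L" "card Q = p ^ multiplicity p (card ?L)"
        using sylow_exists[OF L(1) p] by blast
      have "Q \<subseteq> X"
      proof (cases "p \<in> \<pi>")
        case True
        then have "\<not> p dvd card ?L" using x(2) L(2) p unfolding pi_number_def by auto
        then have "card Q = 1" using Q(3) by (simp add: not_dvd_imp_multiplicity_0)
        then have "Q = {\<one>}" using one_in[OF Q(1)] by (metis card_1_singletonE singletonD)
        then show ?thesis using one_in[OF X(1)] by simp
      next
        case False
        then show ?thesis using pX[OF p _ Q(1,3)] by blast
      qed
      then show "\<exists>P. sub P \<and> P \<subseteq> ?L \<inter> X \<and> card P = p ^ multiplicity p (card ?L)" using Q by blast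
    qed
    moreover have "x \<in> ?L" by (rule generate.incl) simp
    ultimately show "x \<in> X" by blast
  qed
  then show "normalizes (residual \<pi> ?C) N"
    unfolding X_def using normalizes_iff_normalizer_in[of "residual \<pi> ?C" ?C N] normalizer_in_subset by blast
qed

end

section \<open>Normalizers of injectors and intersections with subgroups above a residual\<close>

context fitting_setup
begin

text \<open>Frattini argument: every conjugate of V is an injector of G again, and by
  \<open>is_injector_conj_over\<close> it is conjugate to V under M.\<close>

lemma injector_normalizer_supplement:
  assumes "is_injector (carrier G) V" "nml M (carrier G)" "\<rho> \<in> \<A>" "pi_number \<rho> (idx (carrier G) M)"
  shows "M <#> normalizer_in (carrier G) V = carrier G"
proof -
  note M = nmlD[OF assms(2)]
  have V: "sub V" using assms(1) unfolding is_injector_def by blast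
  have Vc: "V \<subseteq> carrier G" using sub_carrier[OF V] .
  let ?X = "normalizer_in (carrier G) V"
  have X: "sub ?X" using normalizer_in_sub[OF sub_carrier_self Vc] .
  note MX = normal_set_mult_sub[OF assms(2) X sub_carrier[OF X]]
  have uniq: "\<exists>k\<in>M. cj k U = W" if "is_injector M U" "is_injector M W" for U W
    using injectors_exist_conj[OF M(1)] that by blast
  have "carrier G \<subseteq> M <#> ?X"
  proof
    fix g assume g: "g \<in> carrier G"
    have "is_injector (carrier G) (cj g V)"
      using is_injector_cj[OF assms(1) g sub_carrier_self] cj_self[OF sub_carrier_self g] by simp
    then obtain m where m: "m \<in> M" "cj m (cj g V) = V"
      using is_injector_conj_over[OF assms(2-4) uniq _ assms(1)] by blast
    have mc: "m \<in> carrier G" using m(1) sub_memD(1)[OF M(1)] by blast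
    have "cj (g \<otimes> m) V = V" using m(2) cj_mult[OF g mc Vc] by simp
    then have "g \<otimes> m \<in> ?X" unfolding normalizer_in_def using g mc by blast
    then have "(g \<otimes> m) \<otimes> inv m \<in> M <#> ?X"
      by (rule sub_memD(3)[OF MX(1) subsetD[OF MX(3)] subsetD[OF MX(2) sub_memD(2)[OF M(1) m(1)]]])
    then show "g \<in> M <#> ?X" using g mc by (simp add: m_assoc)
  qed
  then show ?thesis using MX(4) by blast
qed

lemma injector_Int_over_quotient:
  assumes "is_injector (carrier G) I" "nml K (carrier G)" "\<rho> \<in> \<A>" "pi_number \<rho> (idx (carrier G) K)"
    and L: "sub L" "K \<subseteq> L"
    and between: "\<And>W J S. \<lbrakk>nml W J; J \<in> \<F>; pi_number \<rho> (idx J W); sub S; W \<subseteq> S; S \<subseteq> J\<rbrakk> \<Longrightarrow> S \<in> \<F>"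
  shows "is_injector L (I \<inter> L)"
proof -
  note K = nmlD[OF assms(2)]
  have Lc: "L \<subseteq> carrier G" using sub_carrier[OF L(1)] .
  have nKL: "nml K L" using nml_restrict[OF assms(2) L Lc] .
  have iI: "is_injector K (I \<inter> K)" using is_injector_subnormal[OF assms(1) subnormal_in_nml[OF assms(2)]] .
  obtain Y0 where Y0: "is_injector L Y0" using injectors_exist_conj[OF L(1)] by blast
  obtain r where r: "r \<in> K" "cj r (Y0 \<inter> K) = I \<inter> K"
    using injectors_exist_conj[OF K(1)] is_injector_subnormal[OF Y0 subnormal_in_nml[OF nKL]] iI by blast
  have rL: "r \<in> L" "r \<in> carrier G" using r(1) L(2) Lc by blast+
  define Y where "Y = cj r Y0"
  have Y: "is_injector L Y" unfolding Y_def using is_injector_cj[OF Y0 rL(2) L(1)] cj_self[OF L(1) rL(1)] by simp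
  have FY: "Fmax L Y" using is_injector_Fmax[OF Y L(1)] .
  note Y' = FmaxD[OF FY]
  have FI: "Fmax K (I \<inter> K)" using is_injector_Fmax[OF iI K(1)] .
  have WY: "I \<inter> K \<subseteq> Y" unfolding Y_def r(2)[symmetric] by (rule cj_mono) blast
  have Yc: "Y \<subseteq> carrier G" using sub_carrier[OF Y'(4)] .
  obtain V where V: "Fmax (carrier G) V" "Y \<subseteq> V" using Fmax_exists[OF sub_carrier_self Y'(1) Yc] by blast
  note V' = FmaxD[OF V(1)]
  have WV: "I \<inter> K \<subseteq> V" using WY V(2) by blast
  obtain k where k: "k \<in> K" "cj k V = I"
    using Fmax_over_conj[OF assms(2-4) FI V(1) WV is_injector_Fmax[OF assms(1) sub_carrier_self]] by blast
  have sVL: "sub (V \<inter> L)" using sub_Int[OF V'(4) L(1)] .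
  have "nml (V \<inter> K) V" using nml_Int_sub[OF assms(2) V'(4,2)] by (simp add: Int_commute)
  moreover have "pi_number \<rho> (idx V (V \<inter> K))"
    using idx_Int_dvd[OF assms(2) V'(4,2)] assms(4) pi_number_dvd by blast
  \<comment> \<open>The one place where \<open>between\<close> enters: V \<inter> L lies between V
    \<inter> K and V, and maximality of Y in L then gives V \<inter> L = Y.\<close>
  ultimately have "V \<inter> L \<in> \<F>" using between[OF _ V'(1) _ sVL] L(2) by blast
  then have VL: "V \<inter> L = Y" using Y'(3)[of "V \<inter> L"] V(2) Y'(2) by blast
  have kL: "k \<in> L" "k \<in> carrier G" using k(1) L(2) Lc by blast+
  have "cj k Y = I \<inter> L"
    unfolding VL[symmetric] cj_Int[OF kL(2) sub_carrier[OF V'(4)] Lc] k(2) cj_self[OF L(1) kL(1)] ..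
  then show ?thesis using is_injector_cj[OF Y kL(2) L(1)] cj_self[OF L(1) kL(1)] by simp
qed

end

theorem theorem2p10:
  fixes G :: "('a, 'b) monoid_scheme" and \<pi> :: "nat set" and \<F> :: "'a set set"
  assumes "group G" and "finite (carrier G)"
    and "\<forall>p\<in>\<pi>. prime p"
    and "pi_soluble (compl_primes \<pi>) G"
    and "Npi_Fitting_set \<pi> G \<F>"
  shows "(\<exists>V. {W. injector G \<F> (carrier G) W} = {conj_set G V x | x. x \<in> carrier G} \<and>
              injector G \<F> (carrier G) V) \<and>
    (\<forall>V W. injector G \<F> (carrier G) V \<longrightarrow> injector G \<F> (carrier G) W \<longrightarrow>
      (\<exists>g\<in>Npi_residual \<pi> G. conj_set G W g = V)) \<and>
    (\<forall>I N. injector G \<F> (carrier G) I \<longrightarrow> Npi_Dnormal \<pi> N G \<longrightarrow>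
      injector G \<F> N (I \<inter> N))"
proof (intro conjI allI impI)
  interpret fitting_setup G "atoms \<pi>" \<F> by (rule Npi_Fitting_set_setup(1)[OF assms])
  let ?C = "carrier G"
  have injG: "injector G \<F> ?C V \<longleftrightarrow> is_injector ?C V" for V using injector_iff[OF sub_carrier_self] .
  have injD: "sub V" "V \<subseteq> ?C" if "is_injector ?C V" for V using that unfolding is_injector_def by blast+
  show "\<exists>V. {W. injector G \<F> ?C W} = {conj_set G V x | x. x \<in> ?C} \<and> injector G \<F> ?C V"
  proof -
    obtain V where V: "is_injector ?C V" and conj: "\<And>W. is_injector ?C W \<Longrightarrow> \<exists>h\<in>?C. cj h V = W"
      using injectors_exist_conj[OF sub_carrier_self] by blast
    have "{W. is_injector ?C W} = {conj_set G V x | x. x \<in> ?C}"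
    proof (intro subset_antisym subsetI)
      fix W assume "W \<in> {W. is_injector ?C W}"
      then obtain h where h: "h \<in> ?C" "cj h V = W" using conj by blast
      then have "W = conj_set G V h" using conj_set_eq[OF h(1) injD(2)[OF V]] by simp
      then show "W \<in> {conj_set G V x | x. x \<in> ?C}" using h(1) by blast
    next
      fix W assume "W \<in> {conj_set G V x | x. x \<in> ?C}"
      then obtain x where x: "x \<in> ?C" "W = conj_set G V x" by blast
      then have "W = cj x V" using conj_set_eq[OF x(1) injD(2)[OF V]] by simp
      then show "W \<in> {W. is_injector ?C W}"
        using is_injector_cj[OF V x(1) sub_carrier_self] cj_self[OF sub_carrier_self x(1)] by simp
    qed
    then show ?thesis using V unfolding injG by blast
  qed
  show "\<exists>g\<in>Npi_residual \<pi> G. conj_set G W g = V"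
    if "injector G \<F> ?C V" "injector G \<F> ?C W" for V W
  proof -
    have V: "is_injector ?C V" and W: "is_injector ?C W" using that injG by blast+
    let ?X = "normalizer_in ?C W" and ?K = "Npi_residual \<pi> G"
    have X: "sub ?X" using normalizer_in_sub[OF sub_carrier_self injD(2)[OF W]] .
    have K: "nml ?K ?C" using Npi_residual_normal unfolding Npi_normal_def by blast
    have "?K <#>\<^bsub>G\<^esub> ?X = ?C"
      using Npi_normal_supplement[OF Npi_residual_normal X] injector_normalizer_supplement[OF W] by blast
    then have XK: "?X <#>\<^bsub>G\<^esub> ?K = ?C" using normal_set_mult_sub(6)[OF K X sub_carrier[OF X]] by simp
    obtain g where g: "g \<in> ?C" "cj g W = V" using injectors_exist_conj[OF sub_carrier_self] V W by blast
    \<comment> \<open>The normalizing factor comes first, so it acts on W trivially and only k in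
      the residual remains.\<close>
    then obtain x k where xk: "x \<in> ?X" "k \<in> ?K" "g = x \<otimes>\<^bsub>G\<^esub> k" using XK set_mult_mem[of g ?X ?K] by blast
    have c: "x \<in> ?C" "k \<in> ?C" using sub_memD(1)[OF X xk(1)] sub_memD(1)[OF nmlD(1)[OF K] xk(2)] .
    have "cj k (cj x W) = V" using g(2) cj_mult[OF c injD(2)[OF W]] xk(3) by simp
    moreover have "cj x W = W" using xk(1) unfolding normalizer_in_def by blast
    ultimately have "conj_set G W k = V" using conj_set_eq[OF c(2) injD(2)[OF W]] by simp
    then show ?thesis using xk(2) by blast
  qed
  show "injector G \<F> N (I \<inter> N)" if "injector G \<F> ?C I" and D: "Npi_Dnormal \<pi> N G" for I N
  proof -
    have I: "is_injector ?C I" using that injG by blast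
    have "sub N \<and> is_injector N (I \<inter> N)"
    proof (cases "\<exists>q. \<pi> = {q}")
      case True
      then have "nml N ?C" using Dnormal_nml[OF D assms(3)] by blast
      then show ?thesis using is_injector_subnormal[OF I subnormal_in_nml] nmlD(1) by blast
    next
      case False
      then have nq: "\<pi> \<noteq> {q}" for q by blast
      note N = Dnormal_normalized_by_residual[OF D nq]
      let ?R = "residual \<pi> ?C"
      have R: "nml ?R ?C" using residual_nml[OF nml_self[OF sub_carrier_self]] .
      have num: "pi_number \<pi> (idx ?C ?R)" using residual_index[OF sub_carrier_self] .
      have at: "\<pi> \<in> atoms \<pi>" unfolding atoms_def by blast
      \<comment> \<open>N is normal in L because the residual normalizes N, and L contains the
        residual; so I is first cut down to L and then to N.\<close>
      define L where "L = N <#>\<^bsub>G\<^esub> ?R"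
      have L: "sub L" "?R \<subseteq> L" "nml N L"
        unfolding L_def using sub_set_mult[OF N(1) nmlD(1)[OF R] N(2)] set_mult_upper(2)[OF N(1) nmlD(1)[OF R]]
          nml_in_set_mult[OF N(1) nmlD(1)[OF R] N(2)] .
      have "is_injector L (I \<inter> L)"
        using Npi_Fitting_set_setup(2)[OF assms] nq
        by (intro injector_Int_over_quotient[OF I R at num L(1,2)]) blast
      then have "is_injector N (I \<inter> L \<inter> N)" using is_injector_subnormal[OF _ subnormal_in_nml[OF L(3)]] by blast
      moreover have "I \<inter> L \<inter> N = I \<inter> N" using nmlD(3)[OF L(3)] by blast
      ultimately show ?thesis using N(1) by simp
    qed
    then show ?thesis using injector_iff by blast
  qed
qed

end
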